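(* Let $\Gamma=R_{2n}(n+2,n+1)$ be a Rose Window graph with $n\ge3$. Then $\Gamma$ is the underlying graph of a map of class $2_{\{0,1\}}$ if and only if $\gcd(n,12)>2$. Moreover, letting $n_0\in\{0,3,4,6,8,9\}$ be the residue of $n$ modulo $12$: (i) if $n=4$, $\Gamma$ is the underlying graph of a unique map of class $2_{\{0,1\}}$, with face lengths $4$ and $8$; (ii) if $n_0\in\{3,9\}$, $\Gamma$ is the underlying graph of exactly three nonisomorphic maps of class $2_{\{0,1\}}$: one with faces of lengths $4$ and $n$, one with faces of lengths $4$ and $2n$, and one with faces of lengths $n$ and $2n$; (iii) if $n_0\in\{4,6,8\}$ and $n\ne4$, $\Gamma$ is the underlying graph of exactly two nonisomorphic maps of class $2_{\{0,1\}}$: one with faces of lengths $4$ and $n$, the other with faces of lengths $4$ and $2n$; (iv) if $n_0=0$, $\Gamma$ is the underlying graph of exactly four nonisomorphic maps of class $2_{\{0,1\}}$: two with faces of lengths $4$ and $n$, and two with faces of lengths $4$ and $2n$.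
   Context: For $m\ge3$, $1\le r\le m-1$ with $r\ne m/2$, and $0\le a\le m-1$, the Rose Window graph $R_m(a,r)$ has vertex set $\{x_i,y_i: i\in\mathbb Z_m\}$ and edges $x_ix_{i+1}$, $y_iy_{i+r}$, $x_iy_i$, $x_iy_{i-a}$ for $i\in\mathbb Z_m$ (indices mod $m$). A map is a $2$-cell embedding of a connected simple graph (its underlying graph) in a closed surface; the components of the complement are the faces, and the length of a face is the length of its boundary walk. All maps considered are polytopal: flags correspond bijectively to incident triples (vertex, edge, face). For a flag $\Phi$ and $i\in\{0,1,2\}$, $\Phi^i$ is the unique flag differing from $\Phi$ exactly in its vertex ($i=0$), edge ($i=1$) or face ($i=2$). $\mathrm{Aut}(\mathcal M)$ is the group of automorphisms of the underlying graph preserving the set of faces. A map is in class $2_{\{0,1\}}$ if $\mathrm{Aut}(\mathcal M)$ has exactly two orbits on flags and for every flag $\Phi$, the flags $\Phi^0,\Phi^1$ lie in the orbit of $\Phi$ while $\Phi^2$ does not. Maps are counted up to map isomorphism. *)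

theory Defs
  imports Main
begin

definition simple_graph :: "'a set \<Rightarrow> 'a set set \<Rightarrow> bool" where
  "simple_graph V E \<longleftrightarrow> finite V \<and>
     (\<forall>e\<in>E. \<exists>u v. u \<in> V \<and> v \<in> V \<and> u \<noteq> v \<and> e = {u, v})"

definition connected_graph :: "'a set \<Rightarrow> 'a set set \<Rightarrow> bool" where
  "connected_graph V E \<longleftrightarrow>
     (\<forall>S. S \<subseteq> V \<and> S \<noteq> {} \<and> S \<noteq> V \<longrightarrow> (\<exists>u\<in>S. \<exists>v\<in>V - S. {u, v} \<in> E))"

definition graph_automorphism :: "'a set \<Rightarrow> 'a set set \<Rightarrow> ('a \<Rightarrow> 'a) \<Rightarrow> bool" where
  "graph_automorphism V E \<sigma> \<longleftrightarrow> bij_betw \<sigma> V V \<and>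
     (\<forall>u\<in>V. \<forall>v\<in>V. {u, v} \<in> E \<longleftrightarrow> {\<sigma> u, \<sigma> v} \<in> E)"

definition is_cycle :: "'a set set \<Rightarrow> 'a set set \<Rightarrow> bool" where
  "is_cycle E C \<longleftrightarrow> C \<subseteq> E \<and> C \<noteq> {} \<and>
     (\<forall>v \<in> \<Union>C. card {e \<in> C. v \<in> e} = 2) \<and>
     (\<forall>D. D \<subseteq> C \<and> D \<noteq> {} \<and> D \<noteq> C \<longrightarrow> (\<exists>e\<in>D. \<exists>e'\<in>C - D. e \<inter> e' \<noteq> {}))"

section \<open>Polytopal maps, described by their set of faces (each face = its boundary cycle)\<close>

definition is_polytopal_map :: "'a set \<Rightarrow> 'a set set \<Rightarrow> 'a set set set \<Rightarrow> bool" where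
  "is_polytopal_map V E F \<longleftrightarrow>
     simple_graph V E \<and> connected_graph V E \<and>
     (\<forall>f\<in>F. is_cycle E f) \<and>
     (\<forall>e\<in>E. card {f \<in> F. e \<in> f} = 2) \<and>
     (\<forall>v\<in>V. \<forall>S. S \<subseteq> {f \<in> F. \<exists>e\<in>f. v \<in> e} \<and> S \<noteq> {} \<and>
                  S \<noteq> {f \<in> F. \<exists>e\<in>f. v \<in> e} \<longrightarrow>
           (\<exists>f\<in>S. \<exists>g\<in>{f \<in> F. \<exists>e\<in>f. v \<in> e} - S. \<exists>e\<in>f. e \<in> g \<and> v \<in> e))"

definition flags :: "'a set set set \<Rightarrow> ('a \<times> 'a set \<times> 'a set set) set" where
  "flags F = {(v, e, f). f \<in> F \<and> e \<in> f \<and> v \<in> e}"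

definition flag0 :: "'a \<times> 'a set \<times> 'a set set \<Rightarrow> 'a \<times> 'a set \<times> 'a set set" where
  "flag0 = (\<lambda>(v, e, f). (THE u. u \<in> e \<and> u \<noteq> v, e, f))"

definition flag1 :: "'a \<times> 'a set \<times> 'a set set \<Rightarrow> 'a \<times> 'a set \<times> 'a set set" where
  "flag1 = (\<lambda>(v, e, f). (v, THE e'. e' \<in> f \<and> v \<in> e' \<and> e' \<noteq> e, f))"

definition flag2 :: "'a set set set \<Rightarrow> 'a \<times> 'a set \<times> 'a set set \<Rightarrow> 'a \<times> 'a set \<times> 'a set set" where
  "flag2 F = (\<lambda>(v, e, f). (v, e, THE g. g \<in> F \<and> e \<in> g \<and> g \<noteq> f))"

definition face_image :: "('a \<Rightarrow> 'a) \<Rightarrow> 'a set set \<Rightarrow> 'a set set" where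
  "face_image \<sigma> f = (\<lambda>e. \<sigma> ` e) ` f"

definition map_aut :: "'a set \<Rightarrow> 'a set set \<Rightarrow> 'a set set set \<Rightarrow> ('a \<Rightarrow> 'a) \<Rightarrow> bool" where
  "map_aut V E F \<sigma> \<longleftrightarrow> graph_automorphism V E \<sigma> \<and> face_image \<sigma> ` F = F"

definition flag_act :: "('a \<Rightarrow> 'a) \<Rightarrow> 'a \<times> 'a set \<times> 'a set set \<Rightarrow> 'a \<times> 'a set \<times> 'a set set" where
  "flag_act \<sigma> = (\<lambda>(v, e, f). (\<sigma> v, \<sigma> ` e, face_image \<sigma> f))"

definition flag_orbit_rel :: "'a set \<Rightarrow> 'a set set \<Rightarrow> 'a set set set \<Rightarrow>
    (('a \<times> 'a set \<times> 'a set set) \<times> ('a \<times> 'a set \<times> 'a set set)) set" where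
  "flag_orbit_rel V E F = {(\<Phi>, \<Psi>). \<Phi> \<in> flags F \<and> (\<exists>\<sigma>. map_aut V E F \<sigma> \<and> \<Psi> = flag_act \<sigma> \<Phi>)}"

definition class_2_01 :: "'a set \<Rightarrow> 'a set set \<Rightarrow> 'a set set set \<Rightarrow> bool" where
  "class_2_01 V E F \<longleftrightarrow>
     card (flags F // flag_orbit_rel V E F) = 2 \<and>
     (\<forall>\<Phi>\<in>flags F. (\<Phi>, flag0 \<Phi>) \<in> flag_orbit_rel V E F \<and>
                   (\<Phi>, flag1 \<Phi>) \<in> flag_orbit_rel V E F \<and>
                   (\<Phi>, flag2 F \<Phi>) \<notin> flag_orbit_rel V E F)"

definition map_iso :: "'a set \<Rightarrow> 'a set set \<Rightarrow> 'a set set set \<Rightarrow> 'a set set set \<Rightarrow> bool" where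
  "map_iso V E F F' \<longleftrightarrow> (\<exists>\<sigma>. graph_automorphism V E \<sigma> \<and> face_image \<sigma> ` F = F')"

definition class201_maps :: "'a set \<Rightarrow> 'a set set \<Rightarrow> 'a set set set set" where
  "class201_maps V E = {F. is_polytopal_map V E F \<and> class_2_01 V E F}"

definition iso_classes_are :: "'a set \<Rightarrow> 'a set set \<Rightarrow> 'a set set set list \<Rightarrow> bool" where
  "iso_classes_are V E Fs \<longleftrightarrow>
     set Fs \<subseteq> class201_maps V E \<and>
     (\<forall>i<length Fs. \<forall>j<length Fs. i \<noteq> j \<longrightarrow> \<not> map_iso V E (Fs ! i) (Fs ! j)) \<and>
     (\<forall>F\<in>class201_maps V E. \<exists>G\<in>set Fs. map_iso V E F G)"

definition face_lengths :: "'a set set set \<Rightarrow> nat set" where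
  "face_lengths F = card ` F"

section \<open>Rose Window graphs: x_i = (False, i), y_i = (True, i), i < m\<close>

definition rw_verts :: "nat \<Rightarrow> (bool \<times> nat) set" where
  "rw_verts m = {(b, i). i < m}"

definition rw_edges :: "nat \<Rightarrow> nat \<Rightarrow> nat \<Rightarrow> (bool \<times> nat) set set" where
  "rw_edges m a r = (\<Union>i\<in>{..<m}.
      {{(False, i), (False, (i + 1) mod m)},
       {(True, i), (True, (i + r) mod m)},
       {(False, i), (True, i)},
       {(False, i), (True, (i + m - a) mod m)}})"

end

theory Submission
  imports Defs
begin

text \<open>The Rose Window graph \<open>R\<^sub>2\<^sub>n(n+2, n+1)\<close> is a Praeger-Xu graph: its vertices are the triples
  \<open>(i, a, b)\<close> with \<open>i\<close> modulo \<open>n\<close> and bits \<open>a\<close>, \<open>b\<close>, and its edges join \<open>(i, a, b)\<close> to \<open>(i+1, b, c)\<close>.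
  The edges split into the 4-cycles formed by all edges \<open>(i-1, a, b)\<close> - \<open>(i, b, c)\<close> with \<open>i\<close> and \<open>b\<close> fixed.

  In a map of the class considered the two flag orbits split the faces into two families, each covering every edge
  once, and the automorphism group is arc-transitive and preserves both families. At every vertex a
  family pairs the edges either as the 4-cycles do or straight, each edge from level \<open>i-1\<close> with one to level
  \<open>i+1\<close>. A straight face is a bit sequence with \<open>c(i+2) = c(i-1) + s\<^sub>i(c(i), c(i+1))\<close>; arc-transitivity
  forces \<open>s\<^sub>i(a, b) = \<alpha>(a+b) + \<delta>\<^sub>i\<close> with \<open>\<alpha>\<close> constant and every solution of the homogeneous recurrence
  \<open>n\<close>-periodic, that is, 3 (for \<open>\<alpha> = 0\<close>) or 4 (for \<open>\<alpha> = 1\<close>) divides \<open>n\<close>. Translating by a solution of the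
  recurrence on the universal cover removes \<open>\<delta>\<close>, at the price of a twist: going once around adds a constant
  bit \<open>p\<close> to all coordinates. The faces then have length \<open>n\<close> if \<open>p = 0\<close> and \<open>2n\<close> if \<open>p = 1\<close>.

  The argument needs that the automorphisms permute the levels. For \<open>n \<noteq> 4\<close> this is so because
  the 4-cycles above are the only ones. For \<open>n = 4\<close> the graph is the 4-cube, whose 4-cycles fall into three such
  systems, permuted by the automorphisms; one of them is invariant under the group of the map because the
  automorphism reversing an edge and fixing its two faces acts on the three systems as an involution.\<close>

section \<open>Polytopal maps and two families of cycles\<close>

text \<open>Adding a bit sequence \<open>u\<close> to all positions changes the inhomogeneity of the
  recurrence by the defect of \<open>u\<close> and the twist by \<open>u i + u (i + n)\<close>.
  Solutions of the homogeneous recurrence are n-periodic and change neither, so they supply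
  automorphisms. For each admissible \<alpha> only a constant inhomogeneity \<beta> and the twist
  \<open>p\<close> can remain. Next to the 4-cycles, which ignore \<open>u\<close>, \<beta> is
  normalised to 0 and \<open>p\<close> survives: two maps per \<alpha>, told apart by face lengths.
  Two straight families must be \<beta> = 0 and \<beta> = 1 for the same \<alpha>. A solution for
  \<beta> = 1 exchanges them; it keeps the twist unless \<alpha> = 0 and \<open>n\<close> is odd, so
  in all other cases the map has an automorphism fusing the two orbits. In the remaining case it
  changes the twist, so \<open>p\<close> is no invariant and one map is left. When 12 divides
  \<open>n\<close>, both \<alpha> occur with equal face lengths, and the recurrences themselves must
  be separated. For \<open>n = 4\<close> without twist all faces have length 4, and an extra
  automorphism of the cube again fuses the orbits.\<close>

lemma face_image_comp: "face_image (\<sigma> \<circ> \<tau>) f = face_image \<sigma> (face_image \<tau> f)"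
  unfolding face_image_def by (simp add: image_image image_comp)

lemma flag_act_comp: "flag_act (\<sigma> \<circ> \<tau>) \<Phi> = flag_act \<sigma> (flag_act \<tau> \<Phi>)"
  by (cases \<Phi>) (simp add: flag_act_def face_image_comp image_comp)

lemma face_image_cong:
  assumes "\<forall>e\<in>f. e \<subseteq> V" "\<And>v. v \<in> V \<Longrightarrow> \<sigma> v = \<tau> v"
  shows "face_image \<sigma> f = face_image \<tau> f"
  unfolding face_image_def using assms by (intro image_cong refl) auto

lemma simple_graph_edge_subset: "simple_graph V E \<Longrightarrow> e \<in> E \<Longrightarrow> e \<subseteq> V"
  unfolding simple_graph_def by auto

lemma simple_graph_edgeE:
  assumes "simple_graph V E" "e \<in> E" "v \<in> e"
  obtains w where "e = {v, w}" "v \<noteq> w" "v \<in> V" "w \<in> V"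
  using assms unfolding simple_graph_def by fastforce

section \<open>Automorphisms of graphs and maps, and their orbits on flags\<close>

lemma graph_automorphism_comp:
  assumes "graph_automorphism V E \<sigma>" "graph_automorphism V E \<tau>"
  shows "graph_automorphism V E (\<sigma> \<circ> \<tau>)"
proof -
  have "\<tau> u \<in> V" if "u \<in> V" for u
    using assms(2) that by (auto simp: graph_automorphism_def bij_betw_def)
  moreover have "bij_betw (\<sigma> \<circ> \<tau>) V V" "\<And>u v. u \<in> V \<Longrightarrow> v \<in> V \<Longrightarrow> {u, v} \<in> E \<longleftrightarrow> {\<tau> u, \<tau> v} \<in> E"
    "\<And>u v. u \<in> V \<Longrightarrow> v \<in> V \<Longrightarrow> {u, v} \<in> E \<longleftrightarrow> {\<sigma> u, \<sigma> v} \<in> E"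
    using assms by (auto simp: graph_automorphism_def intro: bij_betw_trans)
  ultimately show ?thesis unfolding graph_automorphism_def o_apply by blast
qed

lemma graph_automorphism_inv:
  assumes "graph_automorphism V E \<sigma>"
  shows "graph_automorphism V E (inv_into V \<sigma>)"
proof -
  have b: "bij_betw \<sigma> V V" and e: "\<And>u v. u \<in> V \<Longrightarrow> v \<in> V \<Longrightarrow> {u, v} \<in> E \<longleftrightarrow> {\<sigma> u, \<sigma> v} \<in> E"
    using assms by (auto simp: graph_automorphism_def)
  have i: "inv_into V \<sigma> u \<in> V" "\<sigma> (inv_into V \<sigma> u) = u" if "u \<in> V" for u
    using b that by (auto simp: bij_betw_def inv_into_into f_inv_into_f)
  show ?thesis unfolding graph_automorphism_def
    using bij_betw_inv_into[OF b] e i by metis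
qed

lemma graph_automorphism_in:
  "graph_automorphism V E \<sigma> \<Longrightarrow> v \<in> V \<Longrightarrow> \<sigma> v \<in> V"
  by (auto simp: graph_automorphism_def bij_betw_def)

lemma graph_automorphism_edge:
  assumes "simple_graph V E" "graph_automorphism V E \<sigma>" "e \<in> E"
  shows "\<sigma> ` e \<in> E"
proof -
  obtain u v where "u \<in> V" "v \<in> V" "e = {u, v}"
    using assms unfolding simple_graph_def by blast
  then show ?thesis using assms by (auto simp: graph_automorphism_def)
qed

lemma face_image_inv:
  assumes "simple_graph V E" "graph_automorphism V E \<sigma>" "f \<subseteq> E"
  shows "face_image (inv_into V \<sigma>) (face_image \<sigma> f) = f"
proof -
  have "face_image (inv_into V \<sigma> \<circ> \<sigma>) f = face_image id f"
    using assms simple_graph_edge_subset[OF assms(1)]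
    by (intro face_image_cong[of _ V]) (auto simp: graph_automorphism_def bij_betw_def)
  then show ?thesis by (simp add: face_image_comp) (simp add: face_image_def)
qed

lemma map_aut_comp:
  assumes "map_aut V E F \<sigma>" "map_aut V E F \<tau>"
  shows "map_aut V E F (\<sigma> \<circ> \<tau>)"
proof -
  have "face_image (\<sigma> \<circ> \<tau>) ` F = face_image \<sigma> ` face_image \<tau> ` F"
    by (auto simp: face_image_comp)
  then show ?thesis using assms by (simp add: map_aut_def graph_automorphism_comp)
qed

lemma map_aut_inv:
  assumes "simple_graph V E" "\<forall>f\<in>F. f \<subseteq> E" "map_aut V E F \<sigma>"
  shows "map_aut V E F (inv_into V \<sigma>)"
proof -
  have g: "graph_automorphism V E \<sigma>" and F: "face_image \<sigma> ` F = F"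
    using assms by (auto simp: map_aut_def)
  have *: "face_image (inv_into V \<sigma>) (face_image \<sigma> f) = f" if "f \<in> F" for f
    using face_image_inv[OF assms(1) g] assms(2) that by blast
  have "face_image (inv_into V \<sigma>) ` F = face_image (inv_into V \<sigma>) ` face_image \<sigma> ` F"
    by (simp only: F)
  also have "\<dots> = F" using * by (simp add: image_image)
  finally show ?thesis
    using g by (simp add: map_aut_def graph_automorphism_inv)
qed

lemma map_aut_id: "map_aut V E F id"
  by (auto simp: map_aut_def graph_automorphism_def face_image_def)

lemma flag_act_in_flags:
  assumes "map_aut V E F \<sigma>" "\<Phi> \<in> flags F"
  shows "flag_act \<sigma> \<Phi> \<in> flags F"
  using assms by (cases \<Phi>) (auto simp: map_aut_def flags_def flag_act_def face_image_def)

lemma equiv_flag_orbit_rel: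
  assumes s: "simple_graph V E" and F: "\<forall>f\<in>F. f \<subseteq> E"
  shows "equiv (flags F) (flag_orbit_rel V E F)"
proof (rule equivI)
  show "flag_orbit_rel V E F \<subseteq> flags F \<times> flags F"
    by (auto simp: flag_orbit_rel_def intro: flag_act_in_flags)
  have "flag_act id \<Phi> = \<Phi>" for \<Phi> :: "'a \<times> 'a set \<times> 'a set set"
    by (cases \<Phi>) (simp add: flag_act_def face_image_def)
  then show "refl_on (flags F) (flag_orbit_rel V E F)"
    unfolding refl_on_def flag_orbit_rel_def
    using map_aut_id[of V E F] by (metis (mono_tags, lifting) case_prodI mem_Collect_eq)
  show "sym (flag_orbit_rel V E F)"
  proof (rule symI)
    fix \<Phi> \<Psi> assume "(\<Phi>, \<Psi>) \<in> flag_orbit_rel V E F"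
    then obtain \<sigma> where a: "\<Phi> \<in> flags F" "map_aut V E F \<sigma>" "\<Psi> = flag_act \<sigma> \<Phi>"
      by (auto simp: flag_orbit_rel_def)
    obtain v e f where \<Phi>: "\<Phi> = (v, e, f)" by (cases \<Phi>)
    have fe: "f \<in> F" "e \<in> f" "v \<in> e" using a \<Phi> by (auto simp: flags_def)
    then have eV: "e \<subseteq> V" "f \<subseteq> E" using F simple_graph_edge_subset[OF s] by auto
    have g: "graph_automorphism V E \<sigma>" and inj: "inj_on \<sigma> V"
      using a by (auto simp: map_aut_def graph_automorphism_def bij_betw_def)
    have "flag_act (inv_into V \<sigma>) \<Psi> = \<Phi>"
      using fe eV inj by (auto simp: a \<Phi> flag_act_def face_image_inv[OF s g])
    then show "(\<Psi>, \<Phi>) \<in> flag_orbit_rel V E F"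
      using a map_aut_inv[OF s F a(2)] flag_act_in_flags[OF a(2) a(1)]
      by (auto simp: flag_orbit_rel_def)
  qed
  show "trans (flag_orbit_rel V E F)"
  proof (rule transI)
    fix \<Phi> \<Psi> \<Theta> assume "(\<Phi>, \<Psi>) \<in> flag_orbit_rel V E F" "(\<Psi>, \<Theta>) \<in> flag_orbit_rel V E F"
    then obtain \<sigma> \<tau> where "\<Phi> \<in> flags F" "map_aut V E F \<sigma>" "map_aut V E F \<tau>" "\<Theta> = flag_act (\<tau> \<circ> \<sigma>) \<Phi>"
      by (auto simp: flag_orbit_rel_def flag_act_comp)
    then show "(\<Phi>, \<Theta>) \<in> flag_orbit_rel V E F"
      using map_aut_comp[of V E F \<tau> \<sigma>] by (auto simp: flag_orbit_rel_def)
  qed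
qed

section \<open>Boundary cycles; class 2_{0,1} as a pair of face families\<close>

lemma is_cycle_mates:
  assumes "is_cycle E f" "e \<in> f" "v \<in> e"
  shows "\<exists>!e'. e' \<in> f \<and> v \<in> e' \<and> e' \<noteq> e"
proof -
  have "card {e \<in> f. v \<in> e} = 2" using assms unfolding is_cycle_def by auto
  then obtain x y where "{e \<in> f. v \<in> e} = {x, y}" "x \<noteq> y" by (auto simp: card_2_iff)
  then show ?thesis using assms by (intro ex1I[of _ "if e = x then y else x"]) (auto split: if_splits)
qed

lemma is_cycle_unique_mate:
  assumes "is_cycle E f" "e \<in> f" "e' \<in> f" "e'' \<in> f" "v \<in> e" "v \<in> e'" "v \<in> e''" "e' \<noteq> e" "e'' \<noteq> e"
  shows "e' = e''"
  using is_cycle_mates[OF assms(1,2,5)] assms by blast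

text \<open>The connectedness clause of \<open>is_cycle\<close> as an induction rule: otherwise the
  edges satisfying \<open>P\<close> would form a proper part of the cycle that meets no other
  edge.\<close>

lemma is_cycle_connected_induct [consumes 3, case_names step]:
  assumes "is_cycle E f" "e \<in> f" "P e"
    and step: "\<And>e e' v. e \<in> f \<Longrightarrow> e' \<in> f \<Longrightarrow> v \<in> e \<Longrightarrow> v \<in> e' \<Longrightarrow> P e \<Longrightarrow> P e'"
  shows "\<forall>e'\<in>f. P e'"
proof (rule ccontr)
  assume "\<not> ?thesis"
  then have "{e\<in>f. P e} \<subseteq> f \<and> {e\<in>f. P e} \<noteq> {} \<and> {e\<in>f. P e} \<noteq> f" using assms by auto
  then obtain e1 e2 where "e1 \<in> {e\<in>f. P e}" "e2 \<in> f - {e\<in>f. P e}" "e1 \<inter> e2 \<noteq> {}"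
    using assms(1) unfolding is_cycle_def by meson
  then show False using step by blast
qed

text \<open>\<open>flag0\<close> and \<open>flag1\<close> lead to all flags of one face, so the
  orbit is a property of the face, and \<open>flag2\<close> makes the two faces at an edge differ.
  Hence each edge lies in one face of each kind. Two arcs completed by their faces of the same kind
  are flags of one orbit, which gives arc-transitivity.\<close>

lemma class_2_01_split:
  assumes P: "is_polytopal_map V E F" and C: "class_2_01 V E F"
  shows "\<exists>FA FB. F = FA \<union> FB \<and> FA \<inter> FB = {} \<and> (\<forall>e\<in>E. \<exists>!f. f \<in> FA \<and> e \<in> f) \<and>
     (\<forall>e\<in>E. \<exists>!f. f \<in> FB \<and> e \<in> f) \<and>
     (\<forall>\<sigma>. map_aut V E F \<sigma> \<longrightarrow> (\<forall>f\<in>FA. face_image \<sigma> f \<in> FA) \<and> (\<forall>f\<in>FB. face_image \<sigma> f \<in> FB)) \<and>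
     (\<forall>v e v' e'. e \<in> E \<longrightarrow> v \<in> e \<longrightarrow> e' \<in> E \<longrightarrow> v' \<in> e' \<longrightarrow>
        (\<exists>\<sigma>. map_aut V E F \<sigma> \<and> \<sigma> v = v' \<and> \<sigma> ` e = e'))"
proof -
  let ?R = "flag_orbit_rel V E F"
  have s: "simple_graph V E" and cyc: "\<And>f. f \<in> F \<Longrightarrow> is_cycle E f"
    and two: "\<And>e. e \<in> E \<Longrightarrow> card {f \<in> F. e \<in> f} = 2"
    using P by (auto simp: is_polytopal_map_def)
  have F: "\<forall>f\<in>F. f \<subseteq> E" using cyc by (auto simp: is_cycle_def)
  have eq: "equiv (flags F) ?R" by (rule equiv_flag_orbit_rel[OF s F])
  obtain X Y where XY: "flags F // ?R = {X, Y}" "X \<noteq> Y"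
    using C unfolding class_2_01_def card_2_iff by blast
  \<comment> \<open>The two orbits become a Boolean type, so that types are compared below instead
    of automorphisms.\<close>
  define ty where "ty \<Phi> = (\<Phi> \<in> X)" for \<Phi>
  have XYq: "X \<in> flags F // ?R" "Y \<in> flags F // ?R" using XY by auto
  have disj: "X \<inter> Y = {}" using quotient_disj[OF eq XYq] XY by blast
  have ty: "ty \<Phi> = ty \<Psi> \<longleftrightarrow> (\<Phi>, \<Psi>) \<in> ?R" if "\<Phi> \<in> flags F" "\<Psi> \<in> flags F" for \<Phi> \<Psi>
  proof -
    have "?R `` {\<Phi>} = (if ty \<Phi> then X else Y)" if "\<Phi> \<in> flags F" for \<Phi>
    proof -
      have "?R `` {\<Phi>} \<in> {X, Y}" unfolding XY(1)[symmetric] using that by (rule quotientI)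
      then show ?thesis using equiv_class_self[OF eq that] disj by (auto simp: ty_def)
    qed
    from this[OF that(1)] this[OF that(2)] show ?thesis
      using eq_equiv_class_iff[OF eq that] XY(2) by (cases "ty \<Phi>"; cases "ty \<Psi>") auto
  qed
  have tysig: "ty (flag_act \<sigma> \<Phi>) = ty \<Phi>" if "\<Phi> \<in> flags F" "map_aut V E F \<sigma>" for \<sigma> \<Phi>
    using ty[OF that(1) flag_act_in_flags[OF that(2,1)]] that by (auto simp: flag_orbit_rel_def)
  have e2: "\<exists>w. e = {v, w} \<and> v \<noteq> w" if "f \<in> F" "e \<in> f" "v \<in> e" for v e f
    using simple_graph_edgeE[OF s _ that(3)] F that by (metis subsetD)
  have ty0: "ty (v, e, f) = ty (w, e, f)" if "f \<in> F" "e \<in> f" "v \<in> e" "w \<in> e" for v w e f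
  proof (cases "v = w")
    case False
    then have e: "e = {v, w}" using e2[OF that(1-3)] that by auto
    have "(THE u. u \<in> e \<and> u \<noteq> v) = w" using False e by (intro the_equality) auto
    then have "flag0 (v, e, f) = (w, e, f)" by (simp add: flag0_def)
    moreover have fl: "(v, e, f) \<in> flags F" "(w, e, f) \<in> flags F" using that by (auto simp: flags_def)
    ultimately have "((v, e, f), (w, e, f)) \<in> ?R" using C by (force simp: class_2_01_def)
    then show ?thesis using ty fl by blast
  qed simp
  have ty1: "ty (v, e, f) = ty (v, e', f)"
    if "f \<in> F" "e \<in> f" "v \<in> e" "e' \<in> f" "v \<in> e'" for v e e' f
  proof (cases "e = e'")
    case False
    have "(THE e'. e' \<in> f \<and> v \<in> e' \<and> e' \<noteq> e) = e'"
      using is_cycle_mates[OF cyc[OF that(1)] that(2,3)] that False by (intro the1_equality) auto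
    then have "flag1 (v, e, f) = (v, e', f)" by (simp add: flag1_def)
    moreover have fl: "(v, e, f) \<in> flags F" "(v, e', f) \<in> flags F" using that by (auto simp: flags_def)
    ultimately have "((v, e, f), (v, e', f)) \<in> ?R" using C by (force simp: class_2_01_def)
    then show ?thesis using ty fl by blast
  qed simp
  have tw: "\<exists>f g. {f \<in> F. e \<in> f} = {f, g} \<and> f \<noteq> g" if "e \<in> E" for e
    using two[OF that] by (auto simp: card_2_iff)
  have ty2: "ty (v, e, f) \<noteq> ty (v, e, g)" if "f \<in> F" "g \<in> F" "e \<in> f" "e \<in> g" "v \<in> e" "f \<noteq> g" for v e f g
  proof -
    have eE: "e \<in> E" using that F by auto
    obtain f' g' where "{f \<in> F. e \<in> f} = {f', g'}" using tw[OF eE] by blast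
    moreover have "f \<in> {f \<in> F. e \<in> f}" "g \<in> {f \<in> F. e \<in> f}" using that by simp_all
    ultimately have fg: "{f \<in> F. e \<in> f} = {f, g}" using \<open>f \<noteq> g\<close> by auto
    have "(THE g. g \<in> F \<and> e \<in> g \<and> g \<noteq> f) = g" using fg that by (intro the_equality) auto
    then have "flag2 F (v, e, f) = (v, e, g)" by (simp add: flag2_def)
    moreover have fl: "(v, e, f) \<in> flags F" "(v, e, g) \<in> flags F" using that by (auto simp: flags_def)
    ultimately have "((v, e, f), (v, e, g)) \<notin> ?R" using C by (force simp: class_2_01_def)
    then show ?thesis using ty fl by blast
  qed
  have tyf: "ty (v, e, f) = ty (w, e', f)" if "f \<in> F" "e \<in> f" "e' \<in> f" "v \<in> e" "w \<in> e'" for v e w e' f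
  proof -
    have "\<forall>e'\<in>f. \<forall>w\<in>e'. ty (w, e', f) = ty (v, e, f)"
      using cyc[OF that(1)] that(2)
    proof (rule is_cycle_connected_induct)
      show "\<forall>w\<in>e. ty (w, e, f) = ty (v, e, f)" using ty0 that by blast
    next
      fix e1 e2 u assume a: "e1 \<in> f" "e2 \<in> f" "u \<in> e1" "u \<in> e2" "\<forall>w\<in>e1. ty (w, e1, f) = ty (v, e, f)"
      have "ty (u, e2, f) = ty (v, e, f)" using ty1[OF that(1) a(1,3,2,4)] a(3,5) by blast
      then show "\<forall>w\<in>e2. ty (w, e2, f) = ty (v, e, f)" using ty0[OF that(1) a(2) _ a(4)] by blast
    qed
    from bspec[OF bspec[OF this that(3)] that(5)] show ?thesis by (rule sym)
  qed
  define FT where "FT x = {f \<in> F. \<exists>e\<in>f. \<exists>v\<in>e. ty (v, e, f) = x}" for x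
  have FTI: "f \<in> FT (ty (v, e, f))" if "f \<in> F" "e \<in> f" "v \<in> e" for v e f
    unfolding FT_def using that by auto
  have FTD: "ty (v, e, f) = x" if "f \<in> FT x" "e \<in> f" "v \<in> e" for v e f x
    using that tyf unfolding FT_def by blast
  have ne: "\<exists>e v. e \<in> f \<and> v \<in> e" if fF: "f \<in> F" for f
  proof -
    obtain e where "e \<in> f" using cyc[OF fF] by (auto simp: is_cycle_def)
    moreover from this have "e \<in> E" using F fF by auto
    then have "\<exists>v. v \<in> e" using s by (auto simp: simple_graph_def)
    ultimately show ?thesis by blast
  qed
  have FTF: "FT x \<subseteq> F" for x by (auto simp: FT_def)
  have "f \<in> FT True \<union> FT False" if "f \<in> F" for f
    using ne[OF that] FTI[OF that] by (metis (full_types) UnI1 UnI2)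
  then have "F = FT True \<union> FT False" using FTF by blast
  moreover have "f \<notin> FT False" if f: "f \<in> FT True" for f
  proof -
    obtain e v where "e \<in> f" "v \<in> e" using ne[of f] f FTF by blast
    then show ?thesis using FTD[of f True e v] FTD[of f False e v] f by blast
  qed
  then have "FT True \<inter> FT False = {}" by blast
  moreover have ex1: "\<exists>!f. f \<in> FT x \<and> e \<in> f" if eE: "e \<in> E" for e x
  proof -
    obtain f g where fg: "{f \<in> F. e \<in> f} = {f, g}" "f \<noteq> g" using tw[OF eE] by blast
    then have m: "f \<in> F" "g \<in> F" "e \<in> f" "e \<in> g" by blast+
    obtain v where v: "v \<in> e" using eE s by (fastforce simp: simple_graph_def)
    have n: "ty (v, e, f) \<noteq> ty (v, e, g)" using ty2 m v fg by blast
    have "h = f \<or> h = g" if "h \<in> FT x" "e \<in> h" for h using that fg FTF by blast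
    moreover have "f \<in> FT x \<longleftrightarrow> ty (v, e, f) = x" "g \<in> FT x \<longleftrightarrow> ty (v, e, g) = x"
      using FTI[OF m(1,3) v] FTI[OF m(2,4) v] FTD[of f x e v] FTD[of g x e v] m v by auto
    ultimately show ?thesis using n m by (cases "ty (v, e, f) = x") blast+
  qed
  moreover have "face_image \<sigma> f \<in> FT x" if sg: "map_aut V E F \<sigma>" and fx: "f \<in> FT x" for \<sigma> f x
  proof -
    have "f \<in> F" using fx FTF by blast
    then obtain e v where ev: "e \<in> f" "v \<in> e" using ne by blast
    have fl: "(v, e, f) \<in> flags F" using ev \<open>f \<in> F\<close> by (auto simp: flags_def)
    have "flag_act \<sigma> (v, e, f) \<in> flags F" "ty (flag_act \<sigma> (v, e, f)) = x"
      using flag_act_in_flags[OF sg fl] tysig[OF fl sg] FTD[OF fx ev] by simp_all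
    then show ?thesis using FTI by (auto simp: flag_act_def flags_def)
  qed
  moreover have "\<exists>\<sigma>. map_aut V E F \<sigma> \<and> \<sigma> v = v' \<and> \<sigma> ` e = e'"
    if ev: "e \<in> E" "v \<in> e" "e' \<in> E" "v' \<in> e'" for e v e' v'
  proof -
    obtain f f' where f: "f \<in> FT True" "e \<in> f" "f' \<in> FT True" "e' \<in> f'"
      using ex1_implies_ex[OF ex1[OF ev(1), of True]] ex1_implies_ex[OF ex1[OF ev(3), of True]]
      by (elim exE conjE)
    then have "(v, e, f) \<in> flags F" "(v', e', f') \<in> flags F" using ev FTF[of True] by (auto simp: flags_def)
    moreover have "ty (v, e, f) = ty (v', e', f')" using FTD[OF f(1,2) ev(2)] FTD[OF f(3,4) ev(4)] by simp
    ultimately have "((v, e, f), (v', e', f')) \<in> ?R" using ty by blast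
    then show ?thesis by (auto simp: flag_orbit_rel_def flag_act_def)
  qed
  ultimately show ?thesis
    by (intro exI[of _ "FT True"] exI[of _ "FT False"] conjI allI impI ballI) simp_all
qed

lemma card_face_image:
  assumes "simple_graph V E" "graph_automorphism V E \<sigma>" "f \<subseteq> E"
  shows "card (face_image \<sigma> f) = card f"
proof -
  have "inj_on \<sigma> V" using assms(2) unfolding graph_automorphism_def bij_betw_def by blast
  then have "inj_on ((`) \<sigma>) f"
    using assms(3) simple_graph_edge_subset[OF assms(1)] by (meson inj_on_image_eq_iff inj_onI subsetD)
  then show ?thesis by (simp add: face_image_def card_image)
qed

text \<open>The converse of the splitting. The different lengths \<open>k\<close> and
  \<open>l\<close> keep every automorphism from mixing the families, and \<open>trans\<close> merges
  all flags inside one family. \<open>link\<close> says that the edges at a vertex are connected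
  through the faces there, which yields the vertex condition of a polytopal map.\<close>

lemma class_2_01_two_families:
  assumes s: "simple_graph V E" and conn: "connected_graph V E" and "E \<noteq> {}"
    and cyc: "\<And>f. f \<in> FA \<union> FB \<Longrightarrow> is_cycle E f"
    and A1: "\<And>e. e \<in> E \<Longrightarrow> \<exists>!f. f \<in> FA \<and> e \<in> f"
    and B1: "\<And>e. e \<in> E \<Longrightarrow> \<exists>!f. f \<in> FB \<and> e \<in> f"
    and cA: "\<And>f. f \<in> FA \<Longrightarrow> card f = k" and cB: "\<And>f. f \<in> FB \<Longrightarrow> card f = l" and kl: "k \<noteq> l"
    and link: "\<And>v X e. v \<in> V \<Longrightarrow> X \<subseteq> {e \<in> E. v \<in> e} \<Longrightarrow> e \<in> X \<Longrightarrow>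
       (\<And>e f e'. e \<in> X \<Longrightarrow> f \<in> FA \<union> FB \<Longrightarrow> e \<in> f \<Longrightarrow> e' \<in> f \<Longrightarrow> v \<in> e' \<Longrightarrow> e' \<in> X) \<Longrightarrow>
       {e \<in> E. v \<in> e} \<subseteq> X"
    and trans: "\<And>v e v' e'. e \<in> E \<Longrightarrow> v \<in> e \<Longrightarrow> e' \<in> E \<Longrightarrow> v' \<in> e' \<Longrightarrow>
       \<exists>\<sigma>. graph_automorphism V E \<sigma> \<and> face_image \<sigma> ` FA = FA \<and> face_image \<sigma> ` FB = FB \<and> \<sigma> v = v' \<and> \<sigma> ` e = e'"
  shows "FA \<union> FB \<in> class201_maps V E" "face_lengths (FA \<union> FB) = {k, l}"
proof -
  let ?F = "FA \<union> FB" and ?R = "flag_orbit_rel V E (FA \<union> FB)"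
  have disj: "FA \<inter> FB = {}" using cA cB kl by auto
  have F: "\<forall>f\<in>?F. f \<subseteq> E" using cyc by (auto simp: is_cycle_def)
  obtain e0 where e0: "e0 \<in> E" using \<open>E \<noteq> {}\<close> by auto
  obtain v0 where v0: "v0 \<in> e0" using e0 s by (fastforce simp: simple_graph_def)
  obtain a b where ab: "a \<in> FA" "e0 \<in> a" "b \<in> FB" "e0 \<in> b" using A1[OF e0] B1[OF e0] by blast
  have two: "\<exists>f g. f \<in> FA \<and> g \<in> FB \<and> f \<noteq> g \<and> {h \<in> ?F. e \<in> h} = {f, g}" if e: "e \<in> E" for e
  proof -
    obtain f g where "f \<in> FA" "e \<in> f" "g \<in> FB" "e \<in> g" using A1[OF e] B1[OF e] by blast
    moreover from this have "{h \<in> ?F. e \<in> h} = {f, g}" using A1[OF e] B1[OF e] by auto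
    ultimately show ?thesis using disj by blast
  qed
  have poly: "is_polytopal_map V E ?F"
    unfolding is_polytopal_map_def
  proof (intro conjI s conn ballI cyc allI impI)
    show "card {f \<in> ?F. e \<in> f} = 2" if "e \<in> E" for e using two[OF that] by (metis card_2_iff)
    fix v S assume v: "v \<in> V" and S: "S \<subseteq> {f \<in> ?F. \<exists>e\<in>f. v \<in> e} \<and> S \<noteq> {} \<and> S \<noteq> {f \<in> ?F. \<exists>e\<in>f. v \<in> e}"
    show "\<exists>f\<in>S. \<exists>g\<in>{f \<in> ?F. \<exists>e\<in>f. v \<in> e} - S. \<exists>e\<in>f. e \<in> g \<and> v \<in> e"
    proof (rule ccontr)
      assume no: "\<not> ?thesis"
      \<comment> \<open>The edges at \<open>v\<close> covered by \<open>S\<close>. If no face of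
        \<open>S\<close> shares an edge at \<open>v\<close> with a face outside \<open>S\<close>,
        this set is closed under passing along faces, and \<open>link\<close> makes it contain all
        edges at \<open>v\<close>.\<close>
      define X where "X = {e. v \<in> e \<and> (\<exists>f\<in>S. e \<in> f)}"
      obtain f0 e1 where "f0 \<in> S" "e1 \<in> f0" "v \<in> e1" using S by blast
      then have e1: "e1 \<in> X" by (auto simp: X_def)
      have "X \<subseteq> {e \<in> E. v \<in> e}" using F S by (auto simp: X_def)
      moreover have "e' \<in> X" if h: "e \<in> X" "f \<in> ?F" "e \<in> f" "e' \<in> f" "v \<in> e'" for e f e'
      proof -
        obtain g where "g \<in> S" "e \<in> g" "v \<in> e" using h(1) by (auto simp: X_def)
        then have "f \<in> S" using no h by blast
        then show ?thesis using h by (auto simp: X_def)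
      qed
      ultimately have X: "{e \<in> E. v \<in> e} \<subseteq> X" using link[OF v _ e1] by blast
      have "g \<in> S" if "g \<in> ?F" "e \<in> g" "v \<in> e" for g e
      proof -
        have "e \<in> X" using X that F by blast
        then obtain f where "f \<in> S" "e \<in> f" by (auto simp: X_def)
        then show ?thesis using no that by blast
      qed
      then show False using S by blast
    qed
  qed
  have eq: "equiv (flags ?F) ?R" by (rule equiv_flag_orbit_rel[OF s F])
  define Fl where "Fl G = {(v, e, f). f \<in> G \<and> e \<in> f \<and> v \<in> e}" for G :: "'a set set set"
  have card_img: "card (face_image \<sigma> f) = card f" if "map_aut V E ?F \<sigma>" "f \<in> ?F" for \<sigma> f
    using card_face_image[OF s] F that unfolding map_aut_def by blast
  have dir: "f \<in> FA \<longleftrightarrow> g \<in> FA" if r: "((v, e, f), (v', e', g)) \<in> ?R" for v e f v' e' g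
  proof -
    have "(v', e', g) \<in> flags ?F" using r equiv_type[OF eq] by blast
    then obtain \<sigma> where "map_aut V E ?F \<sigma>" "f \<in> ?F" "g = face_image \<sigma> f" "g \<in> ?F"
      using r unfolding flag_orbit_rel_def flag_act_def flags_def by auto
    then show ?thesis using card_img cA cB kl by (metis Un_iff)
  qed
  \<comment> \<open>An automorphism matching the two arcs sends \<open>f\<close> to a face of the
    same family through \<open>e'\<close>, and there is only one such face.\<close>
  have rel: "((v, e, f), (v', e', g)) \<in> ?R" if "(v, e, f) \<in> flags ?F" "(v', e', g) \<in> flags ?F" "f \<in> FA \<longleftrightarrow> g \<in> FA" for v e f v' e' g
  proof -
    have m: "e \<in> E" "e' \<in> E" "v \<in> e" "v' \<in> e'" using that F by (auto simp: flags_def)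
    then obtain \<sigma> where sg: "graph_automorphism V E \<sigma>" "face_image \<sigma> ` FA = FA" "face_image \<sigma> ` FB = FB" "\<sigma> v = v'" "\<sigma> ` e = e'"
      using trans by blast
    have "e' \<in> face_image \<sigma> f" using sg that by (auto simp: face_image_def flags_def)
    moreover have "face_image \<sigma> f \<in> FA \<and> g \<in> FA \<or> face_image \<sigma> f \<in> FB \<and> g \<in> FB"
      using that sg(2,3) disj by (auto simp: flags_def)
    moreover have "e' \<in> g" using that by (auto simp: flags_def)
    ultimately have "face_image \<sigma> f = g" using A1[OF m(2)] B1[OF m(2)] by blast
    moreover have "map_aut V E ?F \<sigma>" using sg by (auto simp: map_aut_def image_Un)
    ultimately show ?thesis using that sg by (auto simp: flag_orbit_rel_def flag_act_def)
  qed
  have "flags ?F // ?R = {Fl FA, Fl FB}"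
  proof -
    have cl: "?R `` {(v, e, f)} = {\<Psi> \<in> flags ?F. snd (snd \<Psi>) \<in> FA \<longleftrightarrow> f \<in> FA}"
      if "(v, e, f) \<in> flags ?F" for v e f
    proof (intro set_eqI)
      fix \<Psi> :: "'a \<times> 'a set \<times> 'a set set"
      obtain v' e' g where p: "\<Psi> = (v', e', g)" by (cases \<Psi>)
      show "\<Psi> \<in> ?R `` {(v, e, f)} \<longleftrightarrow> \<Psi> \<in> {\<Psi> \<in> flags ?F. snd (snd \<Psi>) \<in> FA \<longleftrightarrow> f \<in> FA}"
        unfolding p Image_singleton_iff mem_Collect_eq snd_conv
        using rel[OF that, of v' e' g] dir[of v e f v' e' g] equiv_type[OF eq] by blast
    qed
    have FlA: "{\<Psi> \<in> flags ?F. snd (snd \<Psi>) \<in> FA} = Fl FA"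
      "{\<Psi> \<in> flags ?F. snd (snd \<Psi>) \<notin> FA} = Fl FB"
      using disj by (auto simp: Fl_def flags_def)
    have clA: "?R `` {(v, e, f)} = Fl FA" if "f \<in> FA" "e \<in> f" "v \<in> e" for v e f
      using cl[of v e f] that FlA by (simp add: flags_def)
    have clB: "?R `` {(v, e, f)} = Fl FB" if "f \<in> FB" "e \<in> f" "v \<in> e" for v e f
    proof -
      have "f \<notin> FA" using that disj by auto
      then show ?thesis using cl[of v e f] that FlA by (simp add: flags_def)
    qed
    show ?thesis
    proof (intro set_eqI iffI)
      fix X assume "X \<in> flags ?F // ?R"
      then obtain \<Phi> where "\<Phi> \<in> flags ?F" "X = ?R `` {\<Phi>}" by (auto simp: quotient_def)
      moreover obtain v e f where "\<Phi> = (v, e, f)" by (cases \<Phi>)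
      ultimately show "X \<in> {Fl FA, Fl FB}"
        using clA[of f e v] clB[of f e v] by (auto simp: flags_def simp del: Image_singleton_iff)
    next
      fix X assume "X \<in> {Fl FA, Fl FB}"
      moreover have "(v0, e0, a) \<in> flags ?F" "(v0, e0, b) \<in> flags ?F" using ab v0 by (auto simp: flags_def)
      ultimately show "X \<in> flags ?F // ?R" using clA[OF ab(1,2) v0] clB[OF ab(3,4) v0]
        by (metis insert_iff quotientI singletonD)
    qed
  qed
  moreover have "Fl FA \<noteq> Fl FB" using ab v0 disj by (auto simp: Fl_def set_eq_iff)
  ultimately have card2: "card (flags ?F // ?R) = 2" by simp
  have "(\<Phi>, flag0 \<Phi>) \<in> ?R \<and> (\<Phi>, flag1 \<Phi>) \<in> ?R \<and> (\<Phi>, flag2 ?F \<Phi>) \<notin> ?R" if \<Phi>: "\<Phi> \<in> flags ?F" for \<Phi>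
  proof -
    obtain v e f where p: "\<Phi> = (v, e, f)" by (cases \<Phi>)
    have m: "f \<in> ?F" "e \<in> f" "v \<in> e" "e \<in> E" using \<Phi> F by (auto simp: p flags_def)
    obtain w where w: "e = {v, w}" "v \<noteq> w" using simple_graph_edgeE[OF s m(4,3)] by metis
    have "(THE u. u \<in> e \<and> u \<noteq> v) = w" using w by (intro the_equality) auto
    then have "flag0 \<Phi> = (w, e, f)" by (simp add: p flag0_def)
    then have 0: "(\<Phi>, flag0 \<Phi>) \<in> ?R" using m w by (auto simp: p flags_def intro!: rel)
    obtain e' where e': "e' \<in> f" "v \<in> e'" "e' \<noteq> e" and u: "\<And>e''. e'' \<in> f \<and> v \<in> e'' \<and> e'' \<noteq> e \<Longrightarrow> e'' = e'"
      using is_cycle_mates[OF cyc[OF m(1)] m(2,3)] by blast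
    have "(THE e'. e' \<in> f \<and> v \<in> e' \<and> e' \<noteq> e) = e'" using e' u by (intro the_equality) blast+
    then have "flag1 \<Phi> = (v, e', f)" by (simp add: p flag1_def)
    then have 1: "(\<Phi>, flag1 \<Phi>) \<in> ?R" using m e' by (auto simp: p flags_def intro!: rel)
    obtain g h where gh: "g \<in> FA" "h \<in> FB" "g \<noteq> h" "{h \<in> ?F. e \<in> h} = {g, h}" using two[OF m(4)] by blast
    define f' where "f' = (if f = g then h else g)"
    have gh': "k \<in> ?F \<and> e \<in> k \<longleftrightarrow> k = g \<or> k = h" for k using gh(4) by blast
    have "(THE k. k \<in> ?F \<and> e \<in> k \<and> k \<noteq> f) = f'"
      unfolding conj_assoc[symmetric] gh' using gh(3) gh'[of f] m(1,2) unfolding f'_def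
      by (intro the_equality) (auto split: if_splits)
    then have f2: "flag2 ?F \<Phi> = (v, e, f')" by (simp add: p flag2_def)
    have "f \<in> {g, h}" using gh m by blast
    then have "f \<in> FA \<longleftrightarrow> f' \<notin> FA" using gh disj by (auto simp: f'_def)
    then have 2: "(\<Phi>, flag2 ?F \<Phi>) \<notin> ?R" using dir f2 p by metis
    show ?thesis using 0 1 2 by blast
  qed
  then show "?F \<in> class201_maps V E" using poly card2 by (simp add: class201_maps_def class_2_01_def)
  show "face_lengths ?F = {k, l}" unfolding face_lengths_def using ab cA cB by (force simp: image_iff)
qed

text \<open>Indexing the closed walk by all integers avoids a special case at its end; coincidences
  are then expressed by divisibility alone.\<close>

lemma is_cycle_closed_walk:
  fixes w :: "int \<Rightarrow> 'a" and l :: nat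
  assumes "l \<ge> 3" and w: "\<And>i j. w i = w j \<longleftrightarrow> int l dvd i - j"
    and E: "\<And>i. {w i, w (i + 1)} \<in> E" and C: "C = range (\<lambda>i. {w i, w (i + 1)})"
  shows "is_cycle E C" "card C = l"
proof -
  let ?e = "\<lambda>i. {w i, w (i + 1)}"
  \<comment> \<open>If \<open>l\<close> divided 2, an edge could recur in the opposite direction; if
    it divided 1, consecutive edges would coincide.\<close>
  have nd: "\<not> int l dvd 1" "\<not> int l dvd 2" using assms(1) by (auto dest: zdvd_imp_le)
  have eeq: "?e i = ?e j \<longleftrightarrow> int l dvd i - j" for i j
  proof
    assume "?e i = ?e j"
    then consider "w i = w j" | "w i = w (j + 1)" "w (i + 1) = w j" by (metis doubleton_eq_iff)
    then show "int l dvd i - j"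
    proof cases
      case 2
      then have "int l dvd (i + 1 - j) - (i - (j + 1))" unfolding w by (rule dvd_diff[rotated])
      then show ?thesis using nd by simp
    qed (simp add: w)
  next
    assume "int l dvd i - j"
    then have "w i = w j" "w (i + 1) = w (j + 1)" by (auto simp: w)
    then show "?e i = ?e j" by simp
  qed
  have mem: "w i \<in> ?e j \<longleftrightarrow> ?e j = ?e i \<or> ?e j = ?e (i - 1)" for i j
    unfolding eeq insert_iff w by (simp add: dvd_diff_commute algebra_simps)
  show "is_cycle E C" unfolding is_cycle_def
  proof (intro conjI ballI allI impI)
    show "C \<subseteq> E" "C \<noteq> {}" using E C by auto
    fix v assume "v \<in> \<Union>C"
    then obtain i where v: "v = w i" unfolding C by auto
    have "{e \<in> C. v \<in> e} = {?e i, ?e (i - 1)}" (is "?l = ?r")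
    proof
      show "?l \<subseteq> ?r"
      proof
        fix e assume "e \<in> ?l"
        then obtain j where "e = ?e j" "w i \<in> ?e j" unfolding v C by blast
        then show "e \<in> ?r" using mem[of i j] by simp
      qed
      show "?r \<subseteq> ?l" unfolding v C by (auto intro: range_eqI[of _ _ i] range_eqI[of _ _ "i - 1"])
    qed
    moreover have "?e i \<noteq> ?e (i - 1)" using eeq[of i "i - 1"] nd by simp
    ultimately show "card {e \<in> C. v \<in> e} = 2" by (metis card_2_iff)
  next
    fix D assume D: "D \<subseteq> C \<and> D \<noteq> {} \<and> D \<noteq> C"
    show "\<exists>e\<in>D. \<exists>e'\<in>C - D. e \<inter> e' \<noteq> {}"
    proof (rule ccontr)
      assume no: "\<not> ?thesis"
      have step: "?e i \<in> D \<longleftrightarrow> ?e (i + 1) \<in> D" for i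
      proof -
        have "?e i \<in> C" "?e (i + 1) \<in> C" "?e i \<inter> ?e (i + 1) \<noteq> {}" unfolding C by blast+
        moreover from no have "e' \<in> D" if "e \<in> D" "e' \<in> C" "e \<inter> e' \<noteq> {}" for e e' using that by blast
        ultimately show ?thesis by (metis inf_commute)
      qed
      obtain i where i: "?e i \<in> D" using D C by auto
      have "?e j \<in> D" for j
      proof (induction j rule: int_induct[of _ i])
        case (step2 j)
        then show ?case using step[of "j - 1"] by simp
      qed (use i step in auto)
      then show False using D C by auto
    qed
  qed
  have "C = ?e ` {0..<int l}"
  proof -
    have "?e i \<in> ?e ` {0..<int l}" for i
    proof -
      have "?e i = ?e (i mod int l)" unfolding eeq by (simp add: dvd_minus_mod)
      then show ?thesis using assms(1) by (intro image_eqI[of _ _ "i mod int l"]) auto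
    qed
    then show ?thesis unfolding C by blast
  qed
  moreover have "inj_on ?e {0..<int l}"
  proof (rule inj_onI)
    fix i j assume "i \<in> {0..<int l}" "j \<in> {0..<int l}" "?e i = ?e j"
    then have "i mod int l = j mod int l" "0 \<le> i" "i < int l" "0 \<le> j" "j < int l"
      unfolding eeq mod_eq_dvd_iff[symmetric] by auto
    then show "i = j" using mod_pos_pos_trivial by metis
  qed
  ultimately show "card C = l" by (simp add: card_image)
qed

text \<open>Faces are compared locally: if both continue alike at each end of each common edge, the
  common edges exhaust both cycles.\<close>

lemma is_cycle_eqI:
  assumes f: "is_cycle E f" and g: "is_cycle E g" and "e0 \<in> f" "e0 \<in> g"
    and *: "\<And>e v. e \<in> f \<Longrightarrow> e \<in> g \<Longrightarrow> v \<in> e \<Longrightarrow> \<exists>e'. e' \<noteq> e \<and> v \<in> e' \<and> e' \<in> f \<and> e' \<in> g"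
  shows "f = g"
proof -
  have "\<forall>e\<in>f. e \<in> g" using f \<open>e0 \<in> f\<close> \<open>e0 \<in> g\<close>
  proof (rule is_cycle_connected_induct)
    fix e e' v assume h: "e \<in> f" "e' \<in> f" "v \<in> e" "v \<in> e'" "e \<in> g"
    then show "e' \<in> g" using *[of e v] is_cycle_unique_mate[OF f h(1,2)] by metis
  qed
  moreover have "\<forall>e\<in>g. e \<in> f" using g \<open>e0 \<in> g\<close> \<open>e0 \<in> f\<close>
  proof (rule is_cycle_connected_induct)
    fix e e' v assume h: "e \<in> g" "e' \<in> g" "v \<in> e" "v \<in> e'" "e \<in> f"
    then show "e' \<in> f" using *[of e v] is_cycle_unique_mate[OF g h(1,2)] by metis
  qed
  ultimately show ?thesis by blast
qed

section \<open>Labellings of Praeger-Xu graphs\<close>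

text \<open>The order of the quantifiers matters: \<open>z\<close> depends on \<open>m\<close> and
  \<tau> only, so the same \<open>z\<close> serves every labelling with this twist. This is what
  makes the map between two labellings in \<open>relabel\<close> well defined.\<close>

lemma twist_iterate:
  fixes n :: nat and \<tau> :: "int \<Rightarrow> bool"
  shows "\<exists>z. \<forall>L :: int \<Rightarrow> bool \<Rightarrow> bool \<Rightarrow> 'a. (\<forall>i a b. L (i + int n) a b = L i (a \<noteq> \<tau> i) (b \<noteq> \<tau> (i + 1))) \<longrightarrow>
     (\<forall>j a b. L (j + m * int n) a b = L j (a \<noteq> z j) (b \<noteq> z (j + 1)))"
proof (induction m rule: int_induct[of _ 0])
  case base
  show ?case by (rule exI[of _ "\<lambda>_. False"]) simp
next
  case (step1 m)
  then obtain z where z: "\<And>L :: int \<Rightarrow> bool \<Rightarrow> bool \<Rightarrow> 'a. \<forall>i a b. L (i + int n) a b = L i (a \<noteq> \<tau> i) (b \<noteq> \<tau> (i + 1)) \<Longrightarrow>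
     \<forall>j a b. L (j + m * int n) a b = L j (a \<noteq> z j) (b \<noteq> z (j + 1))" by blast
  show ?case
  proof (intro exI[of _ "\<lambda>j. \<tau> (j + m * int n) \<noteq> z j"] allI impI)
    fix L :: "int \<Rightarrow> bool \<Rightarrow> bool \<Rightarrow> 'a" and j a b
    assume t: "\<forall>i a b. L (i + int n) a b = L i (a \<noteq> \<tau> i) (b \<noteq> \<tau> (i + 1))"
    have "L (j + (m + 1) * int n) a b = L ((j + m * int n) + int n) a b" by (simp add: algebra_simps)
    also have "\<dots> = L (j + m * int n) (a \<noteq> \<tau> (j + m * int n)) (b \<noteq> \<tau> (j + 1 + m * int n))"
      by (subst t[rule_format]) (simp add: add_ac)
    also have "\<dots> = L j (a \<noteq> (\<tau> (j + m * int n) \<noteq> z j)) (b \<noteq> (\<tau> (j + 1 + m * int n) \<noteq> z (j + 1)))"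
      by (subst z[OF t, rule_format]) (rule arg_cong2[of _ _ _ _ "L j"]; blast)
    finally show "L (j + (m + 1) * int n) a b = L j (a \<noteq> (\<tau> (j + m * int n) \<noteq> z j)) (b \<noteq> (\<tau> (j + 1 + m * int n) \<noteq> z (j + 1)))" .
  qed
next
  case (step2 m)
  then obtain z where z: "\<And>L :: int \<Rightarrow> bool \<Rightarrow> bool \<Rightarrow> 'a. \<forall>i a b. L (i + int n) a b = L i (a \<noteq> \<tau> i) (b \<noteq> \<tau> (i + 1)) \<Longrightarrow>
     \<forall>j a b. L (j + m * int n) a b = L j (a \<noteq> z j) (b \<noteq> z (j + 1))" by blast
  show ?case
  proof (intro exI[of _ "\<lambda>j. \<tau> (j + (m - 1) * int n) \<noteq> z j"] allI impI)
    fix L :: "int \<Rightarrow> bool \<Rightarrow> bool \<Rightarrow> 'a" and j a b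
    assume t: "\<forall>i a b. L (i + int n) a b = L i (a \<noteq> \<tau> i) (b \<noteq> \<tau> (i + 1))"
    \<comment> \<open>Bits are their own inverses, so going one turn further can be undone by adding
      the same bits again.\<close>
    have "L (j + (m - 1) * int n) a b = L ((j + (m - 1) * int n) + int n)
        (a \<noteq> \<tau> (j + (m - 1) * int n)) (b \<noteq> \<tau> (j + 1 + (m - 1) * int n))"
      by (subst t[rule_format], rule arg_cong2[of _ _ _ _ "L (j + (m - 1) * int n)"]) (auto simp: add_ac)
    also have "\<dots> = L (j + m * int n) (a \<noteq> \<tau> (j + (m - 1) * int n)) (b \<noteq> \<tau> (j + 1 + (m - 1) * int n))"
      by (simp add: algebra_simps)
    also have "\<dots> = L j (a \<noteq> (\<tau> (j + (m - 1) * int n) \<noteq> z j)) (b \<noteq> (\<tau> (j + 1 + (m - 1) * int n) \<noteq> z (j + 1)))"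
      by (subst z[OF t, rule_format]) (rule arg_cong2[of _ _ _ _ "L j"]; blast)
    finally show "L (j + (m - 1) * int n) a b = L j (a \<noteq> (\<tau> (j + (m - 1) * int n) \<noteq> z j)) (b \<noteq> (\<tau> (j + 1 + (m - 1) * int n) \<noteq> z (j + 1)))" .
  qed
qed

section \<open>Vertices and edges under a labelling with twist\<close>

definition ed :: "(int \<Rightarrow> bool \<Rightarrow> bool \<Rightarrow> 'a) \<Rightarrow> int \<Rightarrow> bool \<Rightarrow> bool \<Rightarrow> bool \<Rightarrow> 'a set" where
  "ed L i a b c = {L i a b, L (i + 1) b c}"

text \<open>Addition of bits is written \<open>\<noteq>\<close>. Levels are integers rather than residues modulo \<open>n\<close>; going once
  around adds the bits \<open>\<tau> i\<close> and \<open>\<tau> (i + 1)\<close> to the coordinates of a vertex at level \<open>i\<close>.\<close>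

locale labelled_px =
  fixes n :: nat and \<tau> :: "int \<Rightarrow> bool" and V :: "'a set" and E :: "'a set set"
    and L :: "int \<Rightarrow> bool \<Rightarrow> bool \<Rightarrow> 'a"
  assumes n3: "n \<ge> 3"
    and twist: "L (i + int n) a b = L i (a \<noteq> \<tau> i) (b \<noteq> \<tau> (i + 1))"
    and lev: "L i a b = L j c d \<Longrightarrow> int n dvd i - j"
    and inj: "L i a b = L i c d \<Longrightarrow> a = c \<and> b = d"
    and V_eq: "V = {v. \<exists>i a b. v = L i a b}"
    and E_eq: "E = {e. \<exists>i a b c. e = ed L i a b c}"
begin

lemma L_in_V [simp]: "L i a b \<in> V" unfolding V_eq by blast

lemma ed_in_E [simp]: "ed L i a b c \<in> E" unfolding E_eq by blast

lemma not_dvd_small: "\<not> int n dvd 1" "\<not> int n dvd 2" "\<not> int n dvd -1" "\<not> int n dvd -2"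
  using n3 by (auto dest: zdvd_imp_le)

lemma L_eq_iff: "L i a b = L i c d \<longleftrightarrow> a = c \<and> b = d" using inj[of i a b c d] by auto

lemma L_neq:
  "L i a b \<noteq> L (i + 1) c d" "L (i + 1) a b \<noteq> L i c d" "L i a b \<noteq> L (i - 1) c d" "L (i - 1) a b \<noteq> L i c d"
  "L (i - 1) a b \<noteq> L (i + 1) c d" "L (i + 1) a b \<noteq> L (i - 1) c d"
  "L i a b \<noteq> L (i + 2) c d" "L (i + 2) a b \<noteq> L i c d"
  using lev not_dvd_small by (fastforce dest: lev)+

lemma shift:
  assumes "int n dvd k"
  shows "\<exists>z. \<forall>j a b. L (j + k) a b = L j (a \<noteq> z j) (b \<noteq> z (j + 1))"
proof -
  obtain m where "k = int n * m" using assms by (rule dvdE)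
  then have "k = m * int n" by (simp add: mult.commute)
  then show ?thesis using twist_iterate[where 'a='a, of n \<tau> m] twist by blast
qed

text \<open>Two labels of one vertex differ by a whole number of turns, and the bits
  \<open>z\<close> added by these turns translate between the levels everywhere, not only at this
  vertex.\<close>

lemma L_eqE:
  assumes "L i a b = L j c d"
  obtains z where "\<forall>k a b. L (k + (j - i)) a b = L k (a \<noteq> z k) (b \<noteq> z (k + 1))" "a = (c \<noteq> z i)" "b = (d \<noteq> z (i + 1))"
proof -
  have "int n dvd j - i" using lev[OF assms[symmetric]] .
  then obtain z where z: "\<forall>k a b. L (k + (j - i)) a b = L k (a \<noteq> z k) (b \<noteq> z (k + 1))" using shift by blast
  have "L i a b = L i (c \<noteq> z i) (d \<noteq> z (i + 1))" using assms z[rule_format, of i c d] by simp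
  then have "a = (c \<noteq> z i) \<and> b = (d \<noteq> z (i + 1))" by (rule inj)
  then show thesis using that[OF z] by blast
qed

lemma nbr:
  assumes "{L i a b, w} \<in> E"
  shows "\<exists>c. w = L (i + 1) b c \<or> w = L (i - 1) c a"
proof -
  obtain j a' b' c' where e: "{L i a b, w} = {L j a' b', L (j + 1) b' c'}"
    using assms unfolding E_eq ed_def by blast
  then consider "L i a b = L j a' b'" "w = L (j + 1) b' c'" | "L i a b = L (j + 1) b' c'" "w = L j a' b'"
    by (auto simp: doubleton_eq_iff)
  then show ?thesis
  proof cases
    case 1
    from 1(1) obtain z where z: "\<forall>k a b. L (k + (j - i)) a b = L k (a \<noteq> z k) (b \<noteq> z (k + 1))" "a = (a' \<noteq> z i)" "b = (b' \<noteq> z (i + 1))"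
      by (rule L_eqE)
    from z(1)[rule_format, of "i + 1" b' c'] show ?thesis using 1(2) z(3) by (auto simp: add_ac)
  next
    case 2
    from 2(1) obtain z where z: "\<forall>k a b. L (k + (j + 1 - i)) a b = L k (a \<noteq> z k) (b \<noteq> z (k + 1))" "a = (b' \<noteq> z i)" "b = (c' \<noteq> z (i + 1))"
      by (rule L_eqE)
    from z(1)[rule_format, of "i - 1" a' b'] show ?thesis using 2(2) z(2) by auto
  qed
qed

lemma adj_iff: "{L i a b, L (i + 1) c d} \<in> E \<longleftrightarrow> b = c"
proof
  assume "{L i a b, L (i + 1) c d} \<in> E"
  from nbr[OF this] obtain x where "L (i + 1) c d = L (i + 1) b x \<or> L (i + 1) c d = L (i - 1) x a" ..
  then have "L (i + 1) c d = L (i + 1) b x" using L_neq(6)[of i c d x a] by simp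
  then show "b = c" by (auto dest: inj)
next
  assume "b = c" then show "{L i a b, L (i + 1) c d} \<in> E" using ed_in_E[of i a b d] by (simp add: ed_def)
qed

lemma edge_at:
  assumes "e \<in> E" "L i a b \<in> e"
  shows "\<exists>c. e = ed L i a b c \<or> e = ed L (i - 1) c a b"
proof -
  obtain j a' b' c' where e: "e = {L j a' b', L (j + 1) b' c'}" using assms(1) unfolding E_eq ed_def by blast
  then have "L i a b = L j a' b' \<or> L i a b = L (j + 1) b' c'" using assms(2) by simp
  then have "\<exists>w. e = {L i a b, w}" unfolding e by (metis insert_commute)
  then obtain w where w: "e = {L i a b, w}" ..
  then show ?thesis using nbr[of i a b w] assms(1) by (auto simp: ed_def insert_commute)
qed

lemma edges_at: "{e \<in> E. L i a b \<in> e} = {ed L i a b True, ed L i a b False, ed L (i - 1) True a b, ed L (i - 1) False a b}"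
proof (intro set_eqI iffI)
  fix e assume "e \<in> {e \<in> E. L i a b \<in> e}"
  then obtain c where "e = ed L i a b c \<or> e = ed L (i - 1) c a b" using edge_at[of e i a b] by blast
  then show "e \<in> {ed L i a b True, ed L i a b False, ed L (i - 1) True a b, ed L (i - 1) False a b}"
    by (cases c) auto
next
  fix e assume "e \<in> {ed L i a b True, ed L i a b False, ed L (i - 1) True a b, ed L (i - 1) False a b}"
  moreover have "ed L i a b c \<in> {e \<in> E. L i a b \<in> e}" "ed L (i - 1) c a b \<in> {e \<in> E. L i a b \<in> e}" for c
    using ed_in_E[of i a b c] ed_in_E[of "i - 1" c a b] by (simp_all add: ed_def)
  ultimately show "e \<in> {e \<in> E. L i a b \<in> e}" by blast
qed

lemma ed_eq_iff: "ed L i a b c = ed L i a' b' c' \<longleftrightarrow> a = a' \<and> b = b' \<and> c = c'"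
  unfolding ed_def doubleton_eq_iff using L_eq_iff L_neq by metis

lemma ed_neq: "ed L i a b c \<noteq> ed L (i - 1) a' b' c'" "ed L (i - 1) a b c \<noteq> ed L i a' b' c'"
  unfolding ed_def doubleton_eq_iff using L_neq by (metis diff_add_cancel)+

lemma ed_mem: "L i a b \<in> ed L i a' b' c \<longleftrightarrow> a = a' \<and> b = b'"
  "L i a b \<in> ed L (i - 1) c a' b' \<longleftrightarrow> a = a' \<and> b = b'"
  "L (i + 1) a b \<in> ed L i c a' b' \<longleftrightarrow> a = a' \<and> b = b'"
  unfolding ed_def using L_neq L_eq_iff by auto

lemma ed_eq_levE:
  assumes "ed L i a b c = ed L j a' b' c'"
  obtains z where "\<forall>k a b. L (k + (j - i)) a b = L k (a \<noteq> z k) (b \<noteq> z (k + 1))"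
    "a = (a' \<noteq> z i)" "b = (b' \<noteq> z (i + 1))" "c = (c' \<noteq> z (i + 2))"
proof -
  have "L i a b = L j a' b' \<and> L (i + 1) b c = L (j + 1) b' c'"
  proof (rule ccontr)
    assume "\<not> ?thesis"
    \<comment> \<open>With the ends exchanged, \<open>n\<close> would divide both
      \<open>i - j - 1\<close> and \<open>i - j + 1\<close>, hence 2.\<close>
    then have "L i a b = L (j + 1) b' c'" "L (i + 1) b c = L j a' b'"
      using assms unfolding ed_def doubleton_eq_iff by auto
    then have "int n dvd i - (j + 1)" "int n dvd i + 1 - j" using lev by blast+
    then have "int n dvd (i + 1 - j) - (i - (j + 1))" by (rule dvd_diff[rotated])
    then show False using not_dvd_small by simp
  qed
  then have e0: "L i a b = L j a' b'" and e: "L (i + 1) b c = L (j + 1) b' c'" by blast+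
  from e0 obtain z where z: "\<forall>k a b. L (k + (j - i)) a b = L k (a \<noteq> z k) (b \<noteq> z (k + 1))"
    "a = (a' \<noteq> z i)" "b = (b' \<noteq> z (i + 1))" by (rule L_eqE)
  have "L (j + 1) b' c' = L (i + 1) (b' \<noteq> z (i + 1)) (c' \<noteq> z (i + 2))"
    using z(1)[rule_format, of "i + 1" b' c'] by (simp add: add_ac)
  then have "c = (c' \<noteq> z (i + 2))" using e inj[of "i + 1" b c] by simp
  then show thesis using that[OF z(1) z(2,3)] by blast
qed

lemma rep_in_range:
  shows "\<exists>j c d. 0 \<le> j \<and> j < int n \<and> L i a b = L j c d"
proof -
  have "int n dvd i - i mod int n" by (simp add: dvd_minus_mod)
  from shift[OF this] obtain z where "\<forall>j a b. L (j + (i - i mod int n)) a b = L j (a \<noteq> z j) (b \<noteq> z (j + 1))" ..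
  from this[rule_format, of "i mod int n" a b] show ?thesis using n3 by (intro exI[of _ "i mod int n"]) auto
qed

lemma simple: "simple_graph V E"
proof -
  have "V \<subseteq> (\<lambda>(i, a, b). L i a b) ` ({0..<int n} \<times> UNIV \<times> UNIV)"
  proof
    fix v assume "v \<in> V"
    then obtain i a b where "v = L i a b" unfolding V_eq by blast
    moreover obtain j c d where "0 \<le> j" "j < int n" "L i a b = L j c d" using rep_in_range by blast
    ultimately show "v \<in> (\<lambda>(i, a, b). L i a b) ` ({0..<int n} \<times> UNIV \<times> UNIV)"
      by (intro image_eqI[of _ _ "(j, c, d)"]) auto
  qed
  then have "finite V" by (rule finite_subset) simp
  then show ?thesis unfolding simple_graph_def E_eq ed_def using L_neq(1) L_in_V by blast
qed

text \<open>A step upwards may choose the new bit freely, so from two levels above a vertex of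
  \<open>S\<close> onwards all vertices are in \<open>S\<close>. Every vertex has a label that high,
  obtained by going round often enough.\<close>

lemma connected: "connected_graph V E"
  unfolding connected_graph_def
proof (intro allI impI, rule ccontr)
  fix S assume S: "S \<subseteq> V \<and> S \<noteq> {} \<and> S \<noteq> V" and no: "\<not> (\<exists>u\<in>S. \<exists>v\<in>V - S. {u, v} \<in> E)"
  have step: "L (i + 1) b c \<in> S" if "L i a b \<in> S" for i a b c
    using no that ed_in_E[of i a b c] L_in_V[of "i + 1" b c] unfolding ed_def by blast
  obtain i0 a0 b0 where i0: "L i0 a0 b0 \<in> S" using S unfolding V_eq by blast
  have ge: "\<forall>a b. L i a b \<in> S" if "i \<ge> i0 + 2" for i
    using that
  proof (induction i rule: int_ge_induct)
    case base
    have "L (i0 + 2) b c \<in> S" for b c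
      using step[OF step[OF i0, of b], of c] by (simp add: add.assoc)
    then show ?case by blast
  qed (use step in blast)
  have "L i a b \<in> S" for i a b
  proof -
    \<comment> \<open>A multiple of \<open>n\<close> large enough to lift level \<open>i\<close> to
      at least \<open>i0 + 2\<close>.\<close>
    define k where "k = (\<bar>i0\<bar> + \<bar>i\<bar> + 2) * int n"
    have "int n dvd k" by (simp add: k_def)
    from shift[OF this] obtain z where z: "\<forall>j a b. L (j + k) a b = L j (a \<noteq> z j) (b \<noteq> z (j + 1))" ..
    have "k \<ge> \<bar>i0\<bar> + \<bar>i\<bar> + 2" unfolding k_def using n3 by (intro mult_le_cancel_left1[THEN iffD2]) auto
    then have "L (i + k) (a \<noteq> z i) (b \<noteq> z (i + 1)) \<in> S" using ge[of "i + k"] by auto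
    moreover have "L (i + k) (a \<noteq> z i) (b \<noteq> z (i + 1)) = L i a b"
      unfolding z[rule_format] by (rule arg_cong2[of _ _ _ _ "L i"]; blast)
    ultimately show ?thesis by simp
  qed
  then show False using S unfolding V_eq by blast
qed

text \<open>A vertex at level \<open>i\<close> carries the bits at positions \<open>i\<close> and
  \<open>i + 1\<close>, so reversing levels sends position \<open>i\<close> to position
  \<open>1 - i\<close>. A turn upwards becomes a turn downwards, which moves the place where \<tau>
  is read by another \<open>n\<close>.\<close>

lemma reversed: "labelled_px n (\<lambda>i. \<tau> (1 - i - int n)) V E (\<lambda>i a b. L (- i) b a)"
proof
  show "n \<ge> 3" by (rule n3)
  fix i j :: int and a b c d :: bool
  have "L (- i) (b \<noteq> \<tau> (- i - int n)) (a \<noteq> \<tau> (1 - i - int n)) = L (- i - int n + int n) (b \<noteq> \<tau> (- i - int n)) (a \<noteq> \<tau> (1 - i - int n))" by simp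
  also have "\<dots> = L (- i - int n) b a"
    by (subst twist, rule arg_cong2[of _ _ _ _ "L (- i - int n)"]) (auto simp: algebra_simps)
  finally show "L (- (i + int n)) b a = L (- i) (b \<noteq> \<tau> (1 - (i + 1) - int n)) (a \<noteq> \<tau> (1 - i - int n))"
    by simp
  show "int n dvd i - j" if "L (- i) b a = L (- j) d c" using lev[OF that] by (simp add: dvd_diff_commute)
  show "a = c \<and> b = d" if "L (- i) b a = L (- i) d c" using inj[OF that] by simp
next
  show "V = {v. \<exists>i a b. v = L (- i) b a}" unfolding V_eq by (metis minus_minus)
  have "ed (\<lambda>i a b. L (- i) b a) i a b c = ed L (- i - 1) c b a" for i a b c
    by (auto simp: ed_def)
  then show "E = {e. \<exists>i a b c. e = ed (\<lambda>i a b. L (- i) b a) i a b c}" unfolding E_eq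
    by (auto) (metis add.inverse_inverse diff_add_cancel minus_diff_eq uminus_add_conv_diff)
qed

text \<open>A gauge transformation: position \<open>i\<close> is translated by \<open>u i\<close>
  and levels are shifted by \<open>k\<close>. The sequence \<open>u\<close> need not be periodic;
  its failure to be so is absorbed into the twist.\<close>

lemma gauged:
  "labelled_px n (\<lambda>i. (u i \<noteq> u (i + int n)) \<noteq> \<tau> (i + k)) V E (\<lambda>i a b. L (i + k) (a \<noteq> u i) (b \<noteq> u (i + 1)))"
proof
  show "n \<ge> 3" by (rule n3)
  fix i j :: int and a b c d :: bool
  have "L (i + int n + k) (a \<noteq> u (i + int n)) (b \<noteq> u (i + int n + 1)) = L (i + k + int n) (a \<noteq> u (i + int n)) (b \<noteq> u (i + int n + 1))"
    by (simp add: add_ac)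
  also have "\<dots> = L (i + k) ((a \<noteq> ((u i \<noteq> u (i + int n)) \<noteq> \<tau> (i + k))) \<noteq> u i)
      ((b \<noteq> ((u (i + 1) \<noteq> u (i + 1 + int n)) \<noteq> \<tau> (i + 1 + k))) \<noteq> u (i + 1))"
    by (subst twist, rule arg_cong2[of _ _ _ _ "L (i + k)"]) (auto simp: add_ac)
  finally show "L (i + int n + k) (a \<noteq> u (i + int n)) (b \<noteq> u (i + int n + 1)) = L (i + k) ((a \<noteq> ((u i \<noteq> u (i + int n)) \<noteq> \<tau> (i + k))) \<noteq> u i)
      ((b \<noteq> ((u (i + 1) \<noteq> u (i + 1 + int n)) \<noteq> \<tau> (i + 1 + k))) \<noteq> u (i + 1))" .
  show "int n dvd i - j" if "L (i + k) (a \<noteq> u i) (b \<noteq> u (i + 1)) = L (j + k) (c \<noteq> u j) (d \<noteq> u (j + 1))"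
    using lev[OF that] by simp
  show "a = c \<and> b = d" if "L (i + k) (a \<noteq> u i) (b \<noteq> u (i + 1)) = L (i + k) (c \<noteq> u i) (d \<noteq> u (i + 1))"
    using inj[OF that] by blast
next
  show "V = {v. \<exists>i a b. v = L (i + k) (a \<noteq> u i) (b \<noteq> u (i + 1))}" (is "_ = ?R")
  proof -
    have "L i a b \<in> ?R" for i a b
    proof -
      have "L i a b = L ((i - k) + k) ((a \<noteq> u (i - k)) \<noteq> u (i - k)) ((b \<noteq> u (i - k + 1)) \<noteq> u (i - k + 1))"
        by (simp, rule arg_cong2[of _ _ _ _ "L i"]; blast)
      then show ?thesis by blast
    qed
    then show ?thesis unfolding V_eq by blast
  qed
  show "E = {e. \<exists>i a b c. e = ed (\<lambda>i a b. L (i + k) (a \<noteq> u i) (b \<noteq> u (i + 1))) i a b c}" (is "_ = ?R")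
  proof
    show "?R \<subseteq> E"
    proof
      fix e assume "e \<in> ?R"
      then obtain i a b c where "e = ed (\<lambda>i a b. L (i + k) (a \<noteq> u i) (b \<noteq> u (i + 1))) i a b c" by blast
      then have "e = ed L (i + k) (a \<noteq> u i) (b \<noteq> u (i + 1)) (c \<noteq> u (i + 1 + 1))" by (simp add: ed_def add_ac)
      then show "e \<in> E" by simp
    qed
    show "E \<subseteq> ?R"
    proof
      fix e assume "e \<in> E"
      then obtain i a b c where e: "e = ed L i a b c" unfolding E_eq by blast
      have "e = ed (\<lambda>i a b. L (i + k) (a \<noteq> u i) (b \<noteq> u (i + 1))) (i - k) (a \<noteq> u (i - k)) (b \<noteq> u (i - k + 1)) (c \<noteq> u (i - k + 1 + 1))"
      proof -
        have x: "((p \<noteq> q) \<noteq> q) = p" for p q :: bool by blast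
        have k: "i - k + k = i" "i - k + 1 + k = i + 1" by simp_all
        show ?thesis unfolding e ed_def x k ..
      qed
      then show "e \<in> ?R" by blast
    qed
  qed
qed

text \<open>An automorphism is treated as a second labelling of the same graph with the same twist,
  so that results comparing two labellings apply to it.\<close>

lemma image_labelled:
  assumes g: "graph_automorphism V E \<sigma>"
  shows "labelled_px n \<tau> V E (\<lambda>i a b. \<sigma> (L i a b))"
proof
  have inj': "inj_on \<sigma> V" and im: "\<sigma> ` V = V" and e: "\<And>u v. u \<in> V \<Longrightarrow> v \<in> V \<Longrightarrow> {u, v} \<in> E \<longleftrightarrow> {\<sigma> u, \<sigma> v} \<in> E"
    using g by (auto simp: graph_automorphism_def bij_betw_def)
  show "n \<ge> 3" by (rule n3)
  show "\<sigma> (L (i + int n) a b) = \<sigma> (L i (a \<noteq> \<tau> i) (b \<noteq> \<tau> (i + 1)))" for i a b by (simp only: twist)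
  have i: "\<sigma> (L i a b) = \<sigma> (L j c d) \<Longrightarrow> L i a b = L j c d" for i a b j c d
    using inj' by (auto dest: inj_onD)
  show "int n dvd i - j" if "\<sigma> (L i a b) = \<sigma> (L j c d)" for i j a b c d using i[OF that] by (rule lev)
  show "a = c \<and> b = d" if "\<sigma> (L i a b) = \<sigma> (L i c d)" for i a b c d using i[OF that] by (rule inj)
  have "\<sigma> ` {v. \<exists>i a b. v = L i a b} = {v. \<exists>i a b. v = \<sigma> (L i a b)}" by blast
  then show "V = {v. \<exists>i a b. v = \<sigma> (L i a b)}" using im V_eq by simp
  have ed: "ed (\<lambda>i a b. \<sigma> (L i a b)) i a b c = \<sigma> ` ed L i a b c" for i a b c by (simp add: ed_def)
  show "E = {e. \<exists>i a b c. e = ed (\<lambda>i a b. \<sigma> (L i a b)) i a b c}"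
  proof (intro set_eqI iffI)
    fix f assume f: "f \<in> E"
    then obtain u v where uv: "u \<in> V" "v \<in> V" "f = {u, v}" using simple by (auto simp: simple_graph_def)
    then obtain u' v' where u': "u' \<in> V" "v' \<in> V" "u = \<sigma> u'" "v = \<sigma> v'" using im by (metis imageE)
    then have "{u', v'} \<in> E" using e f uv by auto
    moreover have "f = \<sigma> ` {u', v'}" using uv u' by simp
    ultimately show "f \<in> {e. \<exists>i a b c. e = ed (\<lambda>i a b. \<sigma> (L i a b)) i a b c}" unfolding ed using E_eq by blast
  next
    fix f assume "f \<in> {e. \<exists>i a b c. e = ed (\<lambda>i a b. \<sigma> (L i a b)) i a b c}"
    then show "f \<in> E" unfolding ed using graph_automorphism_edge[OF simple g] by auto
  qed
qed

end

text \<open>Labels coincide in one labelling exactly when they coincide in the other, since the same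
  turns identify them. All automorphisms constructed later, except the one in
  \<open>exchange\<close>, come from this lemma, with gauged or reversed labellings
  inserted.\<close>

lemma relabel:
  assumes "labelled_px n \<tau> V E L" "labelled_px n \<tau> V E M"
  shows "\<exists>\<sigma>. graph_automorphism V E \<sigma> \<and> (\<forall>i a b. \<sigma> (L i a b) = M i a b)"
proof -
  interpret L: labelled_px n \<tau> V E L by fact
  interpret M: labelled_px n \<tau> V E M by fact
  \<comment> \<open>A coincidence of labels comes from \<open>m\<close> turns, and the common
    \<open>z\<close> carries it over to the other labelling.\<close>
  have wd: "N i a b = N j c d" if LN: "labelled_px n \<tau> V E L'" "labelled_px n \<tau> V E N" and e: "L' i a b = L' j c d"
    for i j a b c d and L' N :: "int \<Rightarrow> bool \<Rightarrow> bool \<Rightarrow> 'a"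
  proof -
    interpret L': labelled_px n \<tau> V E L' by fact
    interpret N: labelled_px n \<tau> V E N by fact
    obtain m where "j - i = int n * m" using L'.lev[OF e[symmetric]] by (rule dvdE)
    then have m: "j = i + m * int n" by (simp add: algebra_simps)
    obtain z where z: "\<And>L :: int \<Rightarrow> bool \<Rightarrow> bool \<Rightarrow> 'a. \<forall>i a b. L (i + int n) a b = L i (a \<noteq> \<tau> i) (b \<noteq> \<tau> (i + 1)) \<Longrightarrow>
     \<forall>j a b. L (j + m * int n) a b = L j (a \<noteq> z j) (b \<noteq> z (j + 1))" using twist_iterate[where 'a='a, of n \<tau> m] by blast
    have "\<forall>i a b. L' (i + int n) a b = L' i (a \<noteq> \<tau> i) (b \<noteq> \<tau> (i + 1))" by (intro allI L'.twist)
    from z[OF this] have "L' j c d = L' i (c \<noteq> z i) (d \<noteq> z (i + 1))" unfolding m by blast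
    then have "a = (c \<noteq> z i) \<and> b = (d \<noteq> z (i + 1))" using e by (intro L'.inj) simp
    moreover have "\<forall>i a b. N (i + int n) a b = N i (a \<noteq> \<tau> i) (b \<noteq> \<tau> (i + 1))" by (intro allI N.twist)
    from z[OF this] have "N j c d = N i (c \<noteq> z i) (d \<noteq> z (i + 1))" unfolding m by blast
    ultimately show ?thesis by simp
  qed
  define \<sigma> where "\<sigma> v = (SOME w. \<exists>i a b. v = L i a b \<and> w = M i a b)" for v
  have s: "\<sigma> (L i a b) = M i a b" for i a b
  proof -
    have "\<exists>i' a' b'. L i a b = L i' a' b' \<and> \<sigma> (L i a b) = M i' a' b'"
      unfolding \<sigma>_def by (rule someI[of _ "M i a b"]) blast
    then show ?thesis using wd[OF assms] by metis
  qed
  have inj: "\<sigma> (L i a b) = \<sigma> (L j c d) \<longleftrightarrow> L i a b = L j c d" for i j a b c d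
    unfolding s using wd[OF assms] wd[OF assms(2,1)] by blast
  have "graph_automorphism V E \<sigma>"
    unfolding graph_automorphism_def
  proof (intro conjI ballI)
    have "\<sigma> ` V = V"
    proof
      show "\<sigma> ` V \<subseteq> V" unfolding L.V_eq using s M.L_in_V L.V_eq by auto
      show "V \<subseteq> \<sigma> ` V"
      proof
        fix v assume "v \<in> V"
        then obtain i a b where "v = M i a b" unfolding M.V_eq by blast
        then show "v \<in> \<sigma> ` V" using s[of i a b] L.L_in_V by (metis imageI)
      qed
    qed
    moreover have "inj_on \<sigma> V"
    proof (rule inj_onI)
      fix x y assume "x \<in> V" "y \<in> V" and e: "\<sigma> x = \<sigma> y"
      then obtain i a b j c d where xy: "x = L i a b" "y = L j c d" unfolding L.V_eq by blast
      show "x = y" using e unfolding xy inj .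
    qed
    ultimately show "bij_betw \<sigma> V V" by (simp add: bij_betw_def)
    fix u v assume "u \<in> V" "v \<in> V"
    then obtain i a b j c d where uv: "u = L i a b" "v = L j c d" unfolding L.V_eq by blast
    show "{u, v} \<in> E \<longleftrightarrow> {\<sigma> u, \<sigma> v} \<in> E"
    proof
      assume "{u, v} \<in> E"
      then obtain x where "v = L (i + 1) b x \<or> v = L (i - 1) x a" using L.nbr uv by blast
      then show "{\<sigma> u, \<sigma> v} \<in> E" using M.ed_in_E[of i a b x] M.ed_in_E[of "i - 1" x a b] s uv(1)
        by (auto simp: ed_def insert_commute)
    next
      assume "{\<sigma> u, \<sigma> v} \<in> E"
      then obtain x where "\<sigma> v = M (i + 1) b x \<or> \<sigma> v = M (i - 1) x a" using M.nbr uv s by metis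
      then have "v = L (i + 1) b x \<or> v = L (i - 1) x a" unfolding s[symmetric] uv(2) inj .
      then show "{u, v} \<in> E" using L.ed_in_E[of i a b x] L.ed_in_E[of "i - 1" x a b] uv(1)
        by (auto simp: ed_def insert_commute)
    qed
  qed
  then show ?thesis using s by blast
qed

text \<open>If levels go to levels, the image of the next level cannot fall back onto the level
  already filled, so the direction given by \<open>start\<close> persists. Adjacency settles the
  bits: the second bit at a level must agree with the first bit at the next, so each position is
  translated by a bit of its own.\<close>

lemma gauge_forward:
  assumes LL: "labelled_px n \<tau> V E L" and MM: "labelled_px n \<rho> V E M"
    and fib: "\<And>i j a b c d a' b'. M i a b = L j c d \<Longrightarrow> \<exists>c' d'. M i a' b' = L j c' d'"
    and start: "M i0 a0 b0 = L (i0 + k) c0 d0" "M (i0 + 1) a1 b1 = L (i0 + k + 1) c1 d1"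
  shows "\<exists>t. \<forall>i a b. M i a b = L (i + k) (a \<noteq> t i) (b \<noteq> t (i + 1))"
proof -
  interpret L: labelled_px n \<tau> V E L by fact
  interpret M: labelled_px n \<rho> V E M by fact
  define P where "P i = (\<forall>a b. \<exists>c d. M i a b = L (i + k) c d)" for i
  have PI: "P i" if "M i a b = L (i + k) c d" for i a b c d
    unfolding P_def using fib[OF that] by blast
  \<comment> \<open>Four labels go injectively to four labels, so the image fills the level. This is
    what excludes turning back in \<open>up\<close> and \<open>down\<close>.\<close>
  have surj: "\<exists>a b. L (i + k) c d = M i a b" if P: "P i" for i c d
  proof -
    have "\<exists>f. \<forall>x. (\<lambda>(a, b). M i a b) x = (\<lambda>(c, d). L (i + k) c d) (f x)"
      using P unfolding P_def by (intro choice) auto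
    then obtain f where f: "\<And>x. (\<lambda>(a, b). M i a b) x = (\<lambda>(c, d). L (i + k) c d) (f x)" by blast
    have "inj f"
    proof (rule injI)
      fix x y assume "f x = f y"
      then have "(\<lambda>(a, b). M i a b) x = (\<lambda>(a, b). M i a b) y" using f by metis
      then show "x = y" using M.L_eq_iff by (cases x; cases y) auto
    qed
    then have "surj f" by (rule finite_UNIV_inj_surj[rotated]) simp
    then obtain x where "f x = (c, d)" by (metis surjD)
    then show ?thesis using f[of x] by (cases x) (auto intro: exI sym)
  qed
  have up: "P (i + 2)" if PP: "P i" "P (i + 1)" for i
  proof -
    obtain c d where cd: "M (i + 1) True True = L (i + 1 + k) c d" using PP(2) unfolding P_def by blast
    have "{M (i + 1) True True, M (i + 1 + 1) True True} \<in> E" using M.ed_in_E[of "i + 1"] unfolding ed_def by blast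
    then have "{L (i + 1 + k) c d, M (i + 2) True True} \<in> E" unfolding cd by (simp add: add.assoc)
    then obtain x where "M (i + 2) True True = L (i + 1 + k + 1) d x \<or> M (i + 2) True True = L (i + 1 + k - 1) x c"
      using L.nbr by blast
    moreover have "M (i + 2) True True \<noteq> L (i + 1 + k - 1) x c"
    proof
      assume "M (i + 2) True True = L (i + 1 + k - 1) x c"
      then obtain a b where "M (i + 2) True True = M i a b" using surj[OF PP(1), of x c] by (auto simp: add_ac)
      then show False using M.L_neq(8)[of i True True a b] by simp
    qed
    ultimately have "M (i + 2) True True = L (i + 2 + k) d x" by (simp add: add_ac)
    then show ?thesis by (rule PI)
  qed
  have down: "P (i - 1)" if PP: "P i" "P (i + 1)" for i
  proof -
    obtain c d where cd: "M i True True = L (i + k) c d" using PP(1) unfolding P_def by blast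
    have "{M (i - 1) True True, M (i - 1 + 1) True True} \<in> E" using M.ed_in_E[of "i - 1"] unfolding ed_def by blast
    then have "{L (i + k) c d, M (i - 1) True True} \<in> E" using cd by (simp add: insert_commute)
    then obtain x where "M (i - 1) True True = L (i + k + 1) d x \<or> M (i - 1) True True = L (i + k - 1) x c"
      using L.nbr by blast
    moreover have "M (i - 1) True True \<noteq> L (i + k + 1) d x"
    proof
      assume "M (i - 1) True True = L (i + k + 1) d x"
      then obtain a b where "M (i - 1) True True = M (i + 1) a b" using surj[OF PP(2), of d x] by (auto simp: add_ac)
      then show False using M.L_neq(5)[of i True True a b] by simp
    qed
    ultimately have "M (i - 1) True True = L (i - 1 + k) x c" by (simp add: algebra_simps)
    then show ?thesis by (rule PI)
  qed
  have "P i \<and> P (i + 1)" for i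
  proof (induction i rule: int_induct[of _ i0])
    case base show ?case using PI[OF start(1)] PI[of "i0 + 1" a1 b1 c1 d1] start(2) by (simp add: add_ac)
  next
    case (step1 i) then show ?case using up[of i] by (simp add: add.assoc)
  next
    case (step2 i) then show ?case using down[of i] by simp
  qed
  then have "\<forall>i a b. \<exists>c d. M i a b = L (i + k) c d" unfolding P_def by blast
  then obtain A B where AB: "\<And>i a b. M i a b = L (i + k) (A i a b) (B i a b)" by metis
  \<comment> \<open>The left-hand side does not mention \<open>c\<close> and the right-hand side
    does not mention \<open>a\<close>, so both depend on \<open>b\<close> only.\<close>
  have BA: "B i a b = A (i + 1) b c" for i a b c
  proof -
    have "{M i a b, M (i + 1) b c} \<in> E" using M.ed_in_E by (simp add: ed_def)
    then have "{L (i + k) (A i a b) (B i a b), L (i + k + 1) (A (i + 1) b c) (B (i + 1) b c)} \<in> E"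
      unfolding AB by (simp add: add_ac)
    then show ?thesis using L.adj_iff by blast
  qed
  define t where "t i = A i False True" for i
  have A1: "A i a b = A i a True" for i a b
    using BA[of "i - 1" True a b] BA[of "i - 1" True a True] by simp
  have "A i True True \<noteq> A i False True" for i
  proof
    assume "A i True True = A i False True"
    moreover have "B i True True = B i False True" using BA[of i True True True] BA[of i False True True] by simp
    ultimately have "M i True True = M i False True" unfolding AB by simp
    then show False using M.inj by blast
  qed
  then have A: "A i a b = (a \<noteq> t i)" for i a b unfolding t_def using A1[of i a b] by (cases a) auto
  then have "B i a b = (b \<noteq> t (i + 1))" for i a b using BA[of i a b True] by simp
  then have "M i a b = L (i + k) (a \<noteq> t i) (b \<noteq> t (i + 1))" for i a b using AB[of i a b] A[of i a b] by simp
  then show ?thesis by blast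
qed

lemma gauge_backward:
  assumes LL: "labelled_px n \<tau> V E L" and MM: "labelled_px n \<rho> V E M"
    and fib: "\<And>i j a b c d a' b'. M i a b = L j c d \<Longrightarrow> \<exists>c' d'. M i a' b' = L j c' d'"
    and start: "M i0 a0 b0 = L (k - i0) c0 d0" "M (i0 + 1) a1 b1 = L (k - i0 - 1) c1 d1"
  shows "\<exists>t. \<forall>i a b. M i a b = L (k - i) (b \<noteq> t (i + 1)) (a \<noteq> t i)"
proof -
  interpret L: labelled_px n \<tau> V E L by fact
  have "\<exists>t. \<forall>i a b. M i a b = (\<lambda>i a b. L (- i) b a) (i + - k) (a \<noteq> t i) (b \<noteq> t (i + 1))"
  proof (rule gauge_forward[OF L.reversed MM])
    show "\<exists>c' d'. M i a' b' = L (- j) d' c'" if "M i a b = L (- j) d c" for i j a b c d a' b'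
      using fib[OF that] by blast
    show "M i0 a0 b0 = L (- (i0 + - k)) c0 d0" "M (i0 + 1) a1 b1 = L (- (i0 + - k + 1)) c1 d1"
      using start by (simp_all add: algebra_simps)
  qed
  then show ?thesis by (simp add: algebra_simps)
qed

section \<open>Families of faces\<close>

definition face :: "(int \<Rightarrow> bool \<Rightarrow> bool \<Rightarrow> 'a) \<Rightarrow> (int \<Rightarrow> bool) \<Rightarrow> 'a set set" where
  "face L c = range (\<lambda>i. ed L i (c i) (c (i + 1)) (c (i + 2)))"

text \<open>Over the field with two elements: \<open>c i + c (i + 3) = \<beta>\<close> if \<alpha> =
  0, and any four consecutive bits have sum \<beta> if \<alpha> = 1.\<close>

definition sol :: "bool \<Rightarrow> bool \<Rightarrow> (int \<Rightarrow> bool) \<Rightarrow> bool" where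
  "sol \<alpha> \<beta> c \<longleftrightarrow> (\<forall>i. c (i + 3) = ((c i \<noteq> (\<alpha> \<and> c (i + 1) \<noteq> c (i + 2))) \<noteq> \<beta>))"

definition straight_faces :: "bool \<Rightarrow> bool \<Rightarrow> (int \<Rightarrow> bool \<Rightarrow> bool \<Rightarrow> 'a) \<Rightarrow> 'a set set set" where
  "straight_faces \<alpha> \<beta> L = {face L c | c. sol \<alpha> \<beta> c}"

text \<open>The index \<open>j\<close> is the position of the shared bit \<open>b\<close>: the
  second bit at level \<open>j - 1\<close> and the first bit at level \<open>j\<close>.\<close>

definition quad :: "(int \<Rightarrow> bool \<Rightarrow> bool \<Rightarrow> 'a) \<Rightarrow> int \<Rightarrow> bool \<Rightarrow> 'a set set" where
  "quad L j b = {ed L (j - 1) a b c | a c. True}"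

definition quads :: "(int \<Rightarrow> bool \<Rightarrow> bool \<Rightarrow> 'a) \<Rightarrow> 'a set set set" where
  "quads L = {quad L j b | j b. True}"

text \<open>The characteristic polynomials of the two recurrences are \<open>x^3 + 1\<close> and
  \<open>x^3 + x^2 + x + 1\<close>; the latter divides \<open>x^4 + 1\<close> over the field with
  two elements.\<close>

definition period :: "bool \<Rightarrow> nat" where
  "period \<alpha> = (if \<alpha> then 4 else 3)"

section \<open>Bi-infinite solutions of the recurrence\<close>

lemma bi_infinite_iteration:
  fixes g :: "int \<Rightarrow> 's \<Rightarrow> 's"
  assumes "\<And>i. bij (g i)"
  shows "\<exists>S. S i0 = s0 \<and> (\<forall>i. S (i + 1) = g i (S i))"
proof -
  define fwd where "fwd = rec_nat s0 (\<lambda>k s. g (i0 + int k) s)"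
  define bwd where "bwd = rec_nat s0 (\<lambda>k s. inv (g (i0 - int k - 1)) s)"
  define S where "S i = (if i \<ge> i0 then fwd (nat (i - i0)) else bwd (nat (i0 - i)))" for i
  have "S (i + 1) = g i (S i)" for i
  proof (cases "i \<ge> i0")
    case True
    then have "nat (i + 1 - i0) = Suc (nat (i - i0))" by simp
    then show ?thesis using True by (simp add: S_def fwd_def)
  next
    case False
    then have k: "nat (i0 - i) = Suc (nat (i0 - (i + 1)))" by simp
    have "g i (S i) = bwd (nat (i0 - (i + 1)))"
      using False assms[of i] by (simp add: S_def k bwd_def bij_is_surj surj_f_inv_f del: nat_diff_distrib')
    also have "\<dots> = S (i + 1)" using False by (auto simp: S_def fwd_def bwd_def)
    finally show ?thesis ..
  qed
  moreover have "S i0 = s0" by (simp add: S_def fwd_def)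
  ultimately show ?thesis by blast
qed

text \<open>Windows of three consecutive bits are iterated; the step is injective on a finite set,
  hence invertible, and the sequence extends in both directions. The inhomogeneity \<delta> may vary
  with the position, as \<open>normal_form\<close> requires.\<close>

lemma recurrence_exists:
  "\<exists>u :: int \<Rightarrow> bool. u i0 = a \<and> u (i0 + 1) = b \<and> u (i0 + 2) = d \<and>
     (\<forall>i. u (i + 3) = ((u i \<noteq> (\<alpha> \<and> u (i + 1) \<noteq> u (i + 2))) \<noteq> \<delta> i))"
proof -
  define g :: "int \<Rightarrow> bool \<times> bool \<times> bool \<Rightarrow> bool \<times> bool \<times> bool"
    where "g i = (\<lambda>(x, y, z). (y, z, ((x \<noteq> (\<alpha> \<and> y \<noteq> z)) \<noteq> \<delta> i)))" for i
  have "inj (g i)" for i by (rule injI) (auto simp: g_def)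
  then have "bij (g i)" for i using finite_UNIV_inj_surj[of "g i"] by (simp add: bij_def)
  then obtain S where S: "S i0 = (a, b, d)" "\<And>i. S (i + 1) = g i (S i)"
    using bi_infinite_iteration[of g i0 "(a, b, d)"] by blast
  define u where "u i = fst (S i)" for i
  have S': "S i = (u i, u (i + 1), u (i + 2))" for i
  proof -
    obtain x y z where S0: "S i = (x, y, z)" by (cases "S i")
    then have S1: "S (i + 1) = (y, z, (x \<noteq> (\<alpha> \<and> y \<noteq> z)) \<noteq> \<delta> i)" unfolding S(2) by (simp add: g_def)
    then have "fst (S (i + 1 + 1)) = z" unfolding S(2)[of "i + 1"] by (simp add: g_def)
    then show ?thesis unfolding u_def using S0 S1 by (simp add: add.assoc)
  qed
  have "u (i + 3) = ((u i \<noteq> (\<alpha> \<and> u (i + 1) \<noteq> u (i + 2))) \<noteq> \<delta> i)" for i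
    using S(2)[of i] unfolding S'[of i] S'[of "i + 1"] g_def by (simp add: add.assoc)
  then show ?thesis using S(1) unfolding S'[of i0] by (intro exI[of _ u]) simp
qed

lemma sol_exists: "\<exists>c. sol \<alpha> \<beta> c \<and> c i = a \<and> c (i + 1) = b \<and> c (i + 2) = d"
  using recurrence_exists[of i a b d \<alpha> "\<lambda>_. \<beta>"] by (auto simp: sol_def)

lemma solD: "sol \<alpha> \<beta> c \<Longrightarrow> c (i + 3) = ((c i \<noteq> (\<alpha> \<and> c (i + 1) \<noteq> c (i + 2))) \<noteq> \<beta>)"
  unfolding sol_def by blast

lemma solD': "sol \<alpha> \<beta> c \<Longrightarrow> c (i - 1) = ((c (i + 2) \<noteq> (\<alpha> \<and> c i \<noteq> c (i + 1))) \<noteq> \<beta>)"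
  using solD[of \<alpha> \<beta> c "i - 1"] by (simp add: add.commute) blast

lemma sol_unique:
  assumes "sol \<alpha> \<beta> c" "sol \<alpha> \<beta> c'" "c i0 = c' i0" "c (i0 + 1) = c' (i0 + 1)" "c (i0 + 2) = c' (i0 + 2)"
  shows "c = c'"
proof -
  have "c i = c' i \<and> c (i + 1) = c' (i + 1) \<and> c (i + 2) = c' (i + 2)" for i
  proof (induction i rule: int_induct[of _ i0])
    case (step1 i)
    then show ?case using solD[OF assms(1), of i] solD[OF assms(2), of i] by (simp add: add.assoc)
  next
    case (step2 i)
    then show ?case using solD'[OF assms(1), of i] solD'[OF assms(2), of i] by (simp add: algebra_simps)
  qed (use assms in simp)
  then show ?thesis by blast
qed

lemma affine_iterate:
  fixes f :: "int \<Rightarrow> bool"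
  assumes "\<And>i. f (i + d) = (f i \<noteq> q)"
  shows "f (i + m * d) = (f i \<noteq> (q \<and> odd m))"
proof (induction m rule: int_induct[of _ 0])
  case (step1 m)
  have "f (i + (m + 1) * d) = (f (i + m * d) \<noteq> q)" using assms[of "i + m * d"] by (simp add: algebra_simps)
  then show ?case using step1 by auto
next
  case (step2 m)
  have "f (i + m * d) = (f (i + (m - 1) * d) \<noteq> q)" using assms[of "i + (m - 1) * d"] by (simp add: algebra_simps)
  then show ?case using step2 by auto
qed simp

text \<open>For \<alpha> = 1 two consecutive equations add up to \<open>c (i + 4) = c i\<close>,
  whatever \<beta> is. For \<alpha> = 0 every three positions add \<beta>, so \<open>n\<close>
  positions add it \<open>n div 3\<close> times.\<close>

lemma sol_shift:
  assumes "sol \<alpha> \<beta> c" "period \<alpha> dvd n"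
  shows "c (i + int n) = (c i \<noteq> (\<not> \<alpha> \<and> \<beta> \<and> odd (n div 3)))"
proof (cases \<alpha>)
  case True
  have s: "c (i + 3) = ((c i \<noteq> (c (i + 1) \<noteq> c (i + 2))) \<noteq> \<beta>)" for i
    using solD[OF assms(1), of i] True by blast
  have "c (i + 4) = (c i \<noteq> False)" for i
    using s[of i] s[of "i + 1"] by (simp add: add.assoc) blast
  then have "c (i + (int n div 4) * 4) = (c i \<noteq> (False \<and> odd (int n div 4)))" by (rule affine_iterate)
  moreover have "4 dvd int n" using assms(2) True by (simp add: period_def) (metis of_nat_dvd_iff of_nat_numeral)
  ultimately show ?thesis using True by simp
next
  case False
  have "c (i + 3) = (c i \<noteq> \<beta>)" for i using solD[OF assms(1), of i] False by blast
  then have "c (i + (int n div 3) * 3) = (c i \<noteq> (\<beta> \<and> odd (int n div 3)))" by (rule affine_iterate)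
  moreover have "3 dvd int n" using assms(2) False by (simp add: period_def) (metis of_nat_dvd_iff of_nat_numeral)
  moreover have "odd (int n div 3) = odd (n div 3)"
    by (metis even_of_nat of_nat_numeral zdiv_int)
  ultimately show ?thesis using False by simp
qed

lemma sol_periodic:
  assumes "sol \<alpha> False c" "period \<alpha> dvd n"
  shows "c (i + int n) = c i"
  using sol_shift[OF assms] by simp

section \<open>Quads and straight faces as cycles covering each edge once\<close>

lemma (in labelled_px) quad_cycle: "is_cycle E (quad L j b)" "card (quad L j b) = 4"
proof -
  \<comment> \<open>The walk alternates between the levels \<open>j - 1\<close> and
    \<open>j\<close>, and the free bit flips at each return to a level.\<close>
  define w where "w i = (if even i then L (j - 1) (i mod 4 = 2) b else L j b (i mod 4 = 3))" for i :: int
  have m: "i mod 4 = 0 \<or> i mod 4 = 1 \<or> i mod 4 = 2 \<or> i mod 4 = 3" for i :: int by presburger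
  have ev: "even i \<longleftrightarrow> i mod 4 = 0 \<or> i mod 4 = 2" for i :: int by presburger
  have d: "int 4 dvd i - k \<longleftrightarrow> i mod 4 = k mod 4" for i k :: int by (simp add: mod_eq_dvd_iff)
  have w: "w i = w k \<longleftrightarrow> int 4 dvd i - k" for i k
    unfolding d w_def ev using m[of i] m[of k] L_neq(3,4) L_eq_iff by auto
  have e: "{w i, w (i + 1)} = ed L (j - 1) ((if even i then i else i + 1) mod 4 = 2) b ((if even i then i + 1 else i) mod 4 = 3)" for i
    by (auto simp: w_def ed_def)
  have "quad L j b = range (\<lambda>i. {w i, w (i + 1)})"
  proof
    show "range (\<lambda>i. {w i, w (i + 1)}) \<subseteq> quad L j b" unfolding quad_def e by blast
    have "ed L (j - 1) a b c \<in> range (\<lambda>i. {w i, w (i + 1)})" for a c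
      using rangeI[of "\<lambda>i. {w i, w (i + 1)}" 0] rangeI[of "\<lambda>i. {w i, w (i + 1)}" 1]
        rangeI[of "\<lambda>i. {w i, w (i + 1)}" 2] rangeI[of "\<lambda>i. {w i, w (i + 1)}" 3]
      unfolding e by (cases a; cases c) simp_all
    then show "quad L j b \<subseteq> range (\<lambda>i. {w i, w (i + 1)})" unfolding quad_def by blast
  qed
  then show "is_cycle E (quad L j b)" "card (quad L j b) = 4"
    using is_cycle_closed_walk[of 4 w E, OF _ w] unfolding e by simp_all
qed

lemma (in labelled_px) quad_unique:
  assumes "ed L i a b c \<in> f" "f \<in> quads L"
  shows "f = quad L (i + 1) b"
proof -
  obtain j b' where f: "f = quad L j b'" using assms(2) unfolding quads_def by blast
  then obtain a' c' where "ed L i a b c = ed L (j - 1) a' b' c'" using assms(1) unfolding quad_def by blast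
  then obtain z where z: "\<forall>k a b. L (k + (j - 1 - i)) a b = L k (a \<noteq> z k) (b \<noteq> z (k + 1))" "b = (b' \<noteq> z (i + 1))"
    by (rule ed_eq_levE)
  have e: "ed L (j - 1) x b' y = ed L i (x \<noteq> z i) b (y \<noteq> z (i + 2))" for x y
    using z(1)[rule_format, of i x b'] z(1)[rule_format, of "i + 1" b' y] z(2)
    by (simp add: ed_def add_ac)
  have x: "((p \<noteq> q) \<noteq> q) = p" for p q :: bool by blast
  have "ed L i x b y = ed L (j - 1) (x \<noteq> z i) b' (y \<noteq> z (i + 2))" for x y
    unfolding e x ..
  then show ?thesis unfolding f quad_def using e by (simp only: add_diff_cancel_right') blast
qed

lemma ed_in_quad: "ed L i a b c \<in> quad L (i + 1) b"
  unfolding quad_def by force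

lemma quad_in_quads: "quad L i b \<in> quads L"
  unfolding quads_def by blast

text \<open>A constant sequence solves the homogeneous recurrence for both values of \<alpha>. With
  a constant twist the notion of a straight face therefore does not depend on which labels of an
  edge are used.\<close>

locale const_px = labelled_px n "\<lambda>_. p" V E L
  for n :: nat and p :: bool and V :: "'a set" and E :: "'a set set" and L :: "int \<Rightarrow> bool \<Rightarrow> bool \<Rightarrow> 'a"
begin

lemma L_mult: "L (i + m * int n) a b = L i (a \<noteq> (p \<and> odd m)) (b \<noteq> (p \<and> odd m))"
proof (induction m arbitrary: a b rule: int_induct[of _ 0])
  case (step1 m)
  have "L (i + (m + 1) * int n) a b = L (i + m * int n) (a \<noteq> p) (b \<noteq> p)"
    using twist[of "i + m * int n" a b] by (simp add: algebra_simps)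
  also have "\<dots> = L i (a \<noteq> (p \<and> odd (m + 1))) (b \<noteq> (p \<and> odd (m + 1)))"
    unfolding step1.IH by (rule arg_cong2[of _ _ _ _ "L i"]) auto
  finally show ?case .
next
  case (step2 m)
  have "L (i + (m - 1) * int n) a b = L (i + (m - 1) * int n) ((a \<noteq> p) \<noteq> p) ((b \<noteq> p) \<noteq> p)"
    by (rule arg_cong2[of _ _ _ _ "L (i + (m - 1) * int n)"]) auto
  also have "\<dots> = L (i + (m - 1) * int n + int n) (a \<noteq> p) (b \<noteq> p)" by (rule twist[symmetric])
  also have "\<dots> = L (i + m * int n) (a \<noteq> p) (b \<noteq> p)" by (simp add: algebra_simps)
  also have "\<dots> = L i (a \<noteq> (p \<and> odd (m - 1))) (b \<noteq> (p \<and> odd (m - 1)))"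
    unfolding step2.IH by (rule arg_cong2[of _ _ _ _ "L i"]) auto
  finally show ?case .
qed simp

lemma ed_eq_constE:
  assumes "ed L i a b c = ed L j a' b' c'"
  obtains z where "\<And>k a b. L (k + (j - i)) a b = L k (a \<noteq> z) (b \<noteq> z)"
    "a = (a' \<noteq> z)" "b = (b' \<noteq> z)" "c = (c' \<noteq> z)"
proof -
  obtain z where z: "\<forall>k a b. L (k + (j - i)) a b = L k (a \<noteq> z k) (b \<noteq> z (k + 1))"
    "a = (a' \<noteq> z i)" "b = (b' \<noteq> z (i + 1))" "c = (c' \<noteq> z (i + 2))"
    using assms by (rule ed_eq_levE)
  have "int n dvd j - i" using lev[OF z(1)[rule_format, of 0 True True]] by simp
  then obtain m where "j - i = int n * m" by (rule dvdE)
  then have L: "L (k + (j - i)) a b = L k (a \<noteq> (p \<and> odd m)) (b \<noteq> (p \<and> odd m))" for k a b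
    using L_mult[of k m a b] by (simp add: mult.commute)
  have "z k = (p \<and> odd m)" for k
    using L[of k True True] z(1)[rule_format, of k True True] L_eq_iff by auto
  then show thesis using that[OF L] z(2-4) by simp
qed

text \<open>One turn changes the bits of a vertex by \<open>p\<close> through the labelling and by
  \<open>q\<close> through the sequence. The walk closes after one turn if these cancel and after
  two turns otherwise.\<close>

lemma face_cycle:
  assumes c: "\<And>i. c (i + int n) = (c i \<noteq> q)" and l: "l = (if p = q then n else 2 * n)"
  shows "is_cycle E (face L c)" "card (face L c) = l"
proof -
  define w where "w i = L i (c i) (c (i + 1))" for i
  have wm: "w (i + m * int n) = L i (c i \<noteq> ((p \<noteq> q) \<and> odd m)) (c (i + 1) \<noteq> ((p \<noteq> q) \<and> odd m))" for i m
  proof -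
    have "c (i + m * int n + 1) = (c (i + 1) \<noteq> (q \<and> odd m))"
      using affine_iterate[of c, OF c, of "i + 1" m] by (simp add: add_ac)
    then show ?thesis unfolding w_def L_mult affine_iterate[of c, OF c]
      by (intro arg_cong2[of _ _ _ _ "L i"]) auto
  qed
  have w: "w i = w j \<longleftrightarrow> int l dvd i - j" for i j
  proof
    assume e: "w i = w j"
    then have "int n dvd i - j" unfolding w_def by (rule lev)
    then obtain m where m: "i - j = int n * m" by (rule dvdE)
    then have i: "i = j + m * int n" by (simp add: algebra_simps)
    have "c j = (c j \<noteq> ((p \<noteq> q) \<and> odd m))" using e unfolding i wm unfolding w_def by (auto dest: inj)
    then have "p = q \<or> even m" by blast
    then show "int l dvd i - j" unfolding m l by (auto simp: mult.commute)
  next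
    assume "int l dvd i - j"
    then obtain m where "i - j = int l * m" by (rule dvdE)
    then have i: "i = j + (if p = q then m else 2 * m) * int n" unfolding l by (simp add: algebra_simps)
    have "\<not> ((p \<noteq> q) \<and> odd (if p = q then m else 2 * m))" by simp
    then show "w i = w j" unfolding i wm unfolding w_def by (simp only: HOL.simp_thms)
  qed
  have e: "{w i, w (i + 1)} = ed L i (c i) (c (i + 1)) (c (i + 2))" for i
    by (simp add: w_def ed_def add.assoc)
  have "l \<ge> 3" using n3 l by auto
  then show "is_cycle E (face L c)" "card (face L c) = l"
    using is_cycle_closed_walk[of l w E "face L c", OF _ w] unfolding e face_def by simp_all
qed

lemma straight_face_cycle:
  assumes "f \<in> straight_faces \<alpha> \<beta> L" "period \<alpha> dvd n"
  shows "is_cycle E f" "card f = (if p = (\<not> \<alpha> \<and> \<beta> \<and> odd (n div 3)) then n else 2 * n)"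
proof -
  obtain c where c: "sol \<alpha> \<beta> c" "f = face L c" using assms unfolding straight_faces_def by blast
  show "is_cycle E f" "card f = (if p = (\<not> \<alpha> \<and> \<beta> \<and> odd (n div 3)) then n else 2 * n)"
    unfolding c(2) using face_cycle[of c, OF sol_shift[OF c(1) assms(2)] refl] by simp_all
qed

text \<open>The face may list the given edge at another level, but then its bits are shifted by a
  constant, to which the recurrence is blind. The second claim is the recurrence solved for its
  first term.\<close>

lemma straight_face_next:
  assumes "f \<in> straight_faces \<alpha> \<beta> L" "ed L i a b d \<in> f"
  shows "ed L (i + 1) b d ((a \<noteq> (\<alpha> \<and> b \<noteq> d)) \<noteq> \<beta>) \<in> f"
    and "ed L (i - 1) ((d \<noteq> (\<alpha> \<and> a \<noteq> b)) \<noteq> \<beta>) a b \<in> f"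
proof -
  obtain c where c: "sol \<alpha> \<beta> c" "f = face L c" using assms unfolding straight_faces_def by blast
  obtain j where "ed L i a b d = ed L j (c j) (c (j + 1)) (c (j + 2))" using assms(2) unfolding c(2) face_def by blast
  then obtain z where L: "\<And>k a b. L (k + (j - i)) a b = L k (a \<noteq> z) (b \<noteq> z)"
    and z: "a = (c j \<noteq> z)" "b = (c (j + 1) \<noteq> z)" "d = (c (j + 2) \<noteq> z)" by (rule ed_eq_constE) metis
  have e: "ed L (j + k) x y w = ed L (i + k) (x \<noteq> z) (y \<noteq> z) (w \<noteq> z)" for k x y w
    using L[of "i + k" x y] L[of "i + k + 1" y w] by (simp add: ed_def algebra_simps)
  have "ed L (j + 1) (c (j + 1)) (c (j + 1 + 1)) (c (j + 1 + 2)) \<in> f" unfolding c(2) face_def by blast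
  moreover have "(c (j + 3) \<noteq> z) = ((a \<noteq> (\<alpha> \<and> b \<noteq> d)) \<noteq> \<beta>)" unfolding z solD[OF c(1)] by blast
  ultimately show "ed L (i + 1) b d ((a \<noteq> (\<alpha> \<and> b \<noteq> d)) \<noteq> \<beta>) \<in> f" unfolding e z(2,3) by (simp add: add.assoc)
  have "ed L (j - 1) (c (j - 1)) (c (j - 1 + 1)) (c (j - 1 + 2)) \<in> f" unfolding c(2) face_def by blast
  moreover have "(c (j - 1) \<noteq> z) = ((d \<noteq> (\<alpha> \<and> a \<noteq> b)) \<noteq> \<beta>)" unfolding z solD'[OF c(1)] by blast
  moreover have "ed L (j - 1) x y w = ed L (i - 1) (x \<noteq> z) (y \<noteq> z) (w \<noteq> z)" for x y w
    using e[of "-1" x y w] by simp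
  moreover have "j - 1 + 1 = j" "j - 1 + 2 = j + 1" by simp_all
  ultimately show "ed L (i - 1) ((d \<noteq> (\<alpha> \<and> a \<noteq> b)) \<noteq> \<beta>) a b \<in> f" unfolding z(1,2) by (simp only:)
qed

lemma straight_face_exists: "\<exists>f\<in>straight_faces \<alpha> \<beta> L. ed L i a b d \<in> f"
proof -
  obtain c where c: "sol \<alpha> \<beta> c" "c i = a" "c (i + 1) = b" "c (i + 2) = d"
    using sol_exists[of \<alpha> \<beta> i a b d] by (elim exE conjE)
  have "ed L i (c i) (c (i + 1)) (c (i + 2)) \<in> face L c" unfolding face_def by (rule rangeI)
  moreover have "face L c \<in> straight_faces \<alpha> \<beta> L" unfolding straight_faces_def using c(1) by blast
  ultimately show ?thesis unfolding c by (intro bexI[of _ "face L c"])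
qed

lemma straight_face_unique:
  assumes f: "f \<in> straight_faces \<alpha> \<beta> L" "g \<in> straight_faces \<alpha> \<beta> L" and d: "period \<alpha> dvd n" and "e \<in> f" "e \<in> g"
  shows "f = g"
proof (rule is_cycle_eqI)
  show c: "is_cycle E f" "is_cycle E g" using straight_face_cycle d f by blast+
  show "e \<in> f" "e \<in> g" by fact+
  fix e v assume e: "e \<in> f" "e \<in> g" "v \<in> e"
  then have "e \<in> E" using c by (auto simp: is_cycle_def)
  then obtain i a b x where ed: "e = ed L i a b x" unfolding E_eq by blast
  then consider "v = L i a b" | "v = L (i + 1) b x" using e(3) by (auto simp: ed_def)
  then show "\<exists>e'. e' \<noteq> e \<and> v \<in> e' \<and> e' \<in> f \<and> e' \<in> g"
  proof cases
    case 1
    let ?e = "ed L (i - 1) ((x \<noteq> (\<alpha> \<and> a \<noteq> b)) \<noteq> \<beta>) a b"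
    have "?e \<noteq> e" "v \<in> ?e" unfolding 1 ed by (rule ed_neq(2)) (simp add: ed_mem)
    moreover have "?e \<in> f" "?e \<in> g"
      using straight_face_next(2)[OF f(1) e(1)[unfolded ed]] straight_face_next(2)[OF f(2) e(2)[unfolded ed]] .
    ultimately show ?thesis by (intro exI[of _ ?e]) simp
  next
    case 2
    let ?e = "ed L (i + 1) b x ((a \<noteq> (\<alpha> \<and> b \<noteq> x)) \<noteq> \<beta>)"
    have "?e \<noteq> e" "v \<in> ?e" unfolding 2 ed using ed_neq(1)[of "i + 1" b x _ a b x] by (simp_all add: ed_mem)
    moreover have "?e \<in> f" "?e \<in> g"
      using straight_face_next(1)[OF f(1) e(1)[unfolded ed]] straight_face_next(1)[OF f(2) e(2)[unfolded ed]] .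
    ultimately show ?thesis by (intro exI[of _ ?e]) simp
  qed
qed

lemma straight_ex1:
  assumes "period \<alpha> dvd n" "e \<in> E"
  shows "\<exists>!f. f \<in> straight_faces \<alpha> \<beta> L \<and> e \<in> f"
proof -
  obtain i a b x where "e = ed L i a b x" using assms(2) unfolding E_eq by blast
  then obtain f where "f \<in> straight_faces \<alpha> \<beta> L" "e \<in> f" using straight_face_exists by blast
  then show ?thesis using straight_face_unique assms(1) by (intro ex1I[of _ f]) blast+
qed

lemma quad_ex1:
  assumes "e \<in> E"
  shows "\<exists>!f. f \<in> quads L \<and> e \<in> f"
proof -
  obtain i a b x where e: "e = ed L i a b x" using assms unfolding E_eq by blast
  show ?thesis
  proof (rule ex1I)
    show "quad L (i + 1) b \<in> quads L \<and> e \<in> quad L (i + 1) b" unfolding e using ed_in_quad quad_in_quads by blast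
    show "f = quad L (i + 1) b" if "f \<in> quads L \<and> e \<in> f" for f using quad_unique[of i a b x f] that unfolding e by blast
  qed
qed

end

section \<open>The effect of automorphisms, gauging and reversal on the families\<close>

lemma face_image_face:
  assumes "\<And>i a b. \<sigma> (L i a b) = M i a b"
  shows "face_image \<sigma> (face L c) = face M c"
proof -
  have "\<sigma> ` ed L i a b d = ed M i a b d" for i a b d by (simp add: ed_def assms)
  then show ?thesis by (simp add: face_image_def face_def image_image)
qed

lemma face_image_quad:
  assumes "\<And>i a b. \<sigma> (L i a b) = M i a b"
  shows "face_image \<sigma> (quad L j b) = quad M j b"
proof -
  have "\<sigma> ` ed L i a b d = ed M i a b d" for i a b d by (simp add: ed_def assms)
  then show ?thesis unfolding face_image_def quad_def by (auto simp: image_iff) metis+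
qed

lemma face_image_families:
  assumes "\<And>i a b. \<sigma> (L i a b) = M i a b"
  shows "face_image \<sigma> ` straight_faces \<alpha> \<beta> L = straight_faces \<alpha> \<beta> M" "face_image \<sigma> ` quads L = quads M"
  unfolding straight_faces_def quads_def using face_image_face[of \<sigma> L M, OF assms] face_image_quad[of \<sigma> L M, OF assms]
  by (auto simp: image_iff) metis+

lemma ed_gauge: "ed (\<lambda>i a b. L (i + k) (a \<noteq> u i) (b \<noteq> u (i + 1))) i a b c = ed L (i + k) (a \<noteq> u i) (b \<noteq> u (i + 1)) (c \<noteq> u (i + 2))"
  by (simp add: ed_def add_ac)

lemma face_gauge: "face (\<lambda>i a b. L (i + k) (a \<noteq> u i) (b \<noteq> u (i + 1))) c = face L (\<lambda>i. c (i - k) \<noteq> u (i - k))"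
proof -
  have "face L (\<lambda>i. c (i - k) \<noteq> u (i - k)) = range ((\<lambda>i. ed L i (c (i - k) \<noteq> u (i - k)) (c (i + 1 - k) \<noteq> u (i + 1 - k)) (c (i + 2 - k) \<noteq> u (i + 2 - k))) \<circ> (\<lambda>i. i + k))"
    unfolding face_def image_comp[symmetric] by (simp add: surj_plus_right)
  then show ?thesis unfolding face_def ed_gauge by (simp add: o_def add_ac)
qed

text \<open>Linearity of the recurrence: adding a solution for \<gamma> turns solutions for \<beta>
  into solutions for the sum. With \<gamma> = 0 this gives symmetries of a family, with \<gamma> = 1
  it exchanges the two families of the same \<alpha>.\<close>

lemma straight_faces_gauge:
  assumes u: "sol \<alpha> \<gamma> u"
  shows "straight_faces \<alpha> \<beta> (\<lambda>i a b. L (i + k) (a \<noteq> u i) (b \<noteq> u (i + 1))) = straight_faces \<alpha> (\<beta> \<noteq> \<gamma>) L"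
proof -
  have 1: "sol \<alpha> (\<beta> \<noteq> \<gamma>) (\<lambda>i. c (i - k) \<noteq> u (i - k))" if "sol \<alpha> \<beta> c" for c
    unfolding sol_def
  proof
    fix i show "(c (i + 3 - k) \<noteq> u (i + 3 - k)) = (((c (i - k) \<noteq> u (i - k)) \<noteq> (\<alpha> \<and> (c (i + 1 - k) \<noteq> u (i + 1 - k)) \<noteq> (c (i + 2 - k) \<noteq> u (i + 2 - k)))) \<noteq> (\<beta> \<noteq> \<gamma>))"
    proof -
      have e: "i + 3 - k = i - k + 3" "i + 1 - k = i - k + 1" "i + 2 - k = i - k + 2" by simp_all
      show ?thesis unfolding e solD[OF u] solD[OF that] by blast
    qed
  qed
  have 2: "sol \<alpha> \<beta> (\<lambda>i. c (i + k) \<noteq> u i)" if "sol \<alpha> (\<beta> \<noteq> \<gamma>) c" for c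
    unfolding sol_def
  proof
    fix i show "(c (i + 3 + k) \<noteq> u (i + 3)) = (((c (i + k) \<noteq> u i) \<noteq> (\<alpha> \<and> (c (i + 1 + k) \<noteq> u (i + 1)) \<noteq> (c (i + 2 + k) \<noteq> u (i + 2)))) \<noteq> \<beta>)"
    proof -
      have e: "i + 3 + k = i + k + 3" "i + 1 + k = i + k + 1" "i + 2 + k = i + k + 2" by simp_all
      show ?thesis unfolding e solD[OF u] solD[OF that] by blast
    qed
  qed
  have x: "((r \<noteq> q) \<noteq> q) = r" for r q :: bool by blast
  show ?thesis unfolding straight_faces_def face_gauge
  proof (intro set_eqI iffI)
    fix f assume "f \<in> {face L c |c. sol \<alpha> (\<beta> \<noteq> \<gamma>) c}"
    then obtain c where c: "sol \<alpha> (\<beta> \<noteq> \<gamma>) c" "f = face L c" by blast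
    show "f \<in> {face L (\<lambda>i. c (i - k) \<noteq> u (i - k)) |c. sol \<alpha> \<beta> c}"
      using 2[OF c(1)] unfolding c(2) by (intro CollectI exI[of _ "\<lambda>i. c (i + k) \<noteq> u i"] conjI) (simp_all only: x diff_add_cancel)
  qed (use 1 in blast)
qed

text \<open>The outer bits of a quad are free, so translating them changes nothing, and the middle
  bit is merely renamed.\<close>

lemma quads_gauge: "quads (\<lambda>i a b. L (i + k) (a \<noteq> u i) (b \<noteq> u (i + 1))) = quads L"
proof -
  have x: "((r \<noteq> q) \<noteq> q) = r" for r q :: bool by blast
  have q: "quad (\<lambda>i a b. L (i + k) (a \<noteq> u i) (b \<noteq> u (i + 1))) j b = quad L (j + k) (b \<noteq> u j)" for j b
  proof -
    have "ed L (j + k - 1) a (b \<noteq> u j) c = ed L (j - 1 + k) ((a \<noteq> u (j - 1)) \<noteq> u (j - 1)) (b \<noteq> u (j - 1 + 1)) ((c \<noteq> u (j - 1 + 2)) \<noteq> u (j - 1 + 2))" for a c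
      unfolding x by (simp add: algebra_simps)
    moreover have "ed L (j - 1 + k) (a \<noteq> u (j - 1)) (b \<noteq> u (j - 1 + 1)) (c \<noteq> u (j - 1 + 2)) = ed L (j + k - 1) (a \<noteq> u (j - 1)) (b \<noteq> u j) (c \<noteq> u (j - 1 + 2))" for a c
      by (simp add: algebra_simps)
    ultimately show ?thesis unfolding quad_def ed_gauge by blast
  qed
  have "quad L j b = quad L (j - k + k) ((b \<noteq> u (j - k)) \<noteq> u (j - k))" for j b unfolding x by simp
  then show ?thesis unfolding quads_def q by blast
qed

lemma ed_rev: "ed (\<lambda>i a b. L (- i) b a) i a b c = ed L (- i - 1) c b a"
  by (auto simp: ed_def)

text \<open>The recurrence is a palindrome in the positions \<open>i\<close> to
  \<open>i + 3\<close>, and position \<open>i\<close> of the reversed labelling is position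
  \<open>1 - i\<close> of \<open>L\<close>.\<close>

lemma straight_faces_rev: "straight_faces \<alpha> \<beta> (\<lambda>i a b. L (- i) b a) = straight_faces \<alpha> \<beta> L"
proof -
  have s: "sol \<alpha> \<beta> (\<lambda>i. c (1 - i))" if "sol \<alpha> \<beta> c" for c
    unfolding sol_def
  proof
    fix i show "c (1 - (i + 3)) = ((c (1 - i) \<noteq> (\<alpha> \<and> c (1 - (i + 1)) \<noteq> c (1 - (i + 2)))) \<noteq> \<beta>)"
    proof -
      have e: "1 - i = (- i - 2) + 3" "1 - (i + 1) = (- i - 2) + 2" "1 - (i + 2) = (- i - 2) + 1" "1 - (i + 3) = - i - 2"
        by simp_all
      show ?thesis unfolding e solD[OF that] by blast
    qed
  qed
  have f: "face (\<lambda>i a b. L (- i) b a) c = face L (\<lambda>i. c (1 - i))" for c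
  proof -
    have "surj (\<lambda>i :: int. - i - 1)" by (rule surjI[of _ "\<lambda>i. - i - 1"]) simp
    then have "face L (\<lambda>i. c (1 - i)) = range ((\<lambda>i. ed L i (c (1 - i)) (c (1 - (i + 1))) (c (1 - (i + 2)))) \<circ> (\<lambda>i. - i - 1))"
      unfolding face_def image_comp[symmetric] by simp
    then show ?thesis unfolding face_def ed_rev by (simp add: o_def add_ac)
  qed
  show ?thesis unfolding straight_faces_def f
  proof (intro set_eqI iffI)
    fix f assume "f \<in> {face L c |c. sol \<alpha> \<beta> c}"
    then obtain c where c: "sol \<alpha> \<beta> c" "f = face L c" by blast
    show "f \<in> {face L (\<lambda>i. c (1 - i)) |c. sol \<alpha> \<beta> c}"
      using s[OF c(1)] unfolding c(2) by (intro CollectI exI[of _ "\<lambda>i. c (1 - i)"] conjI) simp_all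
  qed (use s in blast)
qed

lemma quads_rev: "quads (\<lambda>i a b. L (- i) b a) = quads L"
proof -
  have q: "quad (\<lambda>i a b. L (- i) b a) j b = quad L (1 - j) b" for j b
    unfolding quad_def ed_rev by (auto simp: algebra_simps)
  have "quad L j b = quad L (1 - (1 - j)) b" for j b by simp
  then show ?thesis unfolding quads_def q by blast
qed

section \<open>Maps built from the families\<close>

lemma const_px_gauged:
  assumes "const_px n p V E L" "\<And>i. (u i \<noteq> u (i + int n)) = r"
  shows "const_px n (r \<noteq> p) V E (\<lambda>i a b. L (i + k) (a \<noteq> u i) (b \<noteq> u (i + 1)))"
proof -
  interpret const_px n p V E L by fact
  show ?thesis using gauged[of u k] unfolding assms(2) const_px_def .
qed

lemma const_px_rev:
  assumes "const_px n p V E L"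
  shows "const_px n p V E (\<lambda>i a b. L (- i) b a)"
proof -
  interpret const_px n p V E L by fact
  show ?thesis using reversed unfolding const_px_def .
qed

text \<open>A solution of the homogeneous recurrence can take any three prescribed bits, hence can
  move any upward edge to any other. It is n-periodic because \<open>period \<alpha>\<close> divides
  \<open>n\<close>, so the twist is unchanged and \<open>relabel\<close> applies. Two labellings are
  allowed so that reversed ones can be used on either side.\<close>

lemma forward_move:
  assumes L0: "const_px n p V E L0" and L1: "const_px n p V E L1" and d: "period \<alpha> dvd n"
  shows "\<exists>\<sigma>. graph_automorphism V E \<sigma> \<and> face_image \<sigma> ` quads L0 = quads L1 \<and>
     (\<forall>\<beta>. face_image \<sigma> ` straight_faces \<alpha> \<beta> L0 = straight_faces \<alpha> \<beta> L1) \<and>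
     \<sigma> (L0 i a b) = L1 j a' b' \<and> \<sigma> ` ed L0 i a b c = ed L1 j a' b' c'"
proof -
  obtain t where t: "sol \<alpha> False t" "t i = (a \<noteq> a')" "t (i + 1) = (b \<noteq> b')" "t (i + 2) = (c \<noteq> c')"
    using sol_exists[of \<alpha> False i "a \<noteq> a'" "b \<noteq> b'" "c \<noteq> c'"] by (elim exE conjE)
  define M where "M = (\<lambda>i' a b. L1 (i' + (j - i)) (a \<noteq> t i') (b \<noteq> t (i' + 1)))"
  have "const_px n (False \<noteq> p) V E M" unfolding M_def
    by (rule const_px_gauged[OF L1]) (simp add: sol_periodic[OF t(1) d])
  then have "labelled_px n (\<lambda>_. p) V E M" by (simp add: const_px_def)
  then obtain \<sigma> where s: "graph_automorphism V E \<sigma>" "\<And>i a b. \<sigma> (L0 i a b) = M i a b"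
    using relabel[OF L0[unfolded const_px_def]] by blast
  have x: "(r \<noteq> (r \<noteq> q)) = q" for r q :: bool by blast
  have m: "\<sigma> (L0 i a b) = L1 j a' b'" unfolding s M_def t x by simp
  have "\<sigma> (L0 (i + 1) b c) = L1 (j + 1) b' c'" unfolding s M_def
  proof -
    have "i + 1 + 1 = i + 2" "i + 1 + (j - i) = j + 1" by simp_all
    then show "L1 (i + 1 + (j - i)) (b \<noteq> t (i + 1)) (c \<noteq> t (i + 1 + 1)) = L1 (j + 1) b' c'"
      by (simp only: t x)
  qed
  then have "\<sigma> ` ed L0 i a b c = ed L1 j a' b' c'" using m by (simp add: ed_def)
  moreover have "face_image \<sigma> ` quads L0 = quads L1"
    using face_image_families(2)[of \<sigma> L0 M, OF s(2)] unfolding M_def quads_gauge .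
  moreover have "face_image \<sigma> ` straight_faces \<alpha> \<beta> L0 = straight_faces \<alpha> \<beta> L1" for \<beta>
  proof -
    have "straight_faces \<alpha> \<beta> M = straight_faces \<alpha> (\<beta> \<noteq> False) L1" unfolding M_def by (rule straight_faces_gauge[OF t(1)])
    then show ?thesis using face_image_families(1)[of \<sigma> L0 M, OF s(2)] by simp
  qed
  ultimately show ?thesis using s(1) m by blast
qed

context const_px
begin

text \<open>An arc pointing down a level points up in the reversed labelling, so moves between
  upward arcs suffice.\<close>

lemma arc_cases:
  assumes "e \<in> E" "v \<in> e"
  obtains i a b c M where "M = L \<or> M = (\<lambda>i a b. L (- i) b a)" "v = M i a b" "e = ed M i a b c"
proof -
  obtain i a b c where e: "e = ed L i a b c" using assms unfolding E_eq by blast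
  then consider "v = L i a b" | "v = L (i + 1) b c" using assms by (auto simp: ed_def)
  then show thesis
  proof cases
    case 1 then show thesis using e that by blast
  next
    case 2
    let ?M = "\<lambda>i a b. L (- i) b a"
    have "v = ?M (- i - 1) c b" "e = ed ?M (- i - 1) c b a" using 2 e by (simp_all add: ed_rev add.commute)
    then show thesis using that by blast
  qed
qed

lemma arc_transitive:
  assumes d: "period \<alpha> dvd n" and "e \<in> E" "v \<in> e" "e' \<in> E" "v' \<in> e'"
  shows "\<exists>\<sigma>. graph_automorphism V E \<sigma> \<and> face_image \<sigma> ` quads L = quads L \<and>
     (\<forall>\<beta>. face_image \<sigma> ` straight_faces \<alpha> \<beta> L = straight_faces \<alpha> \<beta> L) \<and> \<sigma> v = v' \<and> \<sigma> ` e = e'"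
proof -
  have M: "const_px n p V E M \<and> quads M = quads L \<and> (\<forall>\<beta>. straight_faces \<alpha> \<beta> M = straight_faces \<alpha> \<beta> L)"
    if "M = L \<or> M = (\<lambda>i a b. L (- i) b a)" for M
    using that const_px_rev[OF const_px_axioms] const_px_axioms quads_rev[of L] straight_faces_rev[of \<alpha> _ L] by auto
  obtain i a b c M where 0: "M = L \<or> M = (\<lambda>i a b. L (- i) b a)" "v = M i a b" "e = ed M i a b c"
    using arc_cases assms by metis
  obtain i' a' b' c' M' where 1: "M' = L \<or> M' = (\<lambda>i a b. L (- i) b a)" "v' = M' i' a' b'" "e' = ed M' i' a' b' c'"
    using arc_cases assms by metis
  show ?thesis using forward_move[of n p V E M M' \<alpha> i a b i' a' b' c c'] M[OF 0(1)] M[OF 1(1)] d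
    unfolding 0(2,3) 1(2,3) by simp
qed

lemma straight_pair:
  "\<exists>f\<in>straight_faces \<alpha> \<beta> L. ed L (i - 1) c a b \<in> f \<and> ed L i a b ((c \<noteq> (\<alpha> \<and> a \<noteq> b)) \<noteq> \<beta>) \<in> f"
proof -
  obtain f where f: "f \<in> straight_faces \<alpha> \<beta> L" "ed L (i - 1) c a b \<in> f" using straight_face_exists by blast
  then show ?thesis using straight_face_next(1)[OF f] by auto
qed

text \<open>The two families induce different perfect matchings on the four edges at the vertex, and
  two different perfect matchings of four points have a connected union.\<close>

lemma link_closed:
  assumes X: "X \<subseteq> {e \<in> E. L i a b \<in> e}" "e \<in> X"
    and cl: "\<And>e f e'. e \<in> X \<Longrightarrow> f \<in> FA \<union> FB \<Longrightarrow> e \<in> f \<Longrightarrow> e' \<in> f \<Longrightarrow> L i a b \<in> e' \<Longrightarrow> e' \<in> X"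
    and F: "straight_faces \<alpha> \<beta> L \<subseteq> FA \<union> FB" "quads L \<subseteq> FA \<union> FB \<or> straight_faces \<alpha> (\<not> \<beta>) L \<subseteq> FA \<union> FB"
  shows "{e \<in> E. L i a b \<in> e} \<subseteq> X"
proof -
  have cl': "e \<in> X \<longleftrightarrow> e' \<in> X" if "f \<in> FA \<union> FB" "e \<in> f" "e' \<in> f" "L i a b \<in> e" "L i a b \<in> e'" for e e' f
    using cl that by blast
  have s: "ed L (i - 1) c a b \<in> X \<longleftrightarrow> ed L i a b ((c \<noteq> (\<alpha> \<and> a \<noteq> b)) \<noteq> \<gamma>) \<in> X"
    if "straight_faces \<alpha> \<gamma> L \<subseteq> FA \<union> FB" for c \<gamma>
  proof -
    obtain f where f: "f \<in> straight_faces \<alpha> \<gamma> L" "ed L (i - 1) c a b \<in> f" "ed L i a b ((c \<noteq> (\<alpha> \<and> a \<noteq> b)) \<noteq> \<gamma>) \<in> f"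
      using straight_pair[of \<alpha> \<gamma> i c a b] by (elim bexE conjE)
    have "f \<in> FA \<union> FB" using f(1) that by blast
    from cl'[OF this f(2,3)] show ?thesis by (simp add: ed_mem)
  qed
  have q: "ed L (i - 1) True a b \<in> X \<longleftrightarrow> ed L (i - 1) False a b \<in> X" "ed L i a b True \<in> X \<longleftrightarrow> ed L i a b False \<in> X"
    if "quads L \<subseteq> FA \<union> FB"
  proof -
    have "quad L i a \<in> FA \<union> FB" "quad L (i + 1) b \<in> FA \<union> FB" using that quad_in_quads by blast+
    then show "ed L (i - 1) True a b \<in> X \<longleftrightarrow> ed L (i - 1) False a b \<in> X" "ed L i a b True \<in> X \<longleftrightarrow> ed L i a b False \<in> X"
      using cl'[of "quad L i a" "ed L (i - 1) True a b" "ed L (i - 1) False a b"]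
        cl'[of "quad L (i + 1) b" "ed L i a b True" "ed L i a b False"]
        ed_in_quad[of L "i - 1" _ a b] ed_in_quad[of L i a b] by (simp_all add: ed_mem)
  qed
  have "e \<in> {ed L i a b True, ed L i a b False, ed L (i - 1) True a b, ed L (i - 1) False a b}"
    using X edges_at by blast
  then have or: "ed L i a b True \<in> X \<or> ed L i a b False \<in> X \<or> ed L (i - 1) True a b \<in> X \<or> ed L (i - 1) False a b \<in> X"
    using X(2) by auto
  have "ed L i a b True \<in> X \<and> ed L i a b False \<in> X \<and> ed L (i - 1) True a b \<in> X \<and> ed L (i - 1) False a b \<in> X"
    using F(2)
  proof
    assume "quads L \<subseteq> FA \<union> FB"
    from q[OF this] s[OF F(1), of True] s[OF F(1), of False] or show ?thesis
      by (cases "\<alpha> \<and> a \<noteq> b"; cases \<beta>) simp_all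
  next
    assume "straight_faces \<alpha> (\<not> \<beta>) L \<subseteq> FA \<union> FB"
    from s[OF this, of True] s[OF this, of False] s[OF F(1), of True] s[OF F(1), of False] or show ?thesis
      by (cases "\<alpha> \<and> a \<noteq> b"; cases \<beta>) simp_all
  qed
  then show ?thesis unfolding edges_at by simp
qed

lemma E_nonempty: "E \<noteq> {}" using ed_in_E by blast

text \<open>Since \<open>n\<close> is at least 3, the condition on lengths excludes exactly
  \<open>n = 4\<close> without twist, where the straight faces are 4-cycles as well.\<close>

lemma quads_straight_map:
  assumes d: "period \<alpha> dvd n" and l: "(if p then 2 * n else n) \<noteq> 4"
  shows "quads L \<union> straight_faces \<alpha> False L \<in> class201_maps V E"
    "face_lengths (quads L \<union> straight_faces \<alpha> False L) = {4, if p then 2 * n else n}"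
proof -
  have q: "is_cycle E f \<and> card f = 4" if "f \<in> quads L" for f
    using that quad_cycle unfolding quads_def by auto
  have s: "is_cycle E f \<and> card f = (if p then 2 * n else n)" if "f \<in> straight_faces \<alpha> False L" for f
    using straight_face_cycle[OF that d] by simp
  have link: "{e \<in> E. v \<in> e} \<subseteq> X" if h: "v \<in> V" "X \<subseteq> {e \<in> E. v \<in> e}" "e \<in> X"
     "\<And>e f e'. e \<in> X \<Longrightarrow> f \<in> quads L \<union> straight_faces \<alpha> False L \<Longrightarrow> e \<in> f \<Longrightarrow> e' \<in> f \<Longrightarrow> v \<in> e' \<Longrightarrow> e' \<in> X" for v X e
  proof -
    obtain i a b where v: "v = L i a b" using h(1) unfolding V_eq by blast
    show ?thesis unfolding v
      by (rule link_closed[OF h(2,3)[unfolded v], where FA = "quads L" and FB = "straight_faces \<alpha> False L" and \<alpha> = \<alpha> and \<beta> = False])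
        (use h(4)[unfolded v] in blast)+
  qed
  have tr: "\<exists>\<sigma>. graph_automorphism V E \<sigma> \<and> face_image \<sigma> ` quads L = quads L \<and>
       face_image \<sigma> ` straight_faces \<alpha> False L = straight_faces \<alpha> False L \<and> \<sigma> v = v' \<and> \<sigma> ` e = e'"
    if "e \<in> E" "v \<in> e" "e' \<in> E" "v' \<in> e'" for v e v' e'
    using arc_transitive[OF d that] by metis
  note R = class_2_01_two_families[OF simple connected E_nonempty, of "quads L" "straight_faces \<alpha> False L" 4 "if p then 2 * n else n"]
  have prems: "is_cycle E f" if "f \<in> quads L \<union> straight_faces \<alpha> False L" for f
    using that q s by (elim UnE) simp_all
  note prems = prems quad_ex1 straight_ex1[OF d] q[THEN conjunct2] s[THEN conjunct2] l[symmetric] link tr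
  show "quads L \<union> straight_faces \<alpha> False L \<in> class201_maps V E"
    by (rule R(1)) (fact prems)+
  show "face_lengths (quads L \<union> straight_faces \<alpha> False L) = {4, if p then 2 * n else n}"
    by (rule R(2)) (fact prems)+
qed

text \<open>Here \<open>n div 3\<close> is odd, so one turn complements the inhomogeneous sequences,
  which close only after two turns, while the homogeneous ones close after one.\<close>

lemma straight_straight_map:
  assumes d: "3 dvd n" "odd n" and p: "\<not> p"
  shows "straight_faces False False L \<union> straight_faces False True L \<in> class201_maps V E"
    "face_lengths (straight_faces False False L \<union> straight_faces False True L) = {n, 2 * n}"
proof -
  have d': "period False dvd n" using d by (simp add: period_def)
  have o: "odd (n div 3)" using d by (metis dvd_mult_div_cancel even_mult_iff)
  have q: "is_cycle E f \<and> card f = n" if "f \<in> straight_faces False False L" for f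
    using straight_face_cycle[OF that d'] p by simp
  have s: "is_cycle E f \<and> card f = 2 * n" if "f \<in> straight_faces False True L" for f
    using straight_face_cycle[OF that d'] p o by simp
  have link: "{e \<in> E. v \<in> e} \<subseteq> X" if h: "v \<in> V" "X \<subseteq> {e \<in> E. v \<in> e}" "e \<in> X"
     "\<And>e f e'. e \<in> X \<Longrightarrow> f \<in> straight_faces False False L \<union> straight_faces False True L \<Longrightarrow> e \<in> f \<Longrightarrow> e' \<in> f \<Longrightarrow> v \<in> e' \<Longrightarrow> e' \<in> X" for v X e
  proof -
    obtain i a b where v: "v = L i a b" using h(1) unfolding V_eq by blast
    show ?thesis unfolding v
      by (rule link_closed[OF h(2,3)[unfolded v], where FA = "straight_faces False False L" and FB = "straight_faces False True L" and \<alpha> = False and \<beta> = False])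
        (use h(4)[unfolded v] in auto)
  qed
  have tr: "\<exists>\<sigma>. graph_automorphism V E \<sigma> \<and> face_image \<sigma> ` straight_faces False False L = straight_faces False False L \<and>
       face_image \<sigma> ` straight_faces False True L = straight_faces False True L \<and> \<sigma> v = v' \<and> \<sigma> ` e = e'"
    if "e \<in> E" "v \<in> e" "e' \<in> E" "v' \<in> e'" for v e v' e'
    using arc_transitive[OF d' that] by metis
  note R = class_2_01_two_families[OF simple connected E_nonempty, of "straight_faces False False L" "straight_faces False True L" n "2 * n"]
  have n: "n \<noteq> 2 * n" using n3 by simp
  have prems: "is_cycle E f" if "f \<in> straight_faces False False L \<union> straight_faces False True L" for f
    using that q s by (elim UnE) simp_all
  note prems = prems straight_ex1[OF d'] straight_ex1[OF d'] q[THEN conjunct2] s[THEN conjunct2] n link tr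
  show "straight_faces False False L \<union> straight_faces False True L \<in> class201_maps V E"
    by (rule R(1)) (fact prems)+
  show "face_lengths (straight_faces False False L \<union> straight_faces False True L) = {n, 2 * n}"
    by (rule R(2)) (fact prems)+
qed

end

section \<open>Recognising a family by its pairing of edges at the vertices\<close>

lemma family_eqI:
  assumes G: "\<And>f. f \<in> G \<Longrightarrow> is_cycle E f" and H: "\<And>f. f \<in> H \<Longrightarrow> is_cycle E f"
    and G1: "\<And>e. e \<in> E \<Longrightarrow> \<exists>f\<in>G. e \<in> f" and H1: "\<And>e. e \<in> E \<Longrightarrow> \<exists>f\<in>H. e \<in> f"
    and *: "\<And>f g e v. f \<in> G \<Longrightarrow> g \<in> H \<Longrightarrow> e \<in> f \<Longrightarrow> e \<in> g \<Longrightarrow> v \<in> e \<Longrightarrow> \<exists>e'. e' \<noteq> e \<and> v \<in> e' \<and> e' \<in> f \<and> e' \<in> g"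
  shows "G = H"
proof -
  have eq: "f = g" if "f \<in> G" "g \<in> H" "e \<in> f" "e \<in> g" for f g e
    by (rule is_cycle_eqI[OF G H that(3,4)]) (use that * in blast)+
  have ne: "\<exists>e\<in>E. e \<in> f" if "is_cycle E f" for f using that unfolding is_cycle_def by blast
  show ?thesis
  proof (intro set_eqI iffI)
    fix f assume f: "f \<in> G"
    obtain e where e: "e \<in> E" "e \<in> f" using ne[OF G[OF f]] by blast
    obtain g where "g \<in> H" "e \<in> g" using H1[OF e(1)] by blast
    then show "f \<in> H" using eq[OF f _ e(2)] by blast
  next
    fix g assume g: "g \<in> H"
    obtain e where e: "e \<in> E" "e \<in> g" using ne[OF H[OF g]] by blast
    obtain f where "f \<in> G" "e \<in> f" using G1[OF e(1)] by blast
    then show "g \<in> G" using eq[OF _ g _ e(2)] by blast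
  qed
qed

text \<open>A family covering each edge once by a cycle is determined by its pairing of edges at the
  vertices. The classification is carried out on this local datum, and
  \<open>family_eq_straight\<close> and \<open>family_eq_quads\<close> lead back to faces.\<close>

definition mates :: "'a set set set \<Rightarrow> 'a \<Rightarrow> 'a set \<Rightarrow> 'a set \<Rightarrow> bool" where
  "mates G v e e' \<longleftrightarrow> e \<noteq> e' \<and> v \<in> e \<and> v \<in> e' \<and> (\<exists>f\<in>G. e \<in> f \<and> e' \<in> f)"

lemma mates_sym: "mates G v e e' \<Longrightarrow> mates G v e' e"
  unfolding mates_def by blast

context const_px
begin

lemma family_eq_straight:
  assumes G: "\<And>f. f \<in> G \<Longrightarrow> is_cycle E f" and G1: "\<And>e. e \<in> E \<Longrightarrow> \<exists>!f. f \<in> G \<and> e \<in> f"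
    and d: "period \<alpha> dvd n"
    and m: "\<And>i a b c. mates G (L i a b) (ed L (i - 1) c a b) (ed L i a b ((c \<noteq> (\<alpha> \<and> a \<noteq> b)) \<noteq> \<beta>))"
  shows "G = straight_faces \<alpha> \<beta> L"
proof (rule family_eqI[of _ E])
  show "is_cycle E f" if "f \<in> straight_faces \<alpha> \<beta> L" for f by (rule straight_face_cycle[OF that d])
  show "\<exists>f\<in>G. e \<in> f" if "e \<in> E" for e using G1[OF that] by blast
  show "\<exists>f\<in>straight_faces \<alpha> \<beta> L. e \<in> f" if "e \<in> E" for e using straight_ex1[OF d that] by blast
  fix f g e v assume fg: "f \<in> G" "g \<in> straight_faces \<alpha> \<beta> L" "e \<in> f" "e \<in> g" "v \<in> e"
  have eE: "e \<in> E" using G[OF fg(1)] fg(3) unfolding is_cycle_def by blast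
  then obtain i a b x where e: "e = ed L i a b x" unfolding E_eq by blast
  have mf: "e' \<in> f" if "mates G w e e'" for w e'
  proof -
    obtain h where "h \<in> G" "e \<in> h" "e' \<in> h" using \<open>mates G w e e'\<close> unfolding mates_def by blast
    then show ?thesis using G1[OF eE] fg by blast
  qed
  have "v = L i a b \<or> v = L (i + 1) b x" using fg(5) by (auto simp: e ed_def)
  then show "\<exists>e'. e' \<noteq> e \<and> v \<in> e' \<and> e' \<in> f \<and> e' \<in> g"
  proof
    assume v: "v = L i a b"
    let ?c = "(x \<noteq> (\<alpha> \<and> a \<noteq> b)) \<noteq> \<beta>"
    have "((?c \<noteq> (\<alpha> \<and> a \<noteq> b)) \<noteq> \<beta>) = x" by blast
    then have "mates G v (ed L (i - 1) ?c a b) e" using m[of i a b ?c] unfolding v e by simp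
    then have "mates G v e (ed L (i - 1) ?c a b)" by (rule mates_sym)
    moreover have "ed L (i - 1) ?c a b \<in> g" using straight_face_next(2)[OF fg(2) fg(4)[unfolded e]] .
    ultimately show ?thesis using mf unfolding mates_def by blast
  next
    assume v: "v = L (i + 1) b x"
    have "mates G v e (ed L (i + 1) b x ((a \<noteq> (\<alpha> \<and> b \<noteq> x)) \<noteq> \<beta>))" using m[of "i + 1" b x a] unfolding v e by simp
    moreover have "ed L (i + 1) b x ((a \<noteq> (\<alpha> \<and> b \<noteq> x)) \<noteq> \<beta>) \<in> g" using straight_face_next(1)[OF fg(2) fg(4)[unfolded e]] .
    ultimately show ?thesis using mf unfolding mates_def by blast
  qed
qed (use G in blast)

end

lemma (in labelled_px) family_eq_quads:
  assumes G: "\<And>f. f \<in> G \<Longrightarrow> is_cycle E f" and G1: "\<And>e. e \<in> E \<Longrightarrow> \<exists>!f. f \<in> G \<and> e \<in> f"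
    and m: "\<And>i a b c. mates G (L i a b) (ed L (i - 1) c a b) (ed L (i - 1) (\<not> c) a b)"
      "\<And>i a b c. mates G (L i a b) (ed L i a b c) (ed L i a b (\<not> c))"
  shows "G = quads L"
proof (rule family_eqI[of _ E])
  show "is_cycle E f" if "f \<in> quads L" for f using that quad_cycle unfolding quads_def by auto
  show "\<exists>f\<in>G. e \<in> f" if "e \<in> E" for e using G1[OF that] by blast
  show "\<exists>f\<in>quads L. e \<in> f" if "e \<in> E" for e
  proof -
    obtain i a b x where "e = ed L i a b x" using \<open>e \<in> E\<close> unfolding E_eq by blast
    then show ?thesis by (intro bexI[of _ "quad L (i + 1) b"]) (simp_all add: ed_in_quad quad_in_quads)
  qed
  fix f g e v assume fg: "f \<in> G" "g \<in> quads L" "e \<in> f" "e \<in> g" "v \<in> e"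
  have eE: "e \<in> E" using G[OF fg(1)] fg(3) unfolding is_cycle_def by blast
  then obtain i a b x where e: "e = ed L i a b x" unfolding E_eq by blast
  have g: "g = quad L (i + 1) b" using quad_unique fg(2,4) unfolding e by blast
  have mf: "e' \<in> f" if "mates G w e e'" for w e'
  proof -
    obtain h where "h \<in> G" "e \<in> h" "e' \<in> h" using \<open>mates G w e e'\<close> unfolding mates_def by blast
    then show ?thesis using G1[OF eE] fg by blast
  qed
  have "v = L i a b \<or> v = L (i + 1) b x" using fg(5) by (auto simp: e ed_def)
  then show "\<exists>e'. e' \<noteq> e \<and> v \<in> e' \<and> e' \<in> f \<and> e' \<in> g"
  proof
    assume v: "v = L i a b"
    have "mates G v e (ed L i a b (\<not> x))" using m(2) unfolding v e .
    then show ?thesis using mf ed_in_quad[of L i a b "\<not> x"] unfolding mates_def g by blast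
  next
    assume v: "v = L (i + 1) b x"
    have "mates G v e (ed L i (\<not> a) b x)" using m(1)[of "i + 1" b x a] unfolding v e by simp
    then show ?thesis using mf ed_in_quad[of L i "\<not> a" b x] unfolding mates_def g by blast
  qed
qed (use G in blast)

section \<open>Straight pairings\<close>

text \<open>The pairing is kept as an abstract relation \<open>R\<close> invariant under a set
  \<open>A\<close> of automorphisms. No labelling enters \<open>A\<close> or \<open>R\<close>, so
  the locale can be interpreted again for a gauged labelling, with a simpler \<open>s\<close>;
  \<open>normal_form\<close> does this.\<close>

locale straight_pairing = labelled_px n \<tau> V E L
  for n :: nat and \<tau> :: "int \<Rightarrow> bool" and V :: "'a set" and E :: "'a set set" and L :: "int \<Rightarrow> bool \<Rightarrow> bool \<Rightarrow> 'a" +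
  fixes A :: "('a \<Rightarrow> 'a) \<Rightarrow> bool" and R :: "'a \<Rightarrow> 'a set \<Rightarrow> 'a set \<Rightarrow> bool" and s :: "int \<Rightarrow> bool \<Rightarrow> bool \<Rightarrow> bool"
  assumes A_aut: "A \<sigma> \<Longrightarrow> graph_automorphism V E \<sigma>"
    and A_fib: "A \<sigma> \<Longrightarrow> \<sigma> (L i a b) = L j c d \<Longrightarrow> \<exists>c' d'. \<sigma> (L i a' b') = L j c' d'"
    and A_trans: "e \<in> E \<Longrightarrow> v \<in> e \<Longrightarrow> e' \<in> E \<Longrightarrow> v' \<in> e' \<Longrightarrow> \<exists>\<sigma>. A \<sigma> \<and> \<sigma> v = v' \<and> \<sigma> ` e = e'"
    and R_sym: "R v e e' \<Longrightarrow> R v e' e"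
    and R_equi: "A \<sigma> \<Longrightarrow> R v e e' \<Longrightarrow> R (\<sigma> v) (\<sigma> ` e) (\<sigma> ` e')"
    and R_s: "R (L i a b) (ed L (i - 1) c a b) (ed L i a b d) \<longleftrightarrow> d = (c \<noteq> s i a b)"
begin

text \<open>A pair at level \<open>i\<close> joins position \<open>i - 1\<close> to position
  \<open>i + 2\<close>, so a translation by \<open>t\<close> changes \<open>s\<close> by the values
  of \<open>t\<close> at these two positions. Comparing the images of a vertex before and after one
  turn shows that \<open>t\<close> is periodic up to the change of twist.\<close>

lemma forward_gauge:
  assumes A: "A \<sigma>" and m: "\<sigma> (L i0 a0 b0) = L (i0 + k) c0 d0" "\<sigma> (L (i0 + 1) a1 b1) = L (i0 + k + 1) c1 d1"
  shows "\<exists>t. (\<forall>i a b. \<sigma> (L i a b) = L (i + k) (a \<noteq> t i) (b \<noteq> t (i + 1))) \<and>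
     (\<forall>i a b. s (i + k) (a \<noteq> t i) (b \<noteq> t (i + 1)) = (s i a b \<noteq> (t (i - 1) \<noteq> t (i + 2)))) \<and>
     (\<forall>i. (t (i + int n) \<noteq> \<tau> (i + k)) = (t i \<noteq> \<tau> i))"
proof -
  have "\<exists>t. \<forall>i a b. \<sigma> (L i a b) = L (i + k) (a \<noteq> t i) (b \<noteq> t (i + 1))"
    by (rule gauge_forward[OF labelled_px_axioms image_labelled[OF A_aut[OF A]], OF A_fib[OF A] m])
  then obtain t where t: "\<And>i a b. \<sigma> (L i a b) = L (i + k) (a \<noteq> t i) (b \<noteq> t (i + 1))" by blast
  have ed: "\<sigma> ` ed L i a b c = ed L (i + k) (a \<noteq> t i) (b \<noteq> t (i + 1)) (c \<noteq> t (i + 2))" for i a b c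
    unfolding ed_def by (simp add: t add_ac)
  have "s (i + k) (a \<noteq> t i) (b \<noteq> t (i + 1)) = (s i a b \<noteq> (t (i - 1) \<noteq> t (i + 2)))" for i a b
  proof -
    have "R (L i a b) (ed L (i - 1) False a b) (ed L i a b (s i a b))" unfolding R_s by simp
    from R_equi[OF A this] have "R (L (i + k) (a \<noteq> t i) (b \<noteq> t (i + 1)))
        (ed L (i - 1 + k) (False \<noteq> t (i - 1)) (a \<noteq> t (i - 1 + 1)) (b \<noteq> t (i - 1 + 2)))
        (ed L (i + k) (a \<noteq> t i) (b \<noteq> t (i + 1)) (s i a b \<noteq> t (i + 2)))" unfolding ed t .
    moreover have "i - 1 + k = i + k - 1" "i - 1 + 1 = i" "i - 1 + 2 = i + 1" by simp_all
    ultimately have "(s i a b \<noteq> t (i + 2)) = ((False \<noteq> t (i - 1)) \<noteq> s (i + k) (a \<noteq> t i) (b \<noteq> t (i + 1)))"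
      by (simp only: R_s)
    then show ?thesis by blast
  qed
  moreover have "(t (i + int n) \<noteq> \<tau> (i + k)) = (t i \<noteq> \<tau> i)" for i
  proof -
    have "\<sigma> (L (i + int n) False False) = L (i + k + int n) (False \<noteq> t (i + int n)) (False \<noteq> t (i + int n + 1))"
      unfolding t by (simp add: add_ac)
    also have "\<dots> = L (i + k) ((False \<noteq> t (i + int n)) \<noteq> \<tau> (i + k)) ((False \<noteq> t (i + int n + 1)) \<noteq> \<tau> (i + k + 1))"
      by (rule twist)
    finally have "L (i + k) ((False \<noteq> t (i + int n)) \<noteq> \<tau> (i + k)) ((False \<noteq> t (i + int n + 1)) \<noteq> \<tau> (i + k + 1))
      = L (i + k) ((False \<noteq> \<tau> i) \<noteq> t i) ((False \<noteq> \<tau> (i + 1)) \<noteq> t (i + 1))" unfolding twist t ..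
    from inj[OF this] show ?thesis by blast
  qed
  ultimately show ?thesis using t by blast
qed

text \<open>Arc-transitivity within one level: an upward edge can be moved to any other, which
  prescribes three bits of \<open>t\<close>. As no level is shifted, the twist cancels and
  \<open>t\<close> is n-periodic.\<close>

lemma local_translation:
  "\<exists>t. t i = x \<and> t (i + 1) = y \<and> t (i + 2) = z \<and>
     (\<forall>i a b. s i (a \<noteq> t i) (b \<noteq> t (i + 1)) = (s i a b \<noteq> (t (i - 1) \<noteq> t (i + 2)))) \<and> (\<forall>i. t (i + int n) = t i)"
proof -
  have arcs: "L i False False \<in> ed L i False False False" "L i x y \<in> ed L i x y z" by (simp_all add: ed_mem)
  obtain \<sigma> where A: "A \<sigma>" "\<sigma> (L i False False) = L i x y" "\<sigma> ` ed L i False False False = ed L i x y z"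
    using A_trans[OF ed_in_E arcs(1) ed_in_E arcs(2)] by blast
  then have m: "\<sigma> (L (i + 1) False False) = L (i + 1) y z"
    unfolding ed_def by (simp add: doubleton_eq_iff) metis
  have m': "\<sigma> (L i False False) = L (i + 0) x y" "\<sigma> (L (i + 1) False False) = L (i + 0 + 1) y z"
    using A(2) m by simp_all
  obtain t where t: "\<forall>i a b. \<sigma> (L i a b) = L (i + 0) (a \<noteq> t i) (b \<noteq> t (i + 1))"
     "\<forall>i a b. s (i + 0) (a \<noteq> t i) (b \<noteq> t (i + 1)) = (s i a b \<noteq> (t (i - 1) \<noteq> t (i + 2)))"
     "\<forall>i. (t (i + int n) \<noteq> \<tau> (i + 0)) = (t i \<noteq> \<tau> i)" using forward_gauge[OF A(1) m'] by (elim exE conjE)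
  note t = t(1)[unfolded add_0_right, rule_format] t(2)[unfolded add_0_right] t(3)[unfolded add_0_right, rule_format]
  have "t i = x \<and> t (i + 1) = y" using A(2) inj unfolding t by blast
  moreover have "t (i + 1) = y \<and> t (i + 2) = z" using m inj[of "i + 1"] unfolding t by (simp add: add.assoc)
  moreover have "t (i + int n) = t i" for i using t(3)[of i] by blast
  ultimately show ?thesis using t(2) by blast
qed

lemma shift_translation:
  "\<exists>t. (\<forall>i a b. s (i + 1) (a \<noteq> t i) (b \<noteq> t (i + 1)) = (s i a b \<noteq> (t (i - 1) \<noteq> t (i + 2)))) \<and>
     (\<forall>i. (t (i + int n) \<noteq> \<tau> (i + 1)) = (t i \<noteq> \<tau> i))"
proof -
  have arcs: "L 0 False False \<in> ed L 0 False False False" "L 1 False False \<in> ed L 1 False False False" by (simp_all add: ed_mem)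
  obtain \<sigma> where A: "A \<sigma>" "\<sigma> (L 0 False False) = L 1 False False" "\<sigma> ` ed L 0 False False False = ed L 1 False False False"
    using A_trans[OF ed_in_E arcs(1) ed_in_E arcs(2)] by blast
  then have m: "\<sigma> (L 1 False False) = L 2 False False"
    unfolding ed_def by (simp add: doubleton_eq_iff) metis
  have "\<sigma> (L 0 False False) = L (0 + 1) False False" "\<sigma> (L (0 + 1) False False) = L (0 + 1 + 1) False False"
    using A(2) m by simp_all
  from forward_gauge[OF A(1) this] show ?thesis by (elim exE conjE) (intro exI conjI)
qed

text \<open>Reversing an edge between the levels 0 and 1 maps level \<open>i\<close> to level
  \<open>1 - i\<close>. This exchanges the two bits of a vertex, and also the upper and lower edge
  of a pair, hence the use of \<open>R_sym\<close>.\<close>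

lemma reflection:
  "\<exists>t. \<forall>i a b. s (1 - i) (b \<noteq> t (i + 1)) (a \<noteq> t i) = (s i a b \<noteq> (t (i - 1) \<noteq> t (i + 2)))"
proof -
  have arcs: "L 0 False False \<in> ed L 0 False False False" "L 1 False False \<in> ed L 0 False False False" by (simp_all add: ed_def)
  obtain \<sigma> where A: "A \<sigma>" "\<sigma> (L 0 False False) = L 1 False False" "\<sigma> ` ed L 0 False False False = ed L 0 False False False"
    using A_trans[OF ed_in_E arcs(1) ed_in_E arcs(2)] by blast
  then have m: "\<sigma> (L 1 False False) = L 0 False False"
    unfolding ed_def by (simp add: doubleton_eq_iff) metis
  have "\<exists>t. \<forall>i a b. \<sigma> (L i a b) = L (1 - i) (b \<noteq> t (i + 1)) (a \<noteq> t i)"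
  proof (rule gauge_backward[OF labelled_px_axioms image_labelled[OF A_aut[OF A(1)]], OF A_fib[OF A(1)]])
    show "\<sigma> (L 0 False False) = L (1 - 0) False False" "\<sigma> (L (0 + 1) False False) = L (1 - 0 - 1) False False"
      using A(2) m by simp_all
  qed
  then obtain t where t: "\<And>i a b. \<sigma> (L i a b) = L (1 - i) (b \<noteq> t (i + 1)) (a \<noteq> t i)" by blast
  have ed: "\<sigma> ` ed L i a b c = ed L (- i) (c \<noteq> t (i + 2)) (b \<noteq> t (i + 1)) (a \<noteq> t i)" for i a b c
    unfolding ed_def by (simp add: t insert_commute add_ac)
  have "s (1 - i) (b \<noteq> t (i + 1)) (a \<noteq> t i) = (s i a b \<noteq> (t (i - 1) \<noteq> t (i + 2)))" for i a b
  proof -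
    have "R (L i a b) (ed L (i - 1) False a b) (ed L i a b (s i a b))" unfolding R_s by simp
    from R_sym[OF R_equi[OF A(1) this]] have "R (L (1 - i) (b \<noteq> t (i + 1)) (a \<noteq> t i))
        (ed L (- i) (s i a b \<noteq> t (i + 2)) (b \<noteq> t (i + 1)) (a \<noteq> t i))
        (ed L (- (i - 1)) (b \<noteq> t (i - 1 + 2)) (a \<noteq> t (i - 1 + 1)) (False \<noteq> t (i - 1)))" unfolding ed t .
    moreover have "- i = 1 - i - 1" "- (i - 1) = 1 - i" "i - 1 + 1 = i" "i - 1 + 2 = i + 1" by simp_all
    ultimately have "(False \<noteq> t (i - 1)) = ((s i a b \<noteq> t (i + 2)) \<noteq> s (1 - i) (b \<noteq> t (i + 1)) (a \<noteq> t i))"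
      by (simp only: R_s)
    then show ?thesis by blast
  qed
  then show ?thesis by blast
qed

text \<open>A translation fixing the level changes \<open>s i\<close> by a constant, so
  \<open>s i\<close> is an affine function of its two bits. The shift by one level makes the
  coefficients independent of \<open>i\<close>, and the reflection, which swaps the bits, makes the
  two coefficients equal.\<close>

lemma affine: "\<exists>\<alpha>. \<forall>i a b. s i a b = ((\<alpha> \<and> a \<noteq> b) \<noteq> s i False False)"
proof -
  define p where "p i = (s i True False \<noteq> s i False False)" for i
  define q where "q i = (s i False True \<noteq> s i False False)" for i
  have s: "s i a b = (((p i \<and> a) \<noteq> (q i \<and> b)) \<noteq> s i False False)" for i a b
  proof -
    obtain t where t: "t i = True" "t (i + 1) = False"
      "\<And>i a b. s i (a \<noteq> t i) (b \<noteq> t (i + 1)) = (s i a b \<noteq> (t (i - 1) \<noteq> t (i + 2)))"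
      using local_translation[of i True False False] by blast
    have "s i True False = (s i False False \<noteq> (t (i - 1) \<noteq> t (i + 2)))" "s i True True = (s i False True \<noteq> (t (i - 1) \<noteq> t (i + 2)))"
      using t(3)[of i False False] t(3)[of i False True] unfolding t(1,2) by simp_all
    then have "s i True True = (s i False True \<noteq> p i)" unfolding p_def by blast
    then show ?thesis unfolding p_def q_def by (cases a; cases b) auto
  qed
  have pq: "p (i + 1) = p i \<and> q (i + 1) = q i" for i
  proof -
    obtain t where t: "\<And>i a b. s (i + 1) (a \<noteq> t i) (b \<noteq> t (i + 1)) = (s i a b \<noteq> (t (i - 1) \<noteq> t (i + 2)))"
      using shift_translation by blast
    obtain d1 d0 where s1: "\<And>a b. s (i + 1) a b = (((p (i + 1) \<and> a) \<noteq> (q (i + 1) \<and> b)) \<noteq> d1)"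
      and s0: "\<And>a b. s i a b = (((p i \<and> a) \<noteq> (q i \<and> b)) \<noteq> d0)" by (rule that) (rule s)+
    show ?thesis using t[of i False False] t[of i True False] t[of i False True]
      unfolding s1 s0 by argo
  qed
  have "p i = p 0 \<and> q i = q 0" for i
  proof (induction i rule: int_induct[of _ 0])
    case (step2 i) then show ?case using pq[of "i - 1"] by simp
  qed (use pq in auto)
  then have p0: "p i = p 0" "q i = q 0" for i by blast+
  have s': "s i a b = (((p 0 \<and> a) \<noteq> (q 0 \<and> b)) \<noteq> s i False False)" for i a b
    using s[of i a b] unfolding p0(1)[of i] p0(2)[of i] .
  obtain t where t: "\<And>i a b. s (1 - i) (b \<noteq> t (i + 1)) (a \<noteq> t i) = (s i a b \<noteq> (t (i - 1) \<noteq> t (i + 2)))"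
    using reflection by blast
  obtain d1 d0 where s1: "\<And>a b. s (1 - 0) a b = (((p 0 \<and> a) \<noteq> (q 0 \<and> b)) \<noteq> d1)"
    and s0: "\<And>a b. s 0 a b = (((p 0 \<and> a) \<noteq> (q 0 \<and> b)) \<noteq> d0)" by (rule that) (rule s')+
  have "p 0 = q 0" using t[of 0 False False] t[of 0 True False] unfolding s1 s0 by argo
  then have "s i a b = ((p 0 \<and> a \<noteq> b) \<noteq> s i False False)" for i a b using s'[of i a b] by auto
  then show ?thesis by blast
qed

text \<open>Without constants in \<open>s\<close>, the translations coming from automorphisms are
  exactly solutions of the homogeneous recurrence, so their periodicity restricts \<open>n\<close>
  and their effect on the twist restricts \<tau>.\<close>

lemma homogeneous_period:
  assumes s: "\<And>i a b. s i a b = (\<alpha> \<and> a \<noteq> b)"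
  shows "period \<alpha> dvd n" "\<tau> i = \<tau> 0"
proof -
  have sol: "sol \<alpha> False t" if "\<And>i a b. (\<alpha> \<and> (a \<noteq> t i) \<noteq> (b \<noteq> t (i + 1))) = ((\<alpha> \<and> a \<noteq> b) \<noteq> (t (i - 1) \<noteq> t (i + 2)))" for t
    unfolding sol_def
  proof
    fix i :: int
    have "i + 1 - 1 = i" "i + 1 + 1 = i + 2" "i + 1 + 2 = i + 3" by simp_all
    then show "t (i + 3) = ((t i \<noteq> (\<alpha> \<and> t (i + 1) \<noteq> t (i + 2))) \<noteq> False)"
      using that[of False "i + 1" False] by (simp only:) blast
  qed
  have per: "t (i + int n) = t i" if t: "sol \<alpha> False t" for t i
  proof -
    \<comment> \<open>Every solution equals a translation with the same three initial bits, and
      these translations are n-periodic.\<close>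
    obtain t' where t': "t' 0 = t 0" "t' (0 + 1) = t (0 + 1)" "t' (0 + 2) = t (0 + 2)"
      "\<forall>i a b. s i (a \<noteq> t' i) (b \<noteq> t' (i + 1)) = (s i a b \<noteq> (t' (i - 1) \<noteq> t' (i + 2)))" "\<forall>i. t' (i + int n) = t' i"
      using local_translation[of 0 "t 0" "t (0 + 1)" "t (0 + 2)"] by (elim exE conjE)
    have "sol \<alpha> False t'" by (rule sol) (use t'(4) in \<open>simp only: s\<close>)
    then have "t' = t" using sol_unique[OF _ t t'(1-3)] by blast
    then show ?thesis using t'(5) by blast
  qed
  show "period \<alpha> dvd n"
  proof (cases \<alpha>)
    case True
    \<comment> \<open>The pattern 1100 is a solution of exact period 4; its values at
      \<open>n\<close> and \<open>n + 1\<close> already force 4 to divide \<open>n\<close>. For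
      \<alpha> = 0 the pattern 100 plays the same part.\<close>
    define t where "t i = (i mod 4 = 0 \<or> i mod 4 = 1)" for i :: int
    have "t (i + 3) = (t i \<noteq> (t (i + 1) \<noteq> t (i + 2)))" for i
    proof -
      have m: "(i + 1) mod 4 = (i mod 4 + 1) mod 4" "(i + 2) mod 4 = (i mod 4 + 2) mod 4" "(i + 3) mod 4 = (i mod 4 + 3) mod 4"
        by (simp_all only: mod_add_left_eq)
      obtain r where r: "i mod 4 = r" by blast
      have "i mod 4 = 0 \<or> i mod 4 = 1 \<or> i mod 4 = 2 \<or> i mod 4 = 3" by presburger
      then show ?thesis unfolding t_def m r by (elim disjE) simp_all
    qed
    then have "sol \<alpha> False t" unfolding sol_def using True by blast
    from per[OF this, of 0] per[OF this, of 1] have "t (0 + int n) = t 0" "t (1 + int n) = t 1" by simp_all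
    then have "int n mod 4 = 0" unfolding t_def by simp presburger
    then show ?thesis using True unfolding period_def by presburger
  next
    case False
    define t where "t i = (i mod 3 = 0)" for i :: int
    have "sol \<alpha> False t" unfolding sol_def t_def using False by simp
    from per[OF this, of 0] have "t (0 + int n) = t 0" .
    then have "int n mod 3 = 0" unfolding t_def by simp
    then show ?thesis using False unfolding period_def by presburger
  qed
  obtain t where t: "\<forall>i a b. s (i + 1) (a \<noteq> t i) (b \<noteq> t (i + 1)) = (s i a b \<noteq> (t (i - 1) \<noteq> t (i + 2)))"
     "\<And>i. (t (i + int n) \<noteq> \<tau> (i + 1)) = (t i \<noteq> \<tau> i)" using shift_translation by blast
  have "sol \<alpha> False t" by (rule sol) (use t(1) in \<open>simp only: s\<close>)
  \<comment> \<open>The translation belonging to the shift by one level is also n-periodic, so the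
    twist is the same at neighbouring positions.\<close>
  then have st: "\<tau> (i + 1) = \<tau> i" for i using t(2)[of i] per[of t i] by argo
  show "\<tau> i = \<tau> 0"
  proof (induction i rule: int_induct[of _ 0])
    case (step2 i) then show ?case using st[of "i - 1"] by simp
  qed (use st in auto)
qed

text \<open>The constants of \<open>s\<close> are removed by gauging with one particular solution
  \<open>u\<close> of the inhomogeneous recurrence. This \<open>u\<close> is defined on all integers
  and need not respect the turn; the resulting twist is constant by
  \<open>homogeneous_period\<close>.\<close>

lemma normal_form:
  "\<exists>p \<alpha> u. const_px n p V E (\<lambda>i a b. L i (a \<noteq> u i) (b \<noteq> u (i + 1))) \<and> period \<alpha> dvd n \<and>
     (\<forall>i a b c d. R (L i (a \<noteq> u i) (b \<noteq> u (i + 1)))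
        (ed (\<lambda>i a b. L i (a \<noteq> u i) (b \<noteq> u (i + 1))) (i - 1) c a b)
        (ed (\<lambda>i a b. L i (a \<noteq> u i) (b \<noteq> u (i + 1))) i a b d) \<longleftrightarrow> d = (c \<noteq> (\<alpha> \<and> a \<noteq> b)))"
proof -
  obtain \<alpha> where \<alpha>: "\<And>i a b. s i a b = ((\<alpha> \<and> a \<noteq> b) \<noteq> s i False False)" using affine by blast
  \<comment> \<open>The index is \<open>i + 1\<close> because the pairing at level
    \<open>i + 1\<close> ties position \<open>i\<close> to position \<open>i + 3\<close>.\<close>
  obtain u where u: "\<And>i. u (i + 3) = ((u i \<noteq> (\<alpha> \<and> u (i + 1) \<noteq> u (i + 2))) \<noteq> s (i + 1) False False)"
    using recurrence_exists[of 0 False False False \<alpha> "\<lambda>i. s (i + 1) False False"] by blast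
  let ?L = "\<lambda>i a b. L i (a \<noteq> u i) (b \<noteq> u (i + 1))"
  define \<rho> where "\<rho> i = ((u i \<noteq> u (i + int n)) \<noteq> \<tau> (i + 0))" for i
  have L': "labelled_px n \<rho> V E ?L" unfolding \<rho>_def using gauged[of u 0] by (simp only: add_0_right)
  have ed: "ed ?L i a b c = ed L i (a \<noteq> u i) (b \<noteq> u (i + 1)) (c \<noteq> u (i + 2))" for i a b c
    using ed_gauge[of L 0 u i a b c] by (simp only: add_0_right)
  have x: "((r \<noteq> q) \<noteq> q) = r" for r q :: bool by blast
  have R: "R (?L i a b) (ed ?L (i - 1) c a b) (ed ?L i a b d) \<longleftrightarrow> d = (c \<noteq> (\<alpha> \<and> a \<noteq> b))" for i a b c d
  proof -
    have e: "i - 1 + 1 = i" "i - 1 + 2 = i + 1" "i - 1 + 3 = i + 2" by simp_all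
    have "R (?L i a b) (ed ?L (i - 1) c a b) (ed ?L i a b d) \<longleftrightarrow>
       (d \<noteq> u (i + 2)) = ((c \<noteq> u (i - 1)) \<noteq> s i (a \<noteq> u i) (b \<noteq> u (i + 1)))"
      unfolding ed e R_s ..
    also have "\<dots> \<longleftrightarrow> d = (c \<noteq> (\<alpha> \<and> a \<noteq> b))"
      using u[of "i - 1"] unfolding e \<alpha>[of i "a \<noteq> u i" "b \<noteq> u (i + 1)"] by blast
    finally show ?thesis .
  qed
  interpret G: straight_pairing n \<rho> V E ?L A R "\<lambda>i a b. \<alpha> \<and> a \<noteq> b"
  proof (intro straight_pairing.intro[OF L'] straight_pairing_axioms.intro)
    show "\<exists>c' d'. \<sigma> (?L i a' b') = ?L j c' d'" if A: "A \<sigma>" and e: "\<sigma> (?L i a b) = ?L j c d" for \<sigma> i a b j c d a' b'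
    proof -
      obtain c' d' where "\<sigma> (?L i a' b') = L j c' d'" using A_fib[OF A e] by blast
      then have "\<sigma> (?L i a' b') = ?L j (c' \<noteq> u j) (d' \<noteq> u (j + 1))" unfolding x .
      then show ?thesis by blast
    qed
  qed (fact A_aut A_trans R_sym R_equi R)+
  have "const_px n (\<rho> 0) V E ?L" unfolding const_px_def
  proof -
    have "\<rho> = (\<lambda>_. \<rho> 0)" using G.homogeneous_period(2)[of \<alpha>] by blast
    then show "labelled_px n (\<lambda>_. \<rho> 0) V E ?L" using L' by simp
  qed
  then show ?thesis using G.homogeneous_period(1)[of \<alpha>] R by blast
qed

end

section \<open>The pairings defined by a map of the class\<close>

lemma mates_image:
  assumes s: "simple_graph V E" and g: "graph_automorphism V E \<sigma>" and G: "\<And>f. f \<in> G \<Longrightarrow> f \<subseteq> E" and m: "mates G v e e'"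
  shows "mates (face_image \<sigma> ` G) (\<sigma> v) (\<sigma> ` e) (\<sigma> ` e')"
proof -
  obtain f where f: "e \<noteq> e'" "v \<in> e" "v \<in> e'" "f \<in> G" "e \<in> f" "e' \<in> f" using m unfolding mates_def by blast
  then have "e \<subseteq> V" "e' \<subseteq> V" using G simple_graph_edge_subset[OF s] by blast+
  moreover have "inj_on \<sigma> V" using g unfolding graph_automorphism_def bij_betw_def by blast
  ultimately have "\<sigma> ` e \<noteq> \<sigma> ` e'" using f(1) by (simp add: inj_on_image_eq_iff)
  moreover have "\<sigma> ` e \<in> face_image \<sigma> f" "\<sigma> ` e' \<in> face_image \<sigma> f" using f unfolding face_image_def by blast+
  ultimately show ?thesis using f unfolding mates_def by blast
qed

text \<open>The outcome of \<open>class_2_01_split\<close> on a labelled graph, together with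
  \<open>disj\<close>, the remnant of the vertex condition: the two families never pair the same two
  edges at a vertex.\<close>

locale class_map = labelled_px n \<tau> V E L
  for n :: nat and \<tau> :: "int \<Rightarrow> bool" and V :: "'a set" and E :: "'a set set" and L :: "int \<Rightarrow> bool \<Rightarrow> bool \<Rightarrow> 'a" +
  fixes F :: "'a set set set" and FA FB :: "'a set set set"
  assumes F_eq: "F = FA \<union> FB" and FAB: "FA \<inter> FB = {}"
    and F_cycle: "f \<in> F \<Longrightarrow> is_cycle E f"
    and FA1: "e \<in> E \<Longrightarrow> \<exists>!f. f \<in> FA \<and> e \<in> f" and FB1: "e \<in> E \<Longrightarrow> \<exists>!f. f \<in> FB \<and> e \<in> f"
    and A_FA: "map_aut V E F \<sigma> \<Longrightarrow> f \<in> FA \<Longrightarrow> face_image \<sigma> f \<in> FA"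
    and A_FB: "map_aut V E F \<sigma> \<Longrightarrow> f \<in> FB \<Longrightarrow> face_image \<sigma> f \<in> FB"
    and A_arc: "e \<in> E \<Longrightarrow> v \<in> e \<Longrightarrow> e' \<in> E \<Longrightarrow> v' \<in> e' \<Longrightarrow> \<exists>\<sigma>. map_aut V E F \<sigma> \<and> \<sigma> v = v' \<and> \<sigma> ` e = e'"
    and disj: "mates FA v e e' \<Longrightarrow> mates FB v e e' \<Longrightarrow> False"
begin

lemma swapped: "class_map n \<tau> V E L F FB FA"
  using F_eq FAB F_cycle FA1 FB1 A_FA A_FB A_arc disj
  by (intro class_map.intro[OF labelled_px_axioms] class_map_axioms.intro) blast+

lemma mates_equi:
  assumes "map_aut V E F \<sigma>" "G = FA \<or> G = FB" "mates G v e e'"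
  shows "mates G (\<sigma> v) (\<sigma> ` e) (\<sigma> ` e')"
proof -
  have "f \<subseteq> E" if "f \<in> G" for f using F_cycle[of f] that assms(2) F_eq unfolding is_cycle_def by blast
  then have "mates (face_image \<sigma> ` G) (\<sigma> v) (\<sigma> ` e) (\<sigma> ` e')"
    using mates_image[OF simple _ _ assms(3)] assms(1) by (simp add: map_aut_def)
  moreover have "face_image \<sigma> ` G \<subseteq> G" using A_FA A_FB assms(1,2) by blast
  ultimately show ?thesis unfolding mates_def by blast
qed

lemma mates_exists:
  assumes "G = FA \<or> G = FB" "e \<in> E" "v \<in> e"
  shows "\<exists>e'. mates G v e e'"
proof -
  obtain f where f: "f \<in> G" "e \<in> f" using assms FA1 FB1 by blast
  then have "is_cycle E f" using F_cycle F_eq assms(1) by blast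
  from is_cycle_mates[OF this f(2) assms(3)] show ?thesis using f assms(3) unfolding mates_def by blast
qed

lemma mates_unique:
  assumes "G = FA \<or> G = FB" "mates G v e e'" "mates G v e e''"
  shows "e' = e''"
proof -
  obtain f where f: "e \<noteq> e'" "v \<in> e" "v \<in> e'" "f \<in> G" "e \<in> f" "e' \<in> f" using assms(2) unfolding mates_def by blast
  obtain g where g: "e \<noteq> e''" "v \<in> e''" "g \<in> G" "e \<in> g" "e'' \<in> g" using assms(3) unfolding mates_def by blast
  have c: "is_cycle E f" using F_cycle F_eq assms(1) f(4) by blast
  then have "e \<in> E" using f(5) unfolding is_cycle_def by blast
  then have "f = g" using FA1 FB1 assms(1) f g by blast
  then show ?thesis using is_cycle_unique_mate[OF c f(5,6), of e'' v] f g by blast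
qed

lemma mates_in_E:
  assumes "G = FA \<or> G = FB" "mates G v e e'"
  shows "e' \<in> E" "v \<in> e'"
  using assms F_cycle F_eq unfolding mates_def is_cycle_def by blast+

text \<open>If some upper edge is paired with the other upper edge, the two lower edges are left to
  each other. Otherwise the pairing is a bijection from lower to upper edges, and a bijection
  between bits is the addition of a constant \<open>s\<close>.\<close>

lemma mates_cases:
  assumes G: "G = FA \<or> G = FB"
  obtains (quad) "\<And>c. mates G (L i a b) (ed L i a b c) (ed L i a b (\<not> c))"
      "\<And>c. mates G (L i a b) (ed L (i - 1) c a b) (ed L (i - 1) (\<not> c) a b)"
  | (straight) s where "\<And>c. mates G (L i a b) (ed L (i - 1) c a b) (ed L i a b (c \<noteq> s))"
proof -
  let ?v = "L i a b" and ?F = "ed L i a b" and ?B = "\<lambda>c. ed L (i - 1) c a b"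
  have at: "\<exists>c. e = ?F c \<or> e = ?B c" if "mates G ?v e' e" for e e'
    using edge_at mates_in_E[OF G that] by blast
  have v: "?v \<in> ?F c" "?v \<in> ?B c" "?F c \<in> E" "?B c \<in> E" for c by (simp_all add: ed_mem)
  have ne: "\<not> mates G w e e" for w e unfolding mates_def by blast
  have F: "?F c = ?F d \<longleftrightarrow> c = d" "?B c = ?B d \<longleftrightarrow> c = d" for c d by (simp_all add: ed_eq_iff)
  have FB: "?F c \<noteq> ?B d" for c d by (rule ed_neq)
  have un: "mates G ?v e e' \<Longrightarrow> mates G ?v e e'' \<Longrightarrow> e' = e''" for e e' e'' by (rule mates_unique[OF G])
  show thesis
  proof (cases "\<exists>c. mates G ?v (?F c) (?F (\<not> c))")
    case True
    then obtain d where d: "mates G ?v (?F d) (?F (\<not> d))" by blast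
    have T: "mates G ?v (?F c) (?F (\<not> c))" for c using d mates_sym[OF d] by (cases c; cases d) simp_all
    have "mates G ?v (?B c) (?B (\<not> c))" for c
    proof -
      obtain e where e: "mates G ?v (?B c) e" using mates_exists[OF G] v by blast
      then obtain d where d: "e = ?F d \<or> e = ?B d" using at by blast
      have "e \<noteq> ?F d"
      proof
        assume "e = ?F d"
        then have "mates G ?v (?F d) (?B c)" using mates_sym[OF e] by simp
        then show False using un[OF _ T[of d]] FB by metis
      qed
      then have "e = ?B d" using d by blast
      moreover have "d \<noteq> c" using e ne \<open>e = ?B d\<close> by blast
      then have "d = (\<not> c)" by blast
      ultimately show ?thesis using e by simp
    qed
    then show thesis using quad T by blast
  next
    case False
    have ex: "\<exists>d. mates G ?v (?F c) (?B d)" for c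
    proof -
      obtain e where e: "mates G ?v (?F c) e" using mates_exists[OF G] v by blast
      then obtain d where d: "e = ?F d \<or> e = ?B d" using at by blast
      moreover have "e \<noteq> ?F d"
      proof
        assume h: "e = ?F d"
        then have "d \<noteq> c" using e ne by blast
        then have "d = (\<not> c)" by blast
        then show False using False e h by blast
      qed
      ultimately show ?thesis using e by blast
    qed
    obtain x y where xy: "mates G ?v (?F True) (?B x)" "mates G ?v (?F False) (?B y)" using ex by blast
    have "x \<noteq> y"
    proof
      assume "x = y"
      then have "?F True = ?F False" using un[OF mates_sym[OF xy(1)]] mates_sym[OF xy(2)] by blast
      then show False using F by blast
    qed
    then have "mates G ?v (?B c) (?F (c \<noteq> (\<not> x)))" for c
      using mates_sym[OF xy(1)] mates_sym[OF xy(2)] by (cases x; cases c) auto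
    then show thesis by (rule straight)
  qed
qed

definition straight :: "'a set set set \<Rightarrow> int \<Rightarrow> bool \<Rightarrow> bool \<Rightarrow> bool" where
  "straight G i a b \<longleftrightarrow> (\<exists>s. \<forall>c. mates G (L i a b) (ed L (i - 1) c a b) (ed L i a b (c \<noteq> s)))"

lemma not_straight:
  assumes "G = FA \<or> G = FB" "\<not> straight G i a b"
  shows "mates G (L i a b) (ed L i a b c) (ed L i a b (\<not> c))"
      "mates G (L i a b) (ed L (i - 1) c a b) (ed L (i - 1) (\<not> c) a b)"
  by (rule mates_cases[OF assms(1), of i a b]; use assms(2) in \<open>auto simp: straight_def\<close>)+

lemma straight_not_quad:
  assumes G: "G = FA \<or> G = FB" and s: "straight G i a b" 
  shows "\<not> mates G (L i a b) (ed L i a b c) (ed L i a b d)" "\<not> mates G (L i a b) (ed L (i - 1) c a b) (ed L (i - 1) d a b)"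
proof -
  obtain s where s: "\<And>c. mates G (L i a b) (ed L (i - 1) c a b) (ed L i a b (c \<noteq> s))" using s straight_def by blast
  have x: "((c \<noteq> s) \<noteq> s) = c" by blast
  have "mates G (L i a b) (ed L i a b c) (ed L (i - 1) (c \<noteq> s) a b)"
    using mates_sym[OF s[of "c \<noteq> s"]] unfolding x .
  then show "\<not> mates G (L i a b) (ed L i a b c) (ed L i a b d)"
    using mates_unique[OF G] ed_neq by metis
  show "\<not> mates G (L i a b) (ed L (i - 1) c a b) (ed L (i - 1) d a b)"
    using mates_unique[OF G s[of c]] ed_neq by metis
qed

lemma straight_FA_or_FB: "straight FA i a b \<or> straight FB i a b"
  using not_straight(1)[of FA i a b True] not_straight(1)[of FB i a b True] disj by blast

end

section \<open>Classification for automorphisms preserving the fibres\<close>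

text \<open>The fibres are the sets of four vertices on a common level; they are the blocks of
  imprimitivity behind the classification.\<close>

definition (in labelled_px) fibre_preserving :: "('a \<Rightarrow> 'a) \<Rightarrow> bool" where
  "fibre_preserving \<sigma> \<longleftrightarrow> (\<forall>i a b j c d a' b'. \<sigma> (L i a b) = L j c d \<longrightarrow> (\<exists>c' d'. \<sigma> (L i a' b') = L j c' d'))"

context class_map
begin

text \<open>An automorphism that preserves fibres sends two edges towards one level to two edges
  towards one level. With transitivity on arcs, a family is straight at all vertices or at
  none.\<close>

lemma straight_transfer:
  assumes fib: "\<forall>\<sigma>. map_aut V E F \<sigma> \<longrightarrow> fibre_preserving \<sigma>"
    and G: "G = FA \<or> G = FB" and s: "straight G j c d"
  shows "straight G i a b"
proof (rule ccontr)
  assume "\<not> straight G i a b"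
  then have m: "mates G (L i a b) (ed L i a b True) (ed L i a b False)"
    using not_straight(1)[OF G, of i a b True] by simp
  have "L i a b \<in> ed L i a b True" "L j c d \<in> ed L j c d True" by (simp_all add: ed_mem)
  from A_arc[OF ed_in_E this(1) ed_in_E this(2)]
  obtain \<sigma> where \<sigma>: "map_aut V E F \<sigma>" "\<sigma> (L i a b) = L j c d" by blast
  have g: "graph_automorphism V E \<sigma>" using \<sigma>(1) by (simp add: map_aut_def)
  have e: "\<sigma> ` ed L i a b x = {L j c d, \<sigma> (L (i + 1) b x)}" for x by (simp add: ed_def \<sigma>(2))
  have E: "{L j c d, \<sigma> (L (i + 1) b x)} \<in> E" for x
    using graph_automorphism_edge[OF simple g ed_in_E, of i a b x] unfolding e .
  have m': "mates G (L j c d) {L j c d, \<sigma> (L (i + 1) b True)} {L j c d, \<sigma> (L (i + 1) b False)}"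
    using mates_equi[OF \<sigma>(1) G m] unfolding e \<sigma>(2) .
  obtain y where "\<sigma> (L (i + 1) b True) = L (j + 1) d y \<or> \<sigma> (L (i + 1) b True) = L (j - 1) y c"
    using nbr[OF E[of True]] by blast
  then show False
  proof
    assume y: "\<sigma> (L (i + 1) b True) = L (j + 1) d y"
    obtain x z where xz: "\<sigma> (L (i + 1) b False) = L (j + 1) x z" using fib[rule_format, OF \<sigma>(1)] y unfolding fibre_preserving_def by blast
    then have "d = x" using E[of False] adj_iff by simp
    then have "mates G (L j c d) (ed L j c d y) (ed L j c d z)" using m' y xz by (simp add: ed_def)
    then show False using straight_not_quad(1)[OF G s] by blast
  next
    assume y: "\<sigma> (L (i + 1) b True) = L (j - 1) y c"
    obtain x z where xz: "\<sigma> (L (i + 1) b False) = L (j - 1) z x" using fib[rule_format, OF \<sigma>(1)] y unfolding fibre_preserving_def by blast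
    then have "{L (j - 1) z x, L (j - 1 + 1) c d} \<in> E" using E[of False] by (simp add: insert_commute)
    then have "x = c" unfolding adj_iff .
    then have "mates G (L j c d) (ed L (j - 1) y c d) (ed L (j - 1) z c d)" using m' y xz by (simp add: ed_def insert_commute)
    then show False using straight_not_quad(2)[OF G s] by blast
  qed
qed

lemma straight_normal_form:
  assumes fib: "\<forall>\<sigma>. map_aut V E F \<sigma> \<longrightarrow> fibre_preserving \<sigma>"
    and G: "G = FA \<or> G = FB" and s: "\<And>i a b. straight G i a b"
  shows "\<exists>p \<alpha> u L'. const_px n p V E L' \<and> L' = (\<lambda>i a b. L i (a \<noteq> u i) (b \<noteq> u (i + 1))) \<and> period \<alpha> dvd n \<and>
     G = straight_faces \<alpha> False L' \<and>
     (\<forall>i a b c. mates G (L' i a b) (ed L' (i - 1) c a b) (ed L' i a b (c \<noteq> (\<alpha> \<and> a \<noteq> b))))"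
proof -
  have "\<exists>s. \<forall>i a b c. mates G (L i a b) (ed L (i - 1) c a b) (ed L i a b (c \<noteq> s i a b))"
    using s unfolding straight_def by metis
  then obtain s where s: "\<And>i a b c. mates G (L i a b) (ed L (i - 1) c a b) (ed L i a b (c \<noteq> s i a b))" by blast
  have "straight_pairing n \<tau> V E L (map_aut V E F) (mates G) s"
  proof (intro straight_pairing.intro[OF labelled_px_axioms] straight_pairing_axioms.intro)
    show "mates G (L i a b) (ed L (i - 1) c a b) (ed L i a b d) \<longleftrightarrow> d = (c \<noteq> s i a b)" for i a b c d
    proof
      assume "mates G (L i a b) (ed L (i - 1) c a b) (ed L i a b d)"
      from mates_unique[OF G this s] show "d = (c \<noteq> s i a b)" by (simp add: ed_eq_iff)
    qed (use s in simp)
    show "graph_automorphism V E \<sigma>" if "map_aut V E F \<sigma>" for \<sigma> using that by (simp add: map_aut_def)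
    show "\<exists>c' d'. \<sigma> (L i a' b') = L j c' d'" if "map_aut V E F \<sigma>" "\<sigma> (L i a b) = L j c d" for \<sigma> i a b j c d a' b'
      using fib[rule_format, OF that(1)] that(2) unfolding fibre_preserving_def by blast
  qed (fact A_arc mates_sym mates_equi[OF _ G])+
  from straight_pairing.normal_form[OF this] obtain p \<alpha> u where
    c: "const_px n p V E (\<lambda>i a b. L i (a \<noteq> u i) (b \<noteq> u (i + 1)))" and d: "period \<alpha> dvd n"
    and m: "\<forall>i a b c d. mates G (L i (a \<noteq> u i) (b \<noteq> u (i + 1)))
        (ed (\<lambda>i a b. L i (a \<noteq> u i) (b \<noteq> u (i + 1))) (i - 1) c a b)
        (ed (\<lambda>i a b. L i (a \<noteq> u i) (b \<noteq> u (i + 1))) i a b d) \<longleftrightarrow> d = (c \<noteq> (\<alpha> \<and> a \<noteq> b))"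
    by (elim exE conjE)
  define L' where "L' = (\<lambda>i a b. L i (a \<noteq> u i) (b \<noteq> u (i + 1)))"
  have c': "const_px n p V E L'" using c unfolding L'_def .
  have m': "mates G (L' i a b) (ed L' (i - 1) c a b) (ed L' i a b (c \<noteq> (\<alpha> \<and> a \<noteq> b)))" for i a b c
    using m unfolding L'_def by blast
  have "G = straight_faces \<alpha> False L'"
  proof (rule const_px.family_eq_straight[OF c' _ _ d])
    show "is_cycle E f" if "f \<in> G" for f using that F_cycle F_eq G by blast
    show "\<exists>!f. f \<in> G \<and> e \<in> f" if "e \<in> E" for e using that FA1 FB1 G by blast
    show "mates G (L' i a b) (ed L' (i - 1) c a b) (ed L' i a b ((c \<noteq> (\<alpha> \<and> a \<noteq> b)) \<noteq> False))" for i a b c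
      using m'[of i a b c] by simp
  qed
  then show ?thesis using c' d m' L'_def by blast
qed

lemma classification_quads:
  assumes fib: "\<forall>\<sigma>. map_aut V E F \<sigma> \<longrightarrow> fibre_preserving \<sigma>"
    and s: "\<not> straight FA i0 a0 b0"
  shows "\<exists>p \<alpha> L'. const_px n p V E L' \<and> period \<alpha> dvd n \<and> FA = quads L' \<and> FB = straight_faces \<alpha> False L'"
proof -
  have nA: "\<not> straight FA i a b" for i a b using straight_transfer[OF fib, of FA i a b i0 a0 b0] s by blast
  then have sB: "straight FB i a b" for i a b using straight_FA_or_FB by blast
  have q: "FA = quads L"
  proof (rule family_eq_quads)
    show "is_cycle E f" if "f \<in> FA" for f using that F_cycle F_eq by blast
  qed (fact FA1 not_straight[OF disjI1[OF refl] nA])+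
  from straight_normal_form[OF fib disjI2[OF refl] sB] obtain p \<alpha> u L' where
    h: "const_px n p V E L'" "L' = (\<lambda>i a b. L i (a \<noteq> u i) (b \<noteq> u (i + 1)))" "period \<alpha> dvd n" "FB = straight_faces \<alpha> False L'"
    by blast
  have "quads L' = quads L" unfolding h(2) using quads_gauge[of L 0 u] by (simp only: add_0_right)
  then show ?thesis using h q by blast
qed

text \<open>There are only two straight pairings at a vertex. Once \<open>FA\<close> has been gauged
  to \<beta> = 0, \<open>FB\<close> has to be the other one everywhere, so \<beta> = 1 with the same
  \<alpha> and no further gauging.\<close>

lemma classification_straight:
  assumes fib: "\<forall>\<sigma>. map_aut V E F \<sigma> \<longrightarrow> fibre_preserving \<sigma>"
    and sA: "\<And>i a b. straight FA i a b" and sB: "\<And>i a b. straight FB i a b"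
  shows "\<exists>p \<alpha> L'. const_px n p V E L' \<and> period \<alpha> dvd n \<and> FA = straight_faces \<alpha> False L' \<and> FB = straight_faces \<alpha> True L'"
proof -
  from straight_normal_form[OF fib disjI1[OF refl] sA] obtain p \<alpha> u L' where
    h: "const_px n p V E L'" "L' = (\<lambda>i a b. L i (a \<noteq> u i) (b \<noteq> u (i + 1)))" "period \<alpha> dvd n" "FA = straight_faces \<alpha> False L'"
    "\<forall>i a b c. mates FA (L' i a b) (ed L' (i - 1) c a b) (ed L' i a b (c \<noteq> (\<alpha> \<and> a \<noteq> b)))"
    by (elim exE conjE)
  have ed: "ed L' i a b c = ed L i (a \<noteq> u i) (b \<noteq> u (i + 1)) (c \<noteq> u (i + 2))" for i a b c
    using ed_gauge[of L 0 u i a b c] unfolding h(2) by (simp only: add_0_right)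
  have B: "mates FB (L' i a b) (ed L' (i - 1) c a b) (ed L' i a b ((c \<noteq> (\<alpha> \<and> a \<noteq> b)) \<noteq> True))" for i a b c
  proof -
    obtain s where s: "\<And>c. mates FB (L i (a \<noteq> u i) (b \<noteq> u (i + 1))) (ed L (i - 1) c (a \<noteq> u i) (b \<noteq> u (i + 1)))
        (ed L i (a \<noteq> u i) (b \<noteq> u (i + 1)) (c \<noteq> s))"
      using sB[of i "a \<noteq> u i" "b \<noteq> u (i + 1)"] unfolding straight_def by blast
    define r where "r = ((u (i - 1) \<noteq> s) \<noteq> u (i + 2))"
    have e: "i - 1 + 1 = i" "i - 1 + 2 = i + 1" by simp_all
    have x: "((c \<noteq> u (i - 1)) \<noteq> s) = ((c \<noteq> r) \<noteq> u (i + 2))" unfolding r_def by blast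
    have m: "mates FB (L' i a b) (ed L' (i - 1) c a b) (ed L' i a b (c \<noteq> r))"
      using s[of "c \<noteq> u (i - 1)"] unfolding ed e x unfolding h(2) .
    have "r \<noteq> (\<alpha> \<and> a \<noteq> b)"
    proof
      assume r: "r = (\<alpha> \<and> a \<noteq> b)"
      show False using disj[OF h(5)[rule_format, of i a b c]] m unfolding r by blast
    qed
    then have "(c \<noteq> r) = ((c \<noteq> (\<alpha> \<and> a \<noteq> b)) \<noteq> True)" by blast
    then show ?thesis using m by (simp only:)
  qed
  have "FB = straight_faces \<alpha> True L'"
  proof (rule const_px.family_eq_straight[OF h(1) _ _ h(3)])
    show "is_cycle E f" if "f \<in> FB" for f using that F_cycle F_eq by blast
  qed (fact FB1 B)+
  then show ?thesis using h by blast
qed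

text \<open>The added clauses record that map automorphisms keep the families apart. They later
  discard the shapes whose families some automorphism exchanges.\<close>

lemma classification:
  assumes fib: "\<forall>\<sigma>. map_aut V E F \<sigma> \<longrightarrow> fibre_preserving \<sigma>"
  shows "\<exists>p \<alpha> L'. const_px n p V E L' \<and> period \<alpha> dvd n \<and>
     (F = quads L' \<union> straight_faces \<alpha> False L' \<and>
        (\<forall>\<sigma> f. map_aut V E F \<sigma> \<longrightarrow> f \<in> quads L' \<longrightarrow> face_image \<sigma> f \<notin> straight_faces \<alpha> False L') \<or>
      F = straight_faces \<alpha> False L' \<union> straight_faces \<alpha> True L' \<and>
        (\<forall>\<sigma> f. map_aut V E F \<sigma> \<longrightarrow> f \<in> straight_faces \<alpha> False L' \<longrightarrow> face_image \<sigma> f \<notin> straight_faces \<alpha> True L'))"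
proof -
  have nAB: "face_image \<sigma> f \<notin> FB" if "map_aut V E F \<sigma>" "f \<in> FA" for \<sigma> f
    using A_FA[OF that] FAB by blast
  have nBA: "face_image \<sigma> f \<notin> FA" if "map_aut V E F \<sigma>" "f \<in> FB" for \<sigma> f
    using A_FB[OF that] FAB by blast
  consider (A) i a b where "\<not> straight FA i a b" | (B) i a b where "\<not> straight FB i a b"
    | (AB) "\<And>i a b. straight FA i a b" "\<And>i a b. straight FB i a b" by blast
  then show ?thesis
  proof cases
    case A
    from classification_quads[OF fib A] show ?thesis using nAB F_eq by blast
  next
    case B
    interpret S: class_map n \<tau> V E L F FB FA by (rule swapped)
    have "\<not> S.straight FB i a b" using B unfolding straight_def S.straight_def .
    from S.classification_quads[OF fib this] show ?thesis using nBA F_eq by blast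
  next
    case AB
    from classification_straight[OF fib AB] show ?thesis using nAB F_eq by blast
  qed
qed

end

lemma (in labelled_px) class_map_exists:
  assumes "F \<in> class201_maps V E"
  shows "\<exists>FA FB. class_map n \<tau> V E L F FA FB"
proof -
  have P: "is_polytopal_map V E F" and C: "class_2_01 V E F" using assms by (auto simp: class201_maps_def)
  obtain FA FB where h: "F = FA \<union> FB" "FA \<inter> FB = {}" "\<forall>e\<in>E. \<exists>!f. f \<in> FA \<and> e \<in> f" "\<forall>e\<in>E. \<exists>!f. f \<in> FB \<and> e \<in> f"
     "\<forall>\<sigma>. map_aut V E F \<sigma> \<longrightarrow> (\<forall>f\<in>FA. face_image \<sigma> f \<in> FA) \<and> (\<forall>f\<in>FB. face_image \<sigma> f \<in> FB)"
     "\<forall>v e v' e'. e \<in> E \<longrightarrow> v \<in> e \<longrightarrow> e' \<in> E \<longrightarrow> v' \<in> e' \<longrightarrow> (\<exists>\<sigma>. map_aut V E F \<sigma> \<and> \<sigma> v = v' \<and> \<sigma> ` e = e')"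
    using class_2_01_split[OF P C] by (elim exE conjE)
  have cyc: "is_cycle E f" if "f \<in> F" for f using P that by (simp add: is_polytopal_map_def)
  have "class_map n \<tau> V E L F FA FB"
  proof (intro class_map.intro[OF labelled_px_axioms] class_map_axioms.intro)
    \<comment> \<open>If both families paired \<open>e\<close> with \<open>e'\<close>, the faces
      \<open>f\<close> and \<open>g\<close> would contain no other edge at \<open>v\<close>, and no
      further face could be reached from them across an edge at \<open>v\<close>. A third edge at
      \<open>v\<close> lies on such a further face, against the vertex condition.\<close>
    fix v e e' assume mA: "mates FA v e e'" and mB: "mates FB v e e'"
    obtain f where f: "e \<noteq> e'" "v \<in> e" "v \<in> e'" "f \<in> FA" "e \<in> f" "e' \<in> f" using mA unfolding mates_def by blast
    obtain g where g: "g \<in> FB" "e \<in> g" "e' \<in> g" using mB unfolding mates_def by blast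
    have cf: "is_cycle E f" "is_cycle E g" using cyc h(1) f g by blast+
    have "f \<subseteq> E" using cf(1) unfolding is_cycle_def by (rule conjunct1)
    then have eE: "e \<in> E" "e' \<in> E" using f(5,6) by blast+
    then have "v \<in> V" using f(2) simple_graph_edge_subset[OF simple] by blast
    then obtain i a b where v: "v = L i a b" unfolding V_eq by blast
    have "\<exists>e''\<in>E. v \<in> e'' \<and> e'' \<noteq> e \<and> e'' \<noteq> e'"
    proof -
      let ?S = "{ed L i a b True, ed L i a b False, ed L (i - 1) True a b}"
      have "card ?S = 3" using ed_neq by (simp add: ed_eq_iff)
      moreover have "card {e, e'} \<le> 2" by (simp add: card_insert_if)
      ultimately have "\<not> ?S \<subseteq> {e, e'}" using card_mono[of "{e, e'}" ?S] by auto
      then obtain x where "x \<in> ?S" "x \<notin> {e, e'}" by blast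
      moreover have "x \<in> {e \<in> E. L i a b \<in> e}" unfolding edges_at using \<open>x \<in> ?S\<close> by blast
      ultimately show ?thesis unfolding v by blast
    qed
    then obtain e'' where e'': "e'' \<in> E" "v \<in> e''" "e'' \<noteq> e" "e'' \<noteq> e'" by blast
    obtain k where k: "k \<in> FA" "e'' \<in> k" using ex1_implies_ex[OF bspec[OF h(3) e''(1)]] by (elim exE conjE)
    have "e'' \<notin> f" using is_cycle_unique_mate[OF cf(1) f(5,6) _ f(2,3) e''(2)] f(1) e'' by metis
    moreover have "e'' \<notin> g" using is_cycle_unique_mate[OF cf(2) g(2,3) _ f(2,3) e''(2)] f(1) e'' by metis
    ultimately have kfg: "k \<noteq> f" "k \<noteq> g" using k(2) by blast+
    let ?N = "{f \<in> F. \<exists>e\<in>f. v \<in> e}"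
    have "{f, g} \<subseteq> ?N" using f g h(1) by blast
    moreover have "k \<in> ?N" using k e'' h(1) by blast
    then have "{f, g} \<noteq> ?N" using kfg by blast
    moreover have "\<forall>S. S \<subseteq> ?N \<and> S \<noteq> {} \<and> S \<noteq> ?N \<longrightarrow> (\<exists>f\<in>S. \<exists>g\<in>?N - S. \<exists>e\<in>f. e \<in> g \<and> v \<in> e)"
      using P \<open>v \<in> V\<close> unfolding is_polytopal_map_def by (elim conjE) (drule (1) bspec)
    ultimately have "\<exists>f'\<in>{f, g}. \<exists>g'\<in>?N - {f, g}. \<exists>x\<in>f'. x \<in> g' \<and> v \<in> x" by blast
    then obtain f' g' x where x: "f' \<in> {f, g}" "g' \<in> ?N - {f, g}" "x \<in> f'" "x \<in> g'" "v \<in> x"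
      by (elim bexE conjE)
    have "x = e \<or> x = e'"
      using x(1) is_cycle_unique_mate[OF cf(1) f(5,6) _ f(2,3) x(5)] is_cycle_unique_mate[OF cf(2) g(2,3) _ f(2,3) x(5)] f(1) x(3) by blast
    then have "x \<in> E" "x \<in> f" "x \<in> g" using eE f g by blast+
    then have "g' = f \<or> g' = g" using h(1,3,4) x(2,4) f(4) g(1) by blast
    then show False using x(2) by blast
  next
    show "\<exists>!f. f \<in> FA \<and> e \<in> f" if "e \<in> E" for e using h(3) that by (rule bspec)
    show "\<exists>!f. f \<in> FB \<and> e \<in> f" if "e \<in> E" for e using h(4) that by (rule bspec)
    show "face_image \<sigma> f \<in> FA" if "map_aut V E F \<sigma>" "f \<in> FA" for \<sigma> f
      using h(5)[rule_format, OF that(1)] that(2) by (elim conjE) (rule bspec)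
    show "face_image \<sigma> f \<in> FB" if "map_aut V E F \<sigma>" "f \<in> FB" for \<sigma> f
      using h(5)[rule_format, OF that(1)] that(2) by (elim conjE) (rule bspec)
    show "\<exists>\<sigma>. map_aut V E F \<sigma> \<and> \<sigma> v = v' \<and> \<sigma> ` e = e'"
      if "e \<in> E" "v \<in> e" "e' \<in> E" "v' \<in> e'" for e v e' v'
      using h(6)[rule_format, OF that] .
  qed (fact h(1,2) cyc)+
  then show ?thesis by blast
qed

text \<open>A vertex two levels up or down has only one common neighbour with \<open>L i a b\<close>
  on that side, because its bits determine the middle vertex. It could be reached on both sides only
  if \<open>i + 2\<close> and \<open>i - 2\<close> were the same level, that is, if \<open>n\<close>
  divided 4.\<close>

lemma (in labelled_px) common_neighbours:
  assumes n4: "n \<noteq> 4" and w: "w \<noteq> L i a b" and x: "x \<noteq> x'"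
    and e: "{L i a b, x} \<in> E" "{L i a b, x'} \<in> E" "{w, x} \<in> E" "{w, x'} \<in> E"
  shows "\<exists>a' b'. w = L i a' b'"
proof (rule ccontr)
  assume no: "\<not> ?thesis"
  have far: "(\<exists>c d. x = L (i + 1) b c \<and> w = L (i + 2) c d) \<or> (\<exists>c d. x = L (i - 1) c a \<and> w = L (i - 2) d c)"
    if lx: "{L i a b, x} \<in> E" and wx: "{w, x} \<in> E" for x
  proof -
    obtain c where "x = L (i + 1) b c \<or> x = L (i - 1) c a" using nbr[OF lx] by blast
    then show ?thesis
    proof
      assume xx: "x = L (i + 1) b c"
      then have "{L (i + 1) b c, w} \<in> E" using wx by (simp add: insert_commute)
      from nbr[OF this] show ?thesis using no xx by (auto simp: add.assoc)
    next
      assume xx: "x = L (i - 1) c a"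
      then have "{L (i - 1) c a, w} \<in> E" using wx by (simp add: insert_commute)
      from nbr[OF this] show ?thesis using no xx by auto
    qed
  qed
  have opp: "L (i + 2) c d \<noteq> L (i - 2) c' d'" for c d c' d'
  proof
    assume "L (i + 2) c d = L (i - 2) c' d'"
    then have "int n dvd 4" using lev by fastforce
    then have "n dvd 4" by (metis of_nat_dvd_iff of_nat_numeral)
    then have "n \<le> 4" by (rule dvd_imp_le) simp
    then have "n = 3" using n3 n4 by simp
    then show False using \<open>n dvd 4\<close> by presburger
  qed
  from far[OF e(1,3)] far[OF e(2,4)] show False using x
    by (elim disjE exE conjE) (simp_all add: L_eq_iff opp opp[symmetric])
qed

lemma (in labelled_px) automorphism_preserves_fibres:
  assumes n4: "n \<noteq> 4" and g: "graph_automorphism V E \<sigma>"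
  shows "fibre_preserving \<sigma>"
  unfolding fibre_preserving_def
proof (intro allI impI)
  fix i j :: int and a b c d a' b' :: bool assume s: "\<sigma> (L i a b) = L j c d"
  interpret M: labelled_px n \<tau> V E "\<lambda>i a b. \<sigma> (L i a b)" by (rule image_labelled[OF g])
  have E: "{\<sigma> (L i a b), \<sigma> (L (i + 1) b x)} \<in> E" "{\<sigma> (L i a b), \<sigma> (L (i - 1) x a)} \<in> E" for i a b x
    using M.ed_in_E[of i a b x] M.ed_in_E[of "i - 1" x a b] unfolding ed_def by (simp_all add: insert_commute)
  have 1: "\<exists>c' d'. \<sigma> (L i (\<not> a) b) = L j c' d'" if "\<sigma> (L i a b) = L j c d" for a b c d
    by (rule common_neighbours[OF n4 _ _ E(1)[of i a b True, unfolded that] E(1)[of i a b False, unfolded that] E(1) E(1)])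
      (simp_all add: that[symmetric] M.L_eq_iff)
  have 2: "\<exists>c' d'. \<sigma> (L i a (\<not> b)) = L j c' d'" if "\<sigma> (L i a b) = L j c d" for a b c d
    by (rule common_neighbours[OF n4 _ _ E(2)[of i a b True, unfolded that] E(2)[of i a b False, unfolded that] E(2) E(2)])
      (simp_all add: that[symmetric] M.L_eq_iff)
  obtain c' d' where "\<sigma> (L i a' b) = L j c' d'" using 1[OF s] s by (cases "a' = a") auto
  then show "\<exists>c' d'. \<sigma> (L i a' b') = L j c' d'" using 2[of a' b c' d'] by (cases "b' = b") auto
qed

section \<open>The 4-cube\<close>

lemma (in labelled_px) same_fibre:
  assumes "L i a b = L j c d"
  shows "\<exists>c' d'. L j x y = L i c' d'"
proof -
  obtain z where z: "\<forall>k a b. L (k + (j - i)) a b = L k (a \<noteq> z k) (b \<noteq> z (k + 1))" using assms by (rule L_eqE)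
  show ?thesis using z[rule_format, of i x y] by auto
qed

text \<open>Non-adjacent vertices of a quad lie on one level, and an automorphism preserving the
  quads keeps this relation. The two quads at a vertex allow its bits to be changed one at a
  time.\<close>

lemma (in labelled_px) fibre_preserving_if_quads:
  assumes g: "graph_automorphism V E \<sigma>" and q: "face_image \<sigma> ` quads L = quads L"
  shows "fibre_preserving \<sigma>"
proof -
  interpret M: labelled_px n \<tau> V E "\<lambda>i a b. \<sigma> (L i a b)" by (rule image_labelled[OF g])
  have nadj': "{\<sigma> (L i a b), \<sigma> (L i c d)} \<notin> E" for i a b c d
    using M.nbr[of i a b "\<sigma> (L i c d)"] M.L_neq by metis
  have side: "(\<exists>c d c' d'. v = L (j - 1) c d \<and> w = L (j - 1) c' d') \<or> (\<exists>c d c' d'. v = L j c d \<and> w = L j c' d')"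
    if v: "v \<in> \<Union>(quad L j b)" and w: "w \<in> \<Union>(quad L j b)" and vw: "{v, w} \<notin> E" for v w j b
  proof -
    have "(\<exists>x. u = L (j - 1) x b) \<or> (\<exists>x. u = L j b x)" if "u \<in> \<Union>(quad L j b)" for u
      using that unfolding quad_def ed_def by auto
    from this[OF v] this[OF w] show ?thesis
    proof (elim disjE exE)
      fix x y assume "v = L (j - 1) x b" "w = L j b y"
      then show ?thesis using vw ed_in_E[of "j - 1" x b y] by (simp add: ed_def)
    next
      fix x y assume "v = L j b x" "w = L (j - 1) y b"
      then show ?thesis using vw ed_in_E[of "j - 1" y b x] by (simp add: ed_def insert_commute)
    qed blast+
  qed
  have key: "\<exists>c' d'. \<sigma> (L i a' b') = L j c' d'"
    if q: "L i a b \<in> \<Union>(quad L k z)" "L i a' b' \<in> \<Union>(quad L k z)" and s: "\<sigma> (L i a b) = L j c d" for i a b a' b' k z j c d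
  proof -
    have "face_image \<sigma> (quad L k z) \<in> quads L" using q(1) assms(2) quad_in_quads by blast
    then obtain k' z' where k: "face_image \<sigma> (quad L k z) = quad L k' z'" unfolding quads_def by blast
    have "\<sigma> (L i a b) \<in> \<Union>(quad L k' z')" "\<sigma> (L i a' b') \<in> \<Union>(quad L k' z')"
      unfolding k[symmetric] face_image_def using q by blast+
    from side[OF this nadj'] show ?thesis unfolding s using same_fibre by metis
  qed
  have in1: "L i a b \<in> \<Union>(quad L (i + 1) b)" for i a b using ed_in_quad[of L i a b True] ed_mem(1)[of i a b a b True] by blast
  have in2: "L i a b \<in> \<Union>(quad L i a)" for i a b using ed_in_quad[of L "i - 1" True a b] ed_mem(2)[of i a b True a b] by simp blast
  show ?thesis unfolding fibre_preserving_def
  proof (intro allI impI)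
    fix i j a b c d a' b' assume s: "\<sigma> (L i a b) = L j c d"
    obtain c1 d1 where "\<sigma> (L i a' b) = L j c1 d1" using key[OF in1[of i a b] in1[of i a' b] s] by blast
    from key[OF in2[of i a' b] in2[of i a' b'] this] show "\<exists>c' d'. \<sigma> (L i a' b') = L j c' d'" .
  qed
qed

section \<open>Squares of the 4-cube and their three families\<close>

definition square :: "'a set set \<Rightarrow> bool" where
  "square f \<longleftrightarrow> (\<exists>v w x y. v \<noteq> w \<and> x \<noteq> y \<and> {v, w} \<inter> {x, y} = {} \<and> f = {{v, x}, {v, y}, {w, x}, {w, y}})"

lemma square_at:
  assumes "square f" "e \<in> f" "e' \<in> f" "e \<noteq> e'" "v \<in> e" "v \<in> e'"
  shows "\<exists>w x y. v \<noteq> w \<and> x \<noteq> y \<and> e = {v, x} \<and> e' = {v, y} \<and> f = {{v, x}, {v, y}, {w, x}, {w, y}}"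
proof -
  obtain p q r s where h: "p \<noteq> q" "r \<noteq> s" "{p, q} \<inter> {r, s} = {}" and f: "f = {{p, r}, {p, s}, {q, r}, {q, s}}"
    using assms(1) unfolding square_def by (elim exE conjE)
  have fs: "f = {{p, s}, {p, r}, {q, s}, {q, r}}" "f = {{q, r}, {q, s}, {p, r}, {p, s}}" "f = {{q, s}, {q, r}, {p, s}, {p, r}}"
    "f = {{r, p}, {r, q}, {s, p}, {s, q}}" "f = {{r, q}, {r, p}, {s, q}, {s, p}}" "f = {{s, p}, {s, q}, {r, p}, {r, q}}" "f = {{s, q}, {s, p}, {r, q}, {r, p}}"
    unfolding f by (auto simp: insert_commute)
  have "v \<in> {p, q, r, s}" using assms(2,5) unfolding f by auto
  moreover have "e = {v, x} \<or> e = {v, y}" if "v \<notin> {x, y}" "v \<noteq> w" "f = {{v, x}, {v, y}, {w, x}, {w, y}}" "v \<in> e" "e \<in> f" for v w x y e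
    using that by auto
  ultimately consider (p) "v = p" "e = {p, r} \<or> e = {p, s}" "e' = {p, r} \<or> e' = {p, s}"
    | (q) "v = q" "e = {q, r} \<or> e = {q, s}" "e' = {q, r} \<or> e' = {q, s}"
    | (r) "v = r" "e = {r, p} \<or> e = {r, q}" "e' = {r, p} \<or> e' = {r, q}"
    | (s) "v = s" "e = {s, p} \<or> e = {s, q}" "e' = {s, p} \<or> e' = {s, q}"
    using assms(2,3,5,6) h f fs unfolding insert_iff empty_iff by (smt (verit, best) disjoint_iff insert_iff)
  then show ?thesis
  proof cases
    case p then show ?thesis using h assms(4) f fs(1) by metis
  next
    case q then show ?thesis using h assms(4) fs(2,3) by metis
  next
    case r then show ?thesis using h assms(4) fs(4,5) by metis
  next
    case s then show ?thesis using h assms(4) fs(6,7) by metis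
  qed
qed

text \<open>The twist of a labelling can be chosen freely by \<open>const_px_retwist\<close>; here
  it is zero, so that levels are plain residues modulo 4.\<close>

locale q4 = const_px "4 :: nat" False V E L
  for V :: "'a set" and E :: "'a set set" and L :: "int \<Rightarrow> bool \<Rightarrow> bool \<Rightarrow> 'a"
begin

lemma L_add4: "L (i + 4) a b = L i a b" "L (i + 2) a b = L (i - 2) a b" "L (i + 3) a b = L (i - 1) a b"
  using twist[of i a b] twist[of "i - 2" a b] twist[of "i - 1" a b] by (simp_all add: add.commute)

text \<open>The neighbours \<open>x\<close> and \<open>y\<close> may lie both above, both below, or
  on either side of level \<open>i\<close>. In the mixed case \<open>w\<close> lies two levels away,
  where \<open>L (i + 2)\<close> and \<open>L (i - 2)\<close> agree; this case yields the squares
  that are not quads.\<close>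

lemma opposite:
  assumes "{L i a b, x} \<in> E" "{L i a b, y} \<in> E" "x \<noteq> y" "{w, x} \<in> E" "{w, y} \<in> E" "w \<noteq> L i a b"
  shows "(\<exists>c. {x, y} = {L (i + 1) b c, L (i + 1) b (\<not> c)} \<and> w = L i (\<not> a) b) \<or>
     (\<exists>c. {x, y} = {L (i - 1) c a, L (i - 1) (\<not> c) a} \<and> w = L i a (\<not> b)) \<or>
     (\<exists>c d. {x, y} = {L (i + 1) b c, L (i - 1) d a} \<and> w = L (i + 2) c d)"
proof -
  have fwd: "w = L (i + 2) c d \<or> w = L i d b" if "w = L (i + 1 + 1) c d \<or> w = L (i + 1 - 1) d b" for c d
    using that by (simp add: add.assoc)
  have F: "\<exists>d. w = L (i + 2) c d \<or> w = L i d b" if "{w, L (i + 1) b c} \<in> E" for c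
  proof -
    have "{L (i + 1) b c, w} \<in> E" using that by (simp add: insert_commute)
    from nbr[OF this] obtain d where "w = L (i + 1 + 1) c d \<or> w = L (i + 1 - 1) d b" ..
    then show ?thesis using fwd by blast
  qed
  have B: "\<exists>c. w = L (i + 2) c d \<or> w = L i a c" if "{w, L (i - 1) d a} \<in> E" for d
  proof -
    have "{L (i - 1) d a, w} \<in> E" using that by (simp add: insert_commute)
    from nbr[OF this] obtain c where "w = L (i - 1 + 1) a c \<or> w = L (i - 1 - 1) c d" ..
    moreover have "L (i - 1 - 1) c d = L (i + 2) c d" "L (i - 1 + 1) a c = L i a c" using L_add4(2)[of i c d] by simp_all
    ultimately show ?thesis by metis
  qed
  have ne: "L (i + 2) p q \<noteq> L i r s" for p q r s by (rule L_neq)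
  obtain c where c: "x = L (i + 1) b c \<or> x = L (i - 1) c a" using nbr[OF assms(1)] by blast
  obtain d where d: "y = L (i + 1) b d \<or> y = L (i - 1) d a" using nbr[OF assms(2)] by blast
  have mixed: "w = L (i + 2) c d" if "{w, L (i + 1) b c} \<in> E" "{w, L (i - 1) d a} \<in> E" for c d
  proof -
    obtain p q where "w = L (i + 2) c p \<or> w = L i p b" "w = L (i + 2) q d \<or> w = L i a q"
      using F[OF \<open>{w, L (i + 1) b c} \<in> E\<close>] B[OF \<open>{w, L (i - 1) d a} \<in> E\<close>] by blast
    then show ?thesis using assms(6) by (elim disjE) (auto simp: L_eq_iff ne ne[symmetric])
  qed
  show ?thesis
  proof -
    consider (1) "x = L (i + 1) b c" "y = L (i + 1) b d" | (2) "x = L (i - 1) c a" "y = L (i - 1) d a"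
      | (3) "x = L (i + 1) b c" "y = L (i - 1) d a" | (4) "x = L (i - 1) c a" "y = L (i + 1) b d" using c d by blast
    then show ?thesis
    proof cases
      case 1
      then have cd: "d = (\<not> c)" using assms(3) by (auto simp: L_eq_iff)
      obtain p q where "w = L (i + 2) c p \<or> w = L i p b" "w = L (i + 2) d q \<or> w = L i q b"
        using F[of c] F[of d] assms(4,5) 1 by blast
      then have "w = L i p b" using ne inj cd by metis
      moreover from this have "p = (\<not> a)" using assms(6) by (auto simp: L_eq_iff)
      ultimately show ?thesis using 1 cd by blast
    next
      case 2
      then have cd: "d = (\<not> c)" using assms(3) by (auto simp: L_eq_iff)
      obtain p q where "w = L (i + 2) p c \<or> w = L i a p" "w = L (i + 2) q d \<or> w = L i a q"
        using B[of c] B[of d] assms(4,5) 2 by blast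
      then have "w = L i a p" using ne inj cd by metis
      moreover from this have "p = (\<not> b)" using assms(6) by (auto simp: L_eq_iff)
      ultimately show ?thesis using 2 cd by blast
    next
      case 3
      then show ?thesis using mixed[of c d] assms(4,5) by blast
    next
      case 4
      then show ?thesis using mixed[of d c] assms(4,5) by blast
    qed
  qed
qed

lemma opposite_unique:
  assumes "v \<in> V" "{v, x} \<in> E" "{v, y} \<in> E" "x \<noteq> y" "{w, x} \<in> E" "{w, y} \<in> E" "w \<noteq> v" "{w', x} \<in> E" "{w', y} \<in> E" "w' \<noteq> v"
  shows "w = w'"
proof -
  obtain i a b where v: "v = L i a b" using assms(1) unfolding V_eq by blast
  have l: "L (i + 1) p q \<noteq> L (i - 1) r s" for p q r s by (rule L_neq)
  show ?thesis
    using opposite[OF assms(2,3)[unfolded v] assms(4-7)[unfolded v]] opposite[OF assms(2,3)[unfolded v] assms(4) assms(8-10)[unfolded v]]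
    by (elim disjE exE conjE) (simp_all add: doubleton_eq_iff L_eq_iff l l[symmetric])
qed

lemma square_eq:
  assumes "square f" "square g" "f \<subseteq> E" "g \<subseteq> E" "e \<in> f" "e' \<in> f" "e \<in> g" "e' \<in> g" "e \<noteq> e'" "v \<in> e" "v \<in> e'"
  shows "f = g"
proof -
  obtain w x y where f: "v \<noteq> w" "x \<noteq> y" "e = {v, x}" "e' = {v, y}" "f = {{v, x}, {v, y}, {w, x}, {w, y}}"
    using square_at[OF assms(1,5,6,9,10,11)] by (elim exE conjE)
  obtain w' x' y' where g: "v \<noteq> w'" "x' \<noteq> y'" "e = {v, x'}" "e' = {v, y'}" "g = {{v, x'}, {v, y'}, {w', x'}, {w', y'}}"
    using square_at[OF assms(2,7,8,9,10,11)] by (elim exE conjE)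
  have xy: "x' = x" "y' = y" using f(3,4) g(3,4) by (auto simp: doubleton_eq_iff)
  have "v \<in> V" using simple_graph_edge_subset[OF simple] assms(3,5,10) by blast
  then have "w = w'" using opposite_unique[of v x y w w'] f g assms(3,4) unfolding xy by blast
  then show ?thesis using f(5) g(5) xy by simp
qed

text \<open>The 24 squares of the 4-cube, sorted by the three ways to split the four edge directions
  into two pairs; each family has 8 squares.\<close>

definition families :: "'a set set set set" where
  "families = {quads L, straight_faces True False L, straight_faces True True L}"

lemma quads_square: "f \<in> quads L \<Longrightarrow> square f"
proof -
  assume "f \<in> quads L"
  then obtain j b where f: "f = quad L j b" unfolding quads_def by blast
  have "f = {{L (j - 1) True b, L j b True}, {L (j - 1) True b, L j b False}, {L (j - 1) False b, L j b True}, {L (j - 1) False b, L j b False}}"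
    unfolding f quad_def ed_def by (auto simp: ex_bool_eq)
  moreover have "{L (j - 1) True b, L (j - 1) False b} \<inter> {L j b True, L j b False} = {}" using L_neq(3,4) by auto
  moreover have "L (j - 1) True b \<noteq> L (j - 1) False b" "L j b True \<noteq> L j b False" by (simp_all add: L_eq_iff)
  ultimately show "square f" unfolding square_def
    by (intro exI[of _ "L (j - 1) True b"] exI[of _ "L (j - 1) False b"] exI[of _ "L j b True"] exI[of _ "L j b False"] conjI)
qed

lemma straight_square: "f \<in> straight_faces True \<beta> L \<Longrightarrow> square f"
proof -
  assume "f \<in> straight_faces True \<beta> L"
  then obtain c where c: "sol True \<beta> c" "f = face L c" unfolding straight_faces_def by blast
  have c4: "c (i + 4) = c i" for i using sol_shift[OF c(1), of 4 i] by (simp add: period_def)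
  have e4: "ed L (i + 4) p q r = ed L i p q r" for i p q r
    using L_add4(1)[of i p q] L_add4(1)[of "i + 1" q r] by (simp add: ed_def add_ac)
  define g where "g i = ed L i (c i) (c (i + 1)) (c (i + 2))" for i
  have g4: "g (i + 4) = g i" for i
    using c4[of i] c4[of "i + 1"] c4[of "i + 2"] unfolding g_def e4 by (simp add: add_ac)
  have gm: "g (i + m * 4) = g i" for i m
  proof (induction m rule: int_induct[of _ 0])
    case (step1 m) then show ?case using g4[of "i + m * 4"] by (simp add: algebra_simps)
  next
    case (step2 m) then show ?case using g4[of "i + (m - 1) * 4"] by (simp add: algebra_simps)
  qed simp
  have "g i \<in> {g 0, g 3, g 1, g 2}" for i
  proof -
    obtain r where r: "i mod 4 = r" by blast
    have "i mod 4 = 0 \<or> i mod 4 = 1 \<or> i mod 4 = 2 \<or> i mod 4 = 3" by presburger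
    moreover have "g i = g r" using gm[of "i mod 4" "i div 4"] unfolding mod_div_mult_eq unfolding r .
    ultimately show ?thesis unfolding r by auto
  qed
  then have "f = {g 0, g 3, g 1, g 2}" unfolding c(2) face_def g_def by blast
  moreover have "g 0 = {L 0 (c 0) (c 1), L 1 (c 1) (c 2)}" "g 1 = {L 2 (c 2) (c 3), L 1 (c 1) (c 2)}"
    "g 2 = {L 2 (c 2) (c 3), L 3 (c 3) (c 0)}" "g 3 = {L 0 (c 0) (c 1), L 3 (c 3) (c 0)}"
    using L_add4(1)[of 0] c4[of 0] c4[of 1] by (auto simp: g_def ed_def)
  moreover have "L 0 p q \<noteq> L 2 r s" "L 1 p q \<noteq> L 3 r s" "L 0 p q \<noteq> L 1 r s" "L 0 p q \<noteq> L 3 r s" "L 2 p q \<noteq> L 1 r s" "L 2 p q \<noteq> L 3 r s" for p q r s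
    using lev[of 0 p q 2 r s] lev[of 1 p q 3 r s] lev[of 0 p q 1 r s] lev[of 0 p q 3 r s] lev[of 2 p q 1 r s] lev[of 2 p q 3 r s] by auto
  ultimately show "square f" unfolding square_def
    by (intro exI[of _ "L 0 (c 0) (c 1)"] exI[of _ "L 2 (c 2) (c 3)"] exI[of _ "L 1 (c 1) (c 2)"] exI[of _ "L 3 (c 3) (c 0)"]) auto
qed

lemma period4: "period True dvd 4" by (simp add: period_def)

lemma families_square: "G \<in> families \<Longrightarrow> f \<in> G \<Longrightarrow> square f"
  unfolding families_def using quads_square straight_square by blast

lemma families_cycle: "G \<in> families \<Longrightarrow> f \<in> G \<Longrightarrow> is_cycle E f"
  unfolding families_def using quad_cycle(1) straight_face_cycle(1)[OF _ period4] unfolding quads_def by blast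

lemma families_E: "G \<in> families \<Longrightarrow> f \<in> G \<Longrightarrow> f \<subseteq> E"
  using families_cycle unfolding is_cycle_def by blast

lemma families_ex1:
  assumes "G \<in> families" "e \<in> E"
  shows "\<exists>!f. f \<in> G \<and> e \<in> f"
proof -
  have "G = quads L \<or> (\<exists>\<beta>. G = straight_faces True \<beta> L)" using assms(1) unfolding families_def by blast
  then show ?thesis
  proof (elim disjE exE)
    assume "G = quads L" then show ?thesis using quad_ex1[OF assms(2)] by (simp only:)
  next
    fix \<beta> assume "G = straight_faces True \<beta> L"
    then show ?thesis using straight_ex1[OF period4 assms(2), of \<beta>] by (simp only:)
  qed
qed

lemma family_mates:
  "mates (quads L) (L i a b) (ed L i a b c) (ed L i a b (\<not> c))"
  "mates (quads L) (L i a b) (ed L (i - 1) c a b) (ed L (i - 1) (\<not> c) a b)"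
  "mates (straight_faces True \<beta> L) (L i a b) (ed L (i - 1) c a b) (ed L i a b ((c \<noteq> (a \<noteq> b)) \<noteq> \<beta>))"
proof -
  show "mates (quads L) (L i a b) (ed L i a b c) (ed L i a b (\<not> c))"
    unfolding mates_def using ed_in_quad[of L i a b] quad_in_quads[of L "i + 1" b] by (auto simp: ed_eq_iff ed_mem)
  show "mates (quads L) (L i a b) (ed L (i - 1) c a b) (ed L (i - 1) (\<not> c) a b)"
    unfolding mates_def using ed_in_quad[of L "i - 1" _ a b] quad_in_quads[of L i a] by (auto simp: ed_eq_iff ed_mem)
  show "mates (straight_faces True \<beta> L) (L i a b) (ed L (i - 1) c a b) (ed L i a b ((c \<noteq> (a \<noteq> b)) \<noteq> \<beta>))"
    unfolding mates_def using straight_pair[of True \<beta> i c a b] ed_neq by (auto simp: ed_mem)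
qed

lemma families_mates_exists:
  assumes "e \<in> E" "e' \<in> E" "e \<noteq> e'" "v \<in> e" "v \<in> e'"
  shows "\<exists>G\<in>families. mates G v e e'"
proof -
  obtain i a b where v: "v = L i a b" using assms(1,4) simple_graph_edge_subset[OF simple] unfolding V_eq by blast
  obtain c where c: "e = ed L i a b c \<or> e = ed L (i - 1) c a b" using edge_at assms(1,4) unfolding v by blast
  obtain d where d: "e' = ed L i a b d \<or> e' = ed L (i - 1) d a b" using edge_at assms(2,5) unfolding v by blast
  have st: "\<exists>G\<in>families. mates G v (ed L (i - 1) c a b) (ed L i a b d)" for c d
  proof -
    \<comment> \<open>A lower and an upper edge are paired by exactly one of the two straight
      families, and this equation selects it.\<close>
    define \<beta> where "\<beta> = ((c \<noteq> (a \<noteq> b)) \<noteq> d)"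
    have "((c \<noteq> (a \<noteq> b)) \<noteq> \<beta>) = d" unfolding \<beta>_def by blast
    then have "mates (straight_faces True \<beta> L) v (ed L (i - 1) c a b) (ed L i a b d)"
      using family_mates(3)[of \<beta> i a b c] unfolding v by simp
    moreover have "straight_faces True \<beta> L \<in> families" unfolding families_def by (cases \<beta>) simp_all
    ultimately show ?thesis by blast
  qed
  have q: "quads L \<in> families" unfolding families_def by simp
  consider (1) "e = ed L i a b c" "e' = ed L i a b d" | (2) "e = ed L (i - 1) c a b" "e' = ed L (i - 1) d a b"
    | (3) "e = ed L i a b c" "e' = ed L (i - 1) d a b" | (4) "e = ed L (i - 1) c a b" "e' = ed L i a b d" using c d by blast
  then show ?thesis
  proof cases
    case 1
    then have "d = (\<not> c)" using assms(3) ed_eq_iff[of i a b c a b d] by simp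
    then show ?thesis using family_mates(1)[of i a b c] q 1 v by blast
  next
    case 2
    then have "d = (\<not> c)" using assms(3) ed_eq_iff[of "i - 1" c a b d a b] by simp
    then show ?thesis using family_mates(2)[of i a b c] q 2 v by blast
  next
    case 3
    obtain G where "G \<in> families" "mates G v (ed L (i - 1) d a b) (ed L i a b c)" using st by blast
    then show ?thesis unfolding 3 by (intro bexI[of _ G]) (rule mates_sym)
  next
    case 4
    then show ?thesis using st by blast
  qed
qed

lemma family_mates_unique:
  assumes "G \<in> families" "mates G v e e'" "mates G v e e''"
  shows "e' = e''"
proof -
  obtain f where f: "e \<noteq> e'" "v \<in> e" "v \<in> e'" "f \<in> G" "e \<in> f" "e' \<in> f" using assms(2) unfolding mates_def by blast
  obtain g where g: "e \<noteq> e''" "v \<in> e''" "g \<in> G" "e \<in> g" "e'' \<in> g" using assms(3) unfolding mates_def by blast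
  have "e \<in> E" using families_E[OF assms(1) f(4)] f(5) by blast
  then have "f = g" using families_ex1[OF assms(1)] f g by blast
  then show ?thesis using is_cycle_unique_mate[OF families_cycle[OF assms(1) f(4)] f(5,6), of e'' v] f g by blast
qed

lemma families_disjoint:
  assumes "G \<in> families" "H \<in> families" "mates G v e e'" "mates H v e e'"
  shows "G = H"
proof -
  have "e \<in> E" "v \<in> e" using assms(1,3) families_E unfolding mates_def by blast+
  then obtain i a b where v: "v = L i a b" using simple_graph_edge_subset[OF simple] unfolding V_eq by blast
  obtain c where c: "e = ed L i a b c \<or> e = ed L (i - 1) c a b" using edge_at \<open>e \<in> E\<close> \<open>v \<in> e\<close> unfolding v by blast
  have un: "e' = x" if "K = G \<or> K = H" "mates K v e x" for K x using that family_mates_unique assms by blast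
  show ?thesis using c
  proof
    assume e: "e = ed L i a b c"
    have 1: "mates (quads L) v e (ed L i a b (\<not> c))" using family_mates(1) unfolding v e .
    have 2: "mates (straight_faces True \<beta> L) v e (ed L (i - 1) ((c \<noteq> (a \<noteq> b)) \<noteq> \<beta>) a b)" for \<beta>
    proof -
      have "((((c \<noteq> (a \<noteq> b)) \<noteq> \<beta>) \<noteq> (a \<noteq> b)) \<noteq> \<beta>) = c" by blast
      then show ?thesis using mates_sym[OF family_mates(3)[of \<beta> i a b "(c \<noteq> (a \<noteq> b)) \<noteq> \<beta>"]] unfolding v e by simp
    qed
    have "ed L (i - 1) ((c \<noteq> (a \<noteq> b)) \<noteq> False) a b \<noteq> ed L (i - 1) ((c \<noteq> (a \<noteq> b)) \<noteq> True) a b"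
      "ed L i a b (\<not> c) \<noteq> ed L (i - 1) ((c \<noteq> (a \<noteq> b)) \<noteq> \<beta>) a b" for \<beta> using ed_neq by (auto simp: ed_eq_iff)
    then show ?thesis using un[OF _ 1] un[OF _ 2[of True]] un[OF _ 2[of False]] assms(1,2) unfolding families_def by blast
  next
    assume e: "e = ed L (i - 1) c a b"
    have 1: "mates (quads L) v e (ed L (i - 1) (\<not> c) a b)" using family_mates(2) unfolding v e .
    have 2: "mates (straight_faces True \<beta> L) v e (ed L i a b ((c \<noteq> (a \<noteq> b)) \<noteq> \<beta>))" for \<beta>
      using family_mates(3) unfolding v e .
    have "ed L i a b ((c \<noteq> (a \<noteq> b)) \<noteq> False) \<noteq> ed L i a b ((c \<noteq> (a \<noteq> b)) \<noteq> True)"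
      "ed L (i - 1) (\<not> c) a b \<noteq> ed L i a b ((c \<noteq> (a \<noteq> b)) \<noteq> \<beta>)" for \<beta> using ed_neq by (auto simp: ed_eq_iff)
    then show ?thesis using un[OF _ 1] un[OF _ 2[of True]] un[OF _ 2[of False]] assms(1,2) unfolding families_def by blast
  qed
qed

lemma square_in_families:
  assumes "square f" "f \<subseteq> E"
  shows "\<exists>G\<in>families. f \<in> G"
proof -
  obtain v w x y where f: "x \<noteq> y" "{v, w} \<inter> {x, y} = {}" "f = {{v, x}, {v, y}, {w, x}, {w, y}}"
    using assms(1) unfolding square_def by blast
  let ?e = "{v, x}" and ?e' = "{v, y}"
  have e: "?e \<in> f" "?e' \<in> f" "?e \<noteq> ?e'" using f by (auto simp: doubleton_eq_iff)
  then obtain G where G: "G \<in> families" "mates G v ?e ?e'" using families_mates_exists[of ?e ?e' v] assms(2) by blast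
  then obtain g where g: "g \<in> G" "?e \<in> g" "?e' \<in> g" unfolding mates_def by blast
  have "f = g" using square_eq[OF assms(1) families_square[OF G(1) g(1)] assms(2) families_E[OF G(1) g(1)] e(1,2) g(2,3) e(3), of v] by simp
  then show ?thesis using G g by blast
qed

text \<open>Once a family contains a quad of \<open>M\<close>, it has used both lower edges at each
  upper vertex of this quad, so it pairs the upper edges there and contains the next quads. Both
  systems cover every edge once, so the inclusion is an equality.\<close>

lemma quads_in_families:
  assumes M: "q4 V E M"
  shows "quads M \<in> families"
proof -
  interpret M: q4 V E M by fact
  have sq: "square f \<and> f \<subseteq> E" if "f \<in> quads M" for f
    using M.quads_square[OF that] M.families_E[OF _ that] unfolding M.families_def by blast
  obtain G where G: "G \<in> families" "quad M 0 False \<in> G" using square_in_families sq quad_in_quads by blast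
  have step: "quad M (j + 1) b' \<in> G" if f: "quad M j b \<in> G" for j b b'
  proof -
    let ?v = "M j b b'" and ?e = "ed M j b b' True"
    obtain g where g: "g \<in> G" "?e \<in> g" using ex1_implies_ex[OF families_ex1[OF G(1) M.ed_in_E]] by blast
    have v: "?v \<in> ?e" by (simp add: M.ed_mem)
    obtain e' where e': "e' \<in> g" "?v \<in> e'" "e' \<noteq> ?e"
      using ex1_implies_ex[OF is_cycle_mates[OF families_cycle[OF G(1) g(1)] g(2) v]] by blast
    have "e' \<in> E" using families_E[OF G(1) g(1)] e'(1) by blast
    then obtain c where c: "e' = ed M j b b' c \<or> e' = ed M (j - 1) c b b'" using M.edge_at e'(2) by blast
    have q: "ed M (j - 1) x b b' \<in> quad M j b" for x using ed_in_quad[of M "j - 1" x b b'] by simp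
    have "e' \<noteq> ed M (j - 1) c b b'"
    proof
      assume e: "e' = ed M (j - 1) c b b'"
      then have "g = quad M j b" using families_ex1[OF G(1) \<open>e' \<in> E\<close>] g(1) f e'(1) q by blast
      then have "ed M (j - 1) True b b' \<in> g" "ed M (j - 1) False b b' \<in> g" using q by simp_all
      from is_cycle_unique_mate[OF families_cycle[OF G(1) g(1)] g(2) this v] have "ed M (j - 1) True b b' = ed M (j - 1) False b b'"
        using M.ed_neq(2) by (simp add: M.ed_mem)
      then show False by (simp add: M.ed_eq_iff)
    qed
    then have e: "e' = ed M j b b' c" using c by blast
    have "square g" "g \<subseteq> E" "square (quad M (j + 1) b')" "quad M (j + 1) b' \<subseteq> E"
      using families_square[OF G(1) g(1)] families_E[OF G(1) g(1)] sq[OF quad_in_quads] by blast+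
    then have "g = quad M (j + 1) b'"
      using square_eq[of g "quad M (j + 1) b'" ?e e' ?v] g(2) e' v ed_in_quad[of M j b b'] unfolding e by metis
    then show ?thesis using g(1) by simp
  qed
  have pos: "\<forall>b. quad M j b \<in> G" if "j \<ge> 1" for j
    using that
  proof (induction j rule: int_ge_induct)
    case base show ?case using step[OF G(2)] by simp
  next
    case (step i) then show ?case using \<open>\<And>j b' b. quad M j b \<in> G \<Longrightarrow> quad M (j + 1) b' \<in> G\<close> by blast
  qed
  have per: "quad M (j + m * 4) b = quad M j b" for j m b
    unfolding quad_def ed_def using M.L_mult[of "j - 1" m] M.L_mult[of j m] by (simp add: algebra_simps)
  \<comment> \<open>Quads recur with period 4 in the level, so those at positive levels are all of
    them.\<close>
  have all: "quad M j b \<in> G" for j b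
    using pos[of "j + (\<bar>j\<bar> + 1) * 4"] unfolding per by auto
  have "quads M \<subseteq> G" unfolding quads_def using all by blast
  moreover have "f \<in> quads M" if f: "f \<in> G" for f
  proof -
    obtain e where e: "e \<in> f" "e \<in> E" using families_cycle[OF G(1) f] unfolding is_cycle_def by blast
    obtain h where "h \<in> quads M" "e \<in> h" using M.quad_ex1[OF e(2)] by blast
    then show ?thesis using families_ex1[OF G(1) e(2)] f e(1) \<open>quads M \<subseteq> G\<close> by blast
  qed
  ultimately have "quads M = G" by blast
  then show ?thesis using G(1) by simp
qed

end

text \<open>Gauging with a solution for \<beta> = 1 exchanges the families. The assumption
  \<open>\<alpha> \<or> even n\<close> makes this solution n-periodic, so the twist is kept and the
  gauge is an automorphism of the graph.\<close>

lemma straight_swap: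
  assumes L: "const_px n p V E L" and d: "period \<alpha> dvd n" and e: "\<alpha> \<or> even n"
  shows "\<exists>\<sigma>. graph_automorphism V E \<sigma> \<and> (\<forall>\<beta>. face_image \<sigma> ` straight_faces \<alpha> \<beta> L = straight_faces \<alpha> (\<not> \<beta>) L)"
proof -
  obtain u where u: "sol \<alpha> True u" using sol_exists[of \<alpha> True 0] by blast
  have "\<not> (\<not> \<alpha> \<and> odd (n div 3))"
  proof
    assume h: "\<not> \<alpha> \<and> odd (n div 3)"
    then have "3 dvd n" "even n" using d e by (simp_all add: period_def)
    then show False using h by (auto elim!: dvdE[of 3 n])
  qed
  then have per: "(u i \<noteq> u (i + int n)) = False" for i using sol_shift[OF u d, of i] by blast
  define M where "M = (\<lambda>i a b. L (i + 0) (a \<noteq> u i) (b \<noteq> u (i + 1)))"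
  have "const_px n (False \<noteq> p) V E M" unfolding M_def
    by (rule const_px_gauged[where u = u and r = False, OF L]) (rule per)
  then have "labelled_px n (\<lambda>_. p) V E M" by (simp add: const_px_def)
  then obtain \<sigma> where s: "graph_automorphism V E \<sigma>" "\<And>i a b. \<sigma> (L i a b) = M i a b"
    using relabel[OF L[unfolded const_px_def]] by blast
  have "face_image \<sigma> ` straight_faces \<alpha> \<beta> L = straight_faces \<alpha> (\<not> \<beta>) L" for \<beta>
  proof -
    have "straight_faces \<alpha> \<beta> M = straight_faces \<alpha> (\<beta> \<noteq> True) L" unfolding M_def by (rule straight_faces_gauge[OF u])
    then show ?thesis using face_image_families(1)[of \<sigma> L M, OF s(2)] by simp
  qed
  then show ?thesis using s(1) by blast
qed

lemma (in const_px) straight_nonempty: "\<exists>f. f \<in> straight_faces \<alpha> \<beta> L"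
  using straight_face_exists by blast

lemma q4_image:
  assumes "q4 V E L" "graph_automorphism V E \<sigma>"
  shows "q4 V E (\<lambda>i a b. \<sigma> (L i a b))"
proof -
  interpret q4 V E L by fact
  show ?thesis using image_labelled[OF assms(2)] by (simp add: q4_def const_px_def)
qed

context q4
begin

text \<open>Viewing the graph as the 4-cube, with the directions of the edges of \<^term>\<open>quads L\<close> paired as
  12 and 34, this automorphism exchanges the directions 2 and 3.\<close>

definition exch :: "int \<Rightarrow> bool \<Rightarrow> bool \<Rightarrow> 'a" where
  "exch r a b = L (r mod 2 + (if a \<noteq> b then 2 else 0)) (if r = 0 then b else if r = 2 then \<not> b else a)
     (if r = 0 \<or> r = 2 then b else if r = 1 then a else \<not> a)"

lemma L_mod4: "L (i mod 4) a b = L i a b"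
  using L_mult[of "i mod 4" "i div 4" a b] by simp

lemma concrete_adj:
  "{L 0 a b, L 1 c d} \<in> E \<longleftrightarrow> b = c" "{L 2 a b, L 1 c d} \<in> E \<longleftrightarrow> d = a"
  "{L 2 a b, L 3 c d} \<in> E \<longleftrightarrow> b = c" "{L 0 a b, L 3 c d} \<in> E \<longleftrightarrow> d = a"
  "{L 1 c d, L 0 a b} \<in> E \<longleftrightarrow> b = c" "{L 1 c d, L 2 a b} \<in> E \<longleftrightarrow> d = a"
  "{L 3 c d, L 2 a b} \<in> E \<longleftrightarrow> b = c" "{L 3 c d, L 0 a b} \<in> E \<longleftrightarrow> d = a"
  using adj_iff[of 0 a b c d] adj_iff[of 1 c d a b] adj_iff[of 2 a b c d] adj_iff[of 3 c d a b] L_add4(1)[of 0 a b]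
  by (simp_all add: insert_commute)

lemma mod4_cases:
  fixes i :: int
  obtains "i mod 4 = 0" | "i mod 4 = 1" | "i mod 4 = 2" | "i mod 4 = 3"
proof -
  have "i mod 4 = 0 \<or> i mod 4 = 1 \<or> i mod 4 = 2 \<or> i mod 4 = 3" by presburger
  then show thesis by (elim disjE that)
qed

lemma exchange: "\<exists>\<sigma>. graph_automorphism V E \<sigma> \<and> face_image \<sigma> ` quads L = straight_faces True False L \<and>
   face_image \<sigma> ` straight_faces True False L = quads L"
proof -
  define \<sigma> where "\<sigma> v = (SOME w. \<exists>i a b. v = L i a b \<and> w = exch (i mod 4) a b)" for v
  have s: "\<sigma> (L i a b) = exch (i mod 4) a b" for i a b
  proof -
    have "\<exists>i' a' b'. L i a b = L i' a' b' \<and> \<sigma> (L i a b) = exch (i' mod 4) a' b'"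
      unfolding \<sigma>_def by (rule someI[of _ "exch (i mod 4) a b"]) blast
    then obtain j c d where j: "L i a b = L j c d" "\<sigma> (L i a b) = exch (j mod 4) c d" by blast
    have m: "i mod 4 = j mod 4" using lev[OF j(1)] by (simp add: mod_eq_dvd_iff)
    have "L i a b = L i c d" using j(1) L_mod4[of i a b] L_mod4[of j c d] L_mod4[of i c d] m by simp
    then have "a = c \<and> b = d" by (rule inj)
    then show ?thesis using j(2) m by simp
  qed
  have inv: "\<sigma> (\<sigma> (L i a b)) = L i a b" for i a b
    by (cases i rule: mod4_cases; cases a; cases b) (simp_all add: s exch_def L_mod4[of i, symmetric])
  have edge: "{\<sigma> (L i a b), \<sigma> (L (i + 1) b c)} \<in> E" for i a b c
  proof -
    have m: "(i + 1) mod 4 = (i mod 4 + 1) mod 4" by (simp add: mod_add_left_eq)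
    obtain r where r: "i mod 4 = r" by blast
    have "r = 0 \<or> r = 1 \<or> r = 2 \<or> r = 3" using r by presburger
    then show ?thesis unfolding s m r
      by (elim disjE; cases a; cases b; cases c) (simp_all add: exch_def concrete_adj)
  qed
  have inV: "\<sigma> v \<in> V" if "v \<in> V" for v
  proof -
    obtain i a b where "v = L i a b" using \<open>v \<in> V\<close> unfolding V_eq by blast
    then show ?thesis using s[of i a b] by (simp add: exch_def)
  qed
  have inv': "\<sigma> (\<sigma> v) = v" if "v \<in> V" for v using that inv unfolding V_eq by blast
  have E1: "{\<sigma> u, \<sigma> v} \<in> E" if uv: "{u, v} \<in> E" for u v
  proof -
    obtain i a b c where "{u, v} = {L i a b, L (i + 1) b c}" using uv unfolding E_eq ed_def by blast
    then have "{\<sigma> u, \<sigma> v} = {\<sigma> (L i a b), \<sigma> (L (i + 1) b c)}" by (auto simp: doubleton_eq_iff)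
    then show ?thesis using edge by simp
  qed
  have g: "graph_automorphism V E \<sigma>" unfolding graph_automorphism_def
  proof (intro conjI ballI)
    show "bij_betw \<sigma> V V" by (rule bij_betw_byWitness[of _ \<sigma>]) (use inv' inV in auto)
    fix u v assume "u \<in> V" "v \<in> V"
    then show "{u, v} \<in> E \<longleftrightarrow> {\<sigma> u, \<sigma> v} \<in> E" using E1[of u v] E1[of "\<sigma> u" "\<sigma> v"] inv' by auto
  qed
  let ?M = "\<lambda>i a b. \<sigma> (L i a b)"
  interpret M: q4 V E ?M by (rule q4_image[OF q4_axioms g])
  \<comment> \<open>Distinct families never share a pair of edges at a vertex, so the image of a
    single pair at \<open>L 0 False False\<close> identifies the image family.\<close>
  have e: "ed ?M 0 False False False = ed L 0 False False False" "ed ?M 0 False False True = ed L (0 - 1) False False False" "?M 0 False False = L 0 False False"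
    using L_add4(1)[of "-1" False False] by (simp_all add: ed_def s exch_def insert_commute)
  have m1: "mates (quads ?M) (L 0 False False) (ed L 0 False False False) (ed L (0 - 1) False False False)"
    using M.family_mates(1)[of 0 False False False] unfolding e by (simp only: e not_False_eq_True)
  have "mates (straight_faces True False L) (L 0 False False) (ed L (0 - 1) False False False) (ed L 0 False False False)"
    using family_mates(3)[of False 0 False False False] by simp
  then have m2: "mates (straight_faces True False L) (L 0 False False) (ed L 0 False False False) (ed L (0 - 1) False False False)"
    by (rule mates_sym)
  have "straight_faces True False L \<in> families" by (simp add: families_def)
  then have q: "quads ?M = straight_faces True False L"
    using families_disjoint[OF quads_in_families[OF M.q4_axioms] _ m1 m2] by blast
  have fq: "face_image \<sigma> ` quads L = straight_faces True False L"
    using face_image_families(2)[of \<sigma> L ?M] q by simp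
  \<comment> \<open>As \<sigma> is an involution, the image of the quads is mapped back to the
    quads.\<close>
  have "face_image \<sigma> (face_image \<sigma> f) = f" if "f \<in> quads L" for f
  proof -
    have "\<forall>e\<in>f. e \<subseteq> V" using families_E[of "quads L" f] that simple_graph_edge_subset[OF simple] by (auto simp: families_def)
    then have "face_image (\<sigma> \<circ> \<sigma>) f = face_image id f" by (rule face_image_cong) (simp add: inv')
    then show ?thesis unfolding face_image_comp by (simp add: face_image_def)
  qed
  then have "face_image \<sigma> ` straight_faces True False L = quads L" unfolding fq[symmetric] image_image by simp
  then show ?thesis using g fq by blast
qed

text \<open>\<open>exchange\<close> treats the family with \<beta> = 0. The family with \<beta> = 1
  has \<beta> = 0 in a labelling gauged by a solution for \<beta> = 1, which still has zero twist
  since \<alpha> = 1.\<close>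

lemma family_labelling:
  assumes "G \<in> families"
  shows "\<exists>M. q4 V E M \<and> quads M = G"
proof -
  have T: "\<exists>M. q4 V E M \<and> quads M = straight_faces True False L'" if q: "q4 V E L'" for L'
  proof -
    obtain \<sigma> where s: "graph_automorphism V E \<sigma>" "face_image \<sigma> ` quads L' = straight_faces True False L'" using q4.exchange[OF q] by blast
    have "quads (\<lambda>i a b. \<sigma> (L' i a b)) = straight_faces True False L'" using face_image_families(2)[of \<sigma> L'] s(2) by metis
    then show ?thesis using q4_image[OF q s(1)] by blast
  qed
  obtain u where u: "sol True True u" using sol_exists[of True True 0] by blast
  define L' where "L' = (\<lambda>i a b. L (i + 0) (a \<noteq> u i) (b \<noteq> u (i + 1)))"
  have "const_px 4 (False \<noteq> False) V E L'" unfolding L'_def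
  proof (rule const_px_gauged[where u = u and r = False, OF const_px_axioms])
    show "(u i \<noteq> u (i + int 4)) = False" for i using sol_shift[OF u period4, of i] by simp
  qed
  then have q: "q4 V E L'" by (simp add: q4_def)
  have s: "straight_faces True False L' = straight_faces True True L"
    using straight_faces_gauge[OF u, of False L 0] unfolding L'_def by simp
  show ?thesis using assms q4_axioms T[OF q4_axioms] T[OF q] unfolding families_def s by blast
qed

lemma automorphism_families:
  assumes "graph_automorphism V E \<sigma>" "G \<in> families"
  shows "face_image \<sigma> ` G \<in> families"
proof -
  obtain M where M: "q4 V E M" "quads M = G" using family_labelling[OF assms(2)] by blast
  have "quads (\<lambda>i a b. \<sigma> (M i a b)) \<in> families" by (rule quads_in_families[OF q4_image[OF M(1) assms(1)]])
  then show ?thesis using face_image_families(2)[of \<sigma> M] M(2) by metis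
qed

lemma automorphism_families_inj:
  assumes g: "graph_automorphism V E \<sigma>" and "G \<in> families" "H \<in> families" "face_image \<sigma> ` G = face_image \<sigma> ` H"
  shows "G = H"
proof -
  have "face_image (inv_into V \<sigma>) ` face_image \<sigma> ` K = K" if "K \<in> families" for K
    using face_image_inv[OF simple g] families_E[OF that] by (simp add: image_image)
  then show ?thesis using assms by metis
qed

lemma card_families: "card families = 3"
proof -
  have st: "mates (straight_faces True \<beta> L) (L 0 False False) (ed L (0 - 1) False False False) (ed L 0 False False \<beta>)" for \<beta>
    using family_mates(3)[of \<beta> 0 False False False] by simp
  have q: "mates (quads L) (L 0 False False) (ed L (0 - 1) False False False) (ed L (0 - 1) True False False)"
    using family_mates(2)[of 0 False False False] by simp
  have f: "quads L \<in> families" "straight_faces True False L \<in> families" unfolding families_def by simp_all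
  have "quads L \<noteq> straight_faces True \<beta> L" for \<beta>
  proof
    assume h: "quads L = straight_faces True \<beta> L"
    show False using family_mates_unique[OF f(1) q st[of \<beta>, folded h]] ed_neq(2) by metis
  qed
  moreover have "straight_faces True False L \<noteq> straight_faces True True L"
  proof
    assume h: "straight_faces True False L = straight_faces True True L"
    show False using family_mates_unique[OF f(2) st[of False] st[of True, folded h]] by (simp add: ed_eq_iff)
  qed
  ultimately show ?thesis unfolding families_def by simp
qed

end

section \<open>A family of squares invariant under the group of the map\<close>

locale q4_class = q4 V E L + class_map "4 :: nat" "\<lambda>_. False" V E L F FA FB
  for V :: "'a set" and E :: "'a set set" and L :: "int \<Rightarrow> bool \<Rightarrow> bool \<Rightarrow> 'a" and F FA FB :: "'a set set set"
begin

text \<open>Four edges have three perfect matchings, and the three families of squares realise them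
  at every vertex. The pairing of \<open>X\<close> at \<open>v\<close> is thus encoded as a family
  of squares, on which automorphisms act.\<close>

definition matches :: "'a set set set \<Rightarrow> 'a set set set \<Rightarrow> 'a \<Rightarrow> bool" where
  "matches X G v \<longleftrightarrow> (\<forall>e\<in>E. v \<in> e \<longrightarrow> (\<exists>e'. mates X v e e' \<and> mates G v e e'))"

lemma edge_exists: "v \<in> V \<Longrightarrow> \<exists>e\<in>E. v \<in> e"
proof -
  assume "v \<in> V"
  then obtain i a b where "v = L i a b" unfolding V_eq by blast
  then show ?thesis by (intro bexI[of _ "ed L i a b True"]) (simp_all add: ed_mem)
qed

lemma matches_exists:
  assumes v: "v \<in> V" and X: "X = FA \<or> X = FB"
  shows "\<exists>G\<in>families. matches X G v"
proof -
  obtain e1 where e1: "e1 \<in> E" "v \<in> e1" using edge_exists[OF v] by blast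
  obtain e2 where e2: "mates X v e1 e2" using mates_exists[OF X e1] by blast
  have e2': "e2 \<in> E" "v \<in> e2" "e1 \<noteq> e2" using mates_in_E[OF X e2] e2 unfolding mates_def by blast+
  obtain G where G: "G \<in> families" "mates G v e1 e2" using families_mates_exists[OF e1(1) e2'(1,3) e1(2) e2'(2)] by blast
  obtain i a b where vL: "v = L i a b" using v unfolding V_eq by blast
  let ?S = "{e \<in> E. v \<in> e}"
  have S: "card ?S = 4" "finite ?S" unfolding vL edges_at using ed_neq by (simp_all add: ed_eq_iff)
  have Gex: "\<exists>e'. mates G v e e'" if "e \<in> E" "v \<in> e" for e
  proof -
    obtain f where f: "f \<in> G" "e \<in> f" using ex1_implies_ex[OF families_ex1[OF G(1) \<open>e \<in> E\<close>]] by blast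
    show ?thesis using ex1_implies_ex[OF is_cycle_mates[OF families_cycle[OF G(1) f(1)] f(2) \<open>v \<in> e\<close>]] f \<open>v \<in> e\<close> unfolding mates_def by blast
  qed
  have "\<exists>e'. mates X v e e' \<and> mates G v e e'" if e: "e \<in> E" "v \<in> e" for e
  proof (cases "e = e1 \<or> e = e2")
    case True
    then show ?thesis
    proof
      assume "e = e1" then show ?thesis using e2 G(2) by (intro exI[of _ e2]) simp
    next
      assume "e = e2" then show ?thesis using mates_sym[OF e2] mates_sym[OF G(2)] by (intro exI[of _ e1]) simp
    qed
  next
    case False
    obtain x where x: "mates X v e x" using mates_exists[OF X e] by blast
    obtain y where y: "mates G v e y" using Gex[OF e] by blast
    have "x \<noteq> e1" using mates_unique[OF X e2, of e] mates_sym[OF x] False by blast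
    moreover have "x \<noteq> e2" using mates_unique[OF X mates_sym[OF e2], of e] mates_sym[OF x] False by blast
    moreover have "y \<noteq> e1" using family_mates_unique[OF G(1,2), of e] mates_sym[OF y] False by blast
    moreover have "y \<noteq> e2" using family_mates_unique[OF G(1) mates_sym[OF G(2)], of e] mates_sym[OF y] False by blast
    moreover have "x \<noteq> e" "y \<noteq> e" "x \<in> ?S" "y \<in> ?S"
      using x y mates_in_E[OF X x] families_E[OF G(1)] unfolding mates_def by blast+
    ultimately have xy: "{x, y} \<subseteq> ?S - {e1, e2, e}" by blast
    \<comment> \<open>A single edge at \<open>v\<close> remains as the partner of \<open>e\<close>,
      in both pairings.\<close>
    have "card {e1, e2, e} = 3" using e2'(3) False by (simp add: eq_commute)
    moreover have "{e1, e2, e} \<subseteq> ?S" using e e1 e2'(1,2) by blast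
    ultimately have "card (?S - {e1, e2, e}) = 1" using S by (subst card_Diff_subset) simp_all
    then obtain z where z: "?S - {e1, e2, e} = {z}" by (rule card_1_singletonE)
    have "x = y" using xy unfolding z by simp
    then show ?thesis using x y by blast
  qed
  then show ?thesis using G(1) unfolding matches_def by blast
qed

lemma matches_unique:
  assumes "v \<in> V" "X = FA \<or> X = FB" "G \<in> families" "H \<in> families" "matches X G v" "matches X H v"
  shows "G = H"
proof -
  obtain e where e: "e \<in> E" "v \<in> e" using edge_exists[OF assms(1)] by blast
  obtain x where x: "mates X v e x" "mates G v e x" using assms(5) e unfolding matches_def by blast
  obtain y where y: "mates X v e y" "mates H v e y" using assms(6) e unfolding matches_def by blast
  have "x = y" by (rule mates_unique[OF assms(2) x(1) y(1)])
  then show ?thesis using families_disjoint[OF assms(3,4) x(2)] y(2) by blast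
qed

lemma matches_disjoint:
  assumes "v \<in> V" "G \<in> families" "matches FA G v" "matches FB G v"
  shows False
proof -
  obtain e where e: "e \<in> E" "v \<in> e" using edge_exists[OF assms(1)] by blast
  obtain x where x: "mates FA v e x" "mates G v e x" using assms(3) e unfolding matches_def by blast
  obtain y where y: "mates FB v e y" "mates G v e y" using assms(4) e unfolding matches_def by blast
  have "x = y" by (rule family_mates_unique[OF assms(2) x(2) y(2)])
  then show False using disj[OF x(1)] y(1) by blast
qed

lemma matches_image:
  assumes s: "map_aut V E F \<sigma>" and v: "v \<in> V" and X: "X = FA \<or> X = FB" and G: "G \<in> families" "matches X G v"
  shows "matches X (face_image \<sigma> ` G) (\<sigma> v)"
proof -
  have g: "graph_automorphism V E \<sigma>" using s by (simp add: map_aut_def)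
  have sv: "\<sigma> v \<in> V" by (rule graph_automorphism_in[OF g v])
  obtain H where H: "H \<in> families" "matches X H (\<sigma> v)" using matches_exists[OF sv X] by blast
  obtain e where e: "e \<in> E" "v \<in> e" using edge_exists[OF v] by blast
  obtain x where x: "mates X v e x" "mates G v e x" using G(2) e unfolding matches_def by blast
  have "\<sigma> ` e \<in> E" "\<sigma> v \<in> \<sigma> ` e" using graph_automorphism_edge[OF simple g e(1)] e(2) by blast+
  then obtain y where y: "mates X (\<sigma> v) (\<sigma> ` e) y" "mates H (\<sigma> v) (\<sigma> ` e) y" using H(2) unfolding matches_def by blast
  have xy: "\<sigma> ` x = y" by (rule mates_unique[OF X mates_equi[OF s X x(1)] y(1)])
  have "mates (face_image \<sigma> ` G) (\<sigma> v) (\<sigma> ` e) (\<sigma> ` x)" by (rule mates_image[OF simple g families_E[OF G(1)] x(2)])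
  then have "face_image \<sigma> ` G = H"
    using families_disjoint[OF automorphism_families[OF g G(1)] H(1)] y(2) unfolding xy by blast
  then show ?thesis using H(2) by simp
qed

definition \<kappa> :: "'a set set set \<Rightarrow> 'a \<Rightarrow> 'a set set set" where
  "\<kappa> X v = (THE G. G \<in> families \<and> matches X G v)"

lemma \<kappa>:
  assumes "v \<in> V" "X = FA \<or> X = FB"
  shows "\<kappa> X v \<in> families" "matches X (\<kappa> X v) v"
proof -
  have "\<exists>!G. G \<in> families \<and> matches X G v" using matches_exists[OF assms] matches_unique[OF assms] by blast
  from theI'[OF this] show "\<kappa> X v \<in> families" "matches X (\<kappa> X v) v" unfolding \<kappa>_def by blast+
qed

lemma \<kappa>_neq: "v \<in> V \<Longrightarrow> \<kappa> FA v \<noteq> \<kappa> FB v"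
  using \<kappa>[of v FA] \<kappa>[of v FB] matches_disjoint by metis

lemma \<kappa>_image:
  assumes s: "map_aut V E F \<sigma>" and v: "v \<in> V" and X: "X = FA \<or> X = FB"
  shows "\<kappa> X (\<sigma> v) = face_image \<sigma> ` \<kappa> X v"
proof -
  have g: "graph_automorphism V E \<sigma>" using s by (simp add: map_aut_def)
  have sv: "\<sigma> v \<in> V" by (rule graph_automorphism_in[OF g v])
  show ?thesis
    using matches_unique[OF sv X \<kappa>(1)[OF sv X] automorphism_families[OF g \<kappa>(1)[OF v X]] \<kappa>(2)[OF sv X] matches_image[OF s v X \<kappa>[OF v X]]] .
qed

text \<open>Agreement of \<open>D\<close> across one edge spreads to all edges by arc-transitivity
  and to all vertices by connectedness; a constant equivariant assignment is invariant.\<close>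

lemma equivariant_constant:
  assumes D: "\<And>\<sigma> v. map_aut V E F \<sigma> \<Longrightarrow> v \<in> V \<Longrightarrow> D (\<sigma> v) = (`) (face_image \<sigma>) ` D v"
    and e0: "{v0, w0} \<in> E" "v0 \<noteq> w0" "D v0 = D w0"
  shows "\<And>\<sigma>. map_aut V E F \<sigma> \<Longrightarrow> (`) (face_image \<sigma>) ` D v0 = D v0"
proof -
  have v0: "v0 \<in> V" "w0 \<in> V" using simple_graph_edge_subset[OF simple e0(1)] by auto
  have step: "D u = D v" if uv: "{u, v} \<in> E" "u \<in> V" "v \<in> V" for u v
  proof -
    obtain \<sigma> where s: "map_aut V E F \<sigma>" "\<sigma> v0 = u" "\<sigma> ` {v0, w0} = {u, v}"
      using A_arc[OF e0(1) _ uv(1), of v0 u] by blast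
    have "\<sigma> w0 = v"
    proof -
      have "inj_on \<sigma> V" using s(1) unfolding map_aut_def graph_automorphism_def bij_betw_def by blast
      then have "\<sigma> v0 \<noteq> \<sigma> w0" using v0 e0(2) by (simp add: inj_on_eq_iff)
      then show ?thesis using s(2,3) by (auto simp: doubleton_eq_iff)
    qed
    then show ?thesis using D[OF s(1) v0(1)] D[OF s(1) v0(2)] e0(3) s(2) by simp
  qed
  have const: "{v \<in> V. D v = D v0} = V"
  proof (rule ccontr)
    assume "{v \<in> V. D v = D v0} \<noteq> V"
    moreover have "{v \<in> V. D v = D v0} \<noteq> {}" "{v \<in> V. D v = D v0} \<subseteq> V" using v0(1) by auto
    ultimately have "\<exists>u\<in>{v \<in> V. D v = D v0}. \<exists>v\<in>V - {v \<in> V. D v = D v0}. {u, v} \<in> E"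
      using connected[unfolded connected_graph_def, rule_format, of "{v \<in> V. D v = D v0}"] by simp
    then show False using step by auto
  qed
  fix \<sigma> assume s: "map_aut V E F \<sigma>"
  then have "\<sigma> v0 \<in> V" using graph_automorphism_in[of V E \<sigma> v0] v0(1) by (simp add: map_aut_def)
  then show "(`) (face_image \<sigma>) ` D v0 = D v0" using const D[OF s v0(1)] by blast
qed

lemma invariant_family: "\<exists>K\<in>families. \<forall>\<sigma>. map_aut V E F \<sigma> \<longrightarrow> face_image \<sigma> ` K = K"
proof -
  let ?v = "L 0 False False" and ?w = "L 1 False False"
  have vw: "{?v, ?w} \<in> E" "?v \<noteq> ?w" "?v \<in> V" "?w \<in> V"
    using ed_in_E[of 0 False False False] L_neq(1)[of 0] by (simp_all add: ed_def)
  obtain \<rho> where r: "map_aut V E F \<rho>" "\<rho> ?v = ?w" "\<rho> ` {?v, ?w} = {?v, ?w}" using A_arc[OF vw(1) _ vw(1), of ?v ?w] by blast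
  then have r': "\<rho> ?w = ?v" using vw(2) by (auto simp: doubleton_eq_iff)
  have A: "FA = FA \<or> FA = FB" "FB = FA \<or> FB = FB" by simp_all
  define a b a' b' where "a = \<kappa> FA ?v" and "b = \<kappa> FB ?v" and "a' = \<kappa> FA ?w" and "b' = \<kappa> FB ?w"
  note defs = a_def b_def a'_def b'_def
  have fam: "a \<in> families" "b \<in> families" "a' \<in> families" "b' \<in> families" unfolding defs using \<kappa>(1) vw A by blast+
  have ne: "a \<noteq> b" "a' \<noteq> b'" unfolding defs using \<kappa>_neq vw by blast+
  have im: "a' = face_image \<rho> ` a" "b' = face_image \<rho> ` b" "a = face_image \<rho> ` a'" "b = face_image \<rho> ` b'"
    unfolding defs using \<kappa>_image[OF r(1) vw(3)] \<kappa>_image[OF r(1) vw(4)] A r(2) r' by metis+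
  have third: "\<exists>c. families = {a, b, c}"
  proof -
    have "card (families - {a, b}) = 1" using card_families fam ne by (subst card_Diff_subset) auto
    then obtain c where "families - {a, b} = {c}" by (auto simp: card_1_singleton_iff)
    then show ?thesis using fam by blast
  qed
  \<comment> \<open>Since \<rho> swaps the two ends, \<open>a' = b\<close> would give
    \<open>b' = a\<close>. If all three alternatives fail, \<open>a'\<close> and \<open>b'\<close>
    must both be the third family, but they differ. In the last alternative it is the third family
    that is invariant.\<close>
  have "a = a' \<or> b = b' \<or> {a, b} = {a', b'}"
  proof (rule ccontr)
    assume no: "\<not> ?thesis"
    have "a' \<noteq> b"
    proof
      assume "a' = b"
      then have "b' = a" using im by metis
      then show False using no \<open>a' = b\<close> by blast
    qed
    moreover have "b' \<noteq> a"
    proof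
      assume "b' = a"
      then have "a' = b" using im by metis
      then show False using \<open>a' \<noteq> b\<close> by blast
    qed
    moreover obtain c where "families = {a, b, c}" using third by blast
    ultimately have "a' = c" "b' = c" using fam(3,4) no by auto
    then show False using ne by simp
  qed
  moreover have "\<exists>K\<in>families. \<forall>\<sigma>. map_aut V E F \<sigma> \<longrightarrow> face_image \<sigma> ` K = K" if "\<kappa> X ?v = \<kappa> X ?w" and X: "X = FA \<or> X = FB" for X
  proof -
    have "face_image \<sigma> ` \<kappa> X ?v = \<kappa> X ?v" if "map_aut V E F \<sigma>" for \<sigma>
      using equivariant_constant[of "\<lambda>v. {\<kappa> X v}", OF _ vw(1,2) _ that] \<kappa>_image[OF _ _ X] \<open>\<kappa> X ?v = \<kappa> X ?w\<close> by simp
    then show ?thesis using \<kappa>(1)[OF vw(3) X] by blast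
  qed
  moreover have "\<exists>K\<in>families. \<forall>\<sigma>. map_aut V E F \<sigma> \<longrightarrow> face_image \<sigma> ` K = K" if ab: "{a, b} = {a', b'}"
  proof -
    have D: "(`) (face_image \<sigma>) ` {a, b} = {a, b}" if "map_aut V E F \<sigma>" for \<sigma>
    proof -
      have "(`) (face_image \<sigma>) ` {\<kappa> FA ?v, \<kappa> FB ?v} = {\<kappa> FA ?v, \<kappa> FB ?v}"
      proof (rule equivariant_constant[of "\<lambda>v. {\<kappa> FA v, \<kappa> FB v}", OF _ vw(1,2) _ that])
        show "{\<kappa> FA ?v, \<kappa> FB ?v} = {\<kappa> FA ?w, \<kappa> FB ?w}" using ab unfolding defs .
        show "{\<kappa> FA (\<tau> v), \<kappa> FB (\<tau> v)} = (`) (face_image \<tau>) ` {\<kappa> FA v, \<kappa> FB v}" if "map_aut V E F \<tau>" "v \<in> V" for \<tau> v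
          using \<kappa>_image[OF that] by simp
      qed
      then show ?thesis unfolding defs .
    qed
    obtain c where c: "families = {a, b, c}" using third by blast
    have cab: "c \<notin> {a, b}"
    proof
      assume "c \<in> {a, b}"
      then have "families = {a, b}" using c by blast
      then show False using card_families ne by simp
    qed
    have "face_image \<sigma> ` c = c" if s: "map_aut V E F \<sigma>" for \<sigma>
    proof -
      have g: "graph_automorphism V E \<sigma>" using s by (simp add: map_aut_def)
      have cf: "c \<in> families" using c by simp
      have "face_image \<sigma> ` c \<notin> {a, b}"
      proof
        assume "face_image \<sigma> ` c \<in> {a, b}"
        then obtain x where "x \<in> {a, b}" "face_image \<sigma> ` c = face_image \<sigma> ` x" using D[OF s] by (metis imageE)
        then show False using automorphism_families_inj[OF g cf, of x] fam cab by blast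
      qed
      moreover have "face_image \<sigma> ` c \<in> {a, b, c}" using automorphism_families[OF g cf] c by simp
      ultimately show ?thesis by simp
    qed
    then show ?thesis by (intro bexI[of _ c] allI impI) (simp_all add: c)
  qed
  ultimately show ?thesis unfolding defs using A by blast
qed

end

text \<open>In a labelling whose quads are the invariant family, the group of the map preserves
  fibres and the general classification applies. Without twist \<open>exchange\<close> would fuse
  quads and straight faces, and two straight families would be fused by
  \<open>straight_swap\<close>.\<close>

lemma (in q4) class_map_standard:
  assumes F: "F \<in> class201_maps V E"
  shows "\<exists>L'. const_px 4 True V E L' \<and> F = quads L' \<union> straight_faces True False L'"
proof -
  obtain FA FB where c: "class_map 4 (\<lambda>_. False) V E L F FA FB" using class_map_exists[OF F] by blast
  interpret C: q4_class V E L F FA FB using c q4_axioms by (simp add: q4_class_def)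
  obtain K where K: "K \<in> families" "\<forall>\<sigma>. map_aut V E F \<sigma> \<longrightarrow> face_image \<sigma> ` K = K" using C.invariant_family by blast
  obtain M where M: "q4 V E M" "quads M = K" using family_labelling[OF K(1)] by blast
  interpret M: q4 V E M by (rule M(1))
  obtain GA GB where c': "class_map 4 (\<lambda>_. False) V E M F GA GB" using M.class_map_exists[OF F] by blast
  interpret D: class_map "4 :: nat" "\<lambda>_. False" V E M F GA GB by (rule c')
  have fib: "\<forall>\<sigma>. map_aut V E F \<sigma> \<longrightarrow> M.fibre_preserving \<sigma>"
    using K(2) M.fibre_preserving_if_quads M(2) by (simp add: map_aut_def)
  obtain p \<alpha> L' where h: "const_px 4 p V E L'" "period \<alpha> dvd 4" and cs: "F = quads L' \<union> straight_faces \<alpha> False L' \<and>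
        (\<forall>\<sigma> f. map_aut V E F \<sigma> \<longrightarrow> f \<in> quads L' \<longrightarrow> face_image \<sigma> f \<notin> straight_faces \<alpha> False L') \<or>
      F = straight_faces \<alpha> False L' \<union> straight_faces \<alpha> True L' \<and>
        (\<forall>\<sigma> f. map_aut V E F \<sigma> \<longrightarrow> f \<in> straight_faces \<alpha> False L' \<longrightarrow> face_image \<sigma> f \<notin> straight_faces \<alpha> True L')"
    using D.classification[OF fib] by (elim exE conjE)
  have \<alpha>: "\<alpha> = True" using h(2) by (cases \<alpha>) (simp_all add: period_def)
  from cs show ?thesis unfolding \<alpha>
  proof (elim disjE conjE)
    assume F': "F = quads L' \<union> straight_faces True False L'"
      and n: "\<forall>\<sigma> f. map_aut V E F \<sigma> \<longrightarrow> f \<in> quads L' \<longrightarrow> face_image \<sigma> f \<notin> straight_faces True False L'"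
    have p
    proof (rule ccontr)
      assume "\<not> p"
      then have q: "q4 V E L'" using h(1) by (simp add: q4_def)
      obtain \<sigma> where s: "graph_automorphism V E \<sigma>" "face_image \<sigma> ` quads L' = straight_faces True False L'" "face_image \<sigma> ` straight_faces True False L' = quads L'"
        using q4.exchange[OF q] by blast
      then have "map_aut V E F \<sigma>" unfolding map_aut_def F' by (simp add: image_Un Un_commute)
      then show False using n s(2) quad_in_quads[of L' 0 False] by blast
    qed
    then show ?thesis using h(1) F' by auto
  next
    assume F': "F = straight_faces True False L' \<union> straight_faces True True L'"
      and n: "\<forall>\<sigma> f. map_aut V E F \<sigma> \<longrightarrow> f \<in> straight_faces True False L' \<longrightarrow> face_image \<sigma> f \<notin> straight_faces True True L'"
    obtain \<sigma> where s: "graph_automorphism V E \<sigma>" "\<forall>\<beta>. face_image \<sigma> ` straight_faces True \<beta> L' = straight_faces True (\<not> \<beta>) L'"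
      using straight_swap[OF h(1), of True] by (auto simp: period_def)
    then have "map_aut V E F \<sigma>" unfolding map_aut_def F' by (simp add: image_Un Un_commute)
    moreover obtain f where f: "f \<in> straight_faces True False L'" using const_px.straight_nonempty[OF h(1)] by blast
    moreover have "face_image \<sigma> f \<in> straight_faces True True L'" using imageI[OF f, of "face_image \<sigma>"] s(2)[rule_format, of False] by simp
    ultimately show ?thesis using n by blast
  qed
qed

section \<open>Isomorphism classes on the Rose Window graph\<close>

lemma map_iso_face_lengths:
  assumes s: "simple_graph V E" and F: "\<And>f. f \<in> F \<Longrightarrow> f \<subseteq> E" and i: "map_iso V E F F'"
  shows "face_lengths F' = face_lengths F"
proof -
  obtain \<sigma> where g: "graph_automorphism V E \<sigma>" and im: "face_image \<sigma> ` F = F'" using i by (auto simp: map_iso_def)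
  have "card (face_image \<sigma> f) = card f" if "f \<in> F" for f
    using card_face_image[OF s g F[OF that]] .
  then show ?thesis unfolding im[symmetric] face_lengths_def by (simp add: image_image)
qed

text \<open>The gauge by the parity of the number of completed turns flips the twist, so both values
  of \<open>p\<close> occur on the same graph. The twist becomes meaningful only relative to a
  family of faces.\<close>

lemma const_px_retwist:
  assumes "const_px n p V E L"
  shows "\<exists>M. const_px n q V E M"
proof (cases "p = q")
  case False
  interpret const_px n p V E L by fact
  have "(i + int n) div int n = i div int n + 1" for i using n3 by (simp add: div_add_self2)
  then have "(odd (i div int n) \<noteq> odd ((i + int n) div int n)) = True" for i by simp
  from const_px_gauged[where u = "\<lambda>i. odd (i div int n)" and r = True, OF assms this, of 0]
  have "\<exists>M. const_px n (True \<noteq> p) V E M" by blast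
  then show ?thesis using False by simp
qed (use assms in blast)

text \<open>No parameter \<beta> is kept: quads are unaffected by gauging, so the straight family
  can always be normalised to \<beta> = 0.\<close>

definition quads_straight :: "bool \<Rightarrow> (int \<Rightarrow> bool \<Rightarrow> bool \<Rightarrow> 'a) \<Rightarrow> 'a set set set" where
  "quads_straight \<alpha> L = quads L \<union> straight_faces \<alpha> False L"

definition straight_straight :: "(int \<Rightarrow> bool \<Rightarrow> bool \<Rightarrow> 'a) \<Rightarrow> 'a set set set" where
  "straight_straight L = straight_faces False False L \<union> straight_faces False True L"

lemma standard_maps_iso:
  assumes "const_px n p V E L" "const_px n p V E M"
  shows "map_iso V E (quads_straight \<alpha> L) (quads_straight \<alpha> M)" "map_iso V E (straight_straight L) (straight_straight M)"
proof -
  obtain \<sigma> where s: "graph_automorphism V E \<sigma>" "\<And>i a b. \<sigma> (L i a b) = M i a b"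
    using relabel[OF assms[unfolded const_px_def]] by blast
  note f = face_image_families[of \<sigma> L M, OF s(2)]
  show "map_iso V E (quads_straight \<alpha> L) (quads_straight \<alpha> M)" "map_iso V E (straight_straight L) (straight_straight M)"
    unfolding map_iso_def quads_straight_def straight_straight_def image_Un by (rule exI[of _ \<sigma>], simp add: f s(1))+
qed

text \<open>For odd \<open>n\<close>, gauging with a solution for \<beta> = 1 flips the twist and
  merely exchanges the two straight families, so their union is unchanged.\<close>

lemma straight_straight_untwist:
  assumes L: "const_px n p V E L" and d: "3 dvd n" "odd n"
  shows "\<exists>M. const_px n False V E M \<and> straight_straight M = straight_straight L"
proof (cases p)
  case True
  have d': "period False dvd n" using d by (simp add: period_def)
  have o: "odd (n div 3)" using d by (metis dvd_mult_div_cancel even_mult_iff)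
  obtain u where u: "sol False True u" using sol_exists[of False True 0] by blast
  define M where "M = (\<lambda>i a b. L (i + 0) (a \<noteq> u i) (b \<noteq> u (i + 1)))"
  have "const_px n (True \<noteq> p) V E M" unfolding M_def
  proof (rule const_px_gauged[where u = u and r = True, OF L])
    show "(u i \<noteq> u (i + int n)) = True" for i using sol_shift[OF u d', of i] o by simp
  qed
  then have c: "const_px n False V E M" using True by simp
  have "straight_faces False \<beta> M = straight_faces False (\<beta> \<noteq> True) L" for \<beta>
    unfolding M_def by (rule straight_faces_gauge[OF u])
  then have "straight_straight M = straight_straight L" unfolding straight_straight_def by auto
  then show ?thesis using c by blast
qed (use L in auto)

text \<open>When 12 divides \<open>n\<close>, face lengths do not separate the two values of
  \<alpha>. Straight faces are longer than 4, so an isomorphism maps straight faces to straight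
  faces. It preserves fibres, hence is a translation, possibly after reversal, and neither alters
  the homogeneous part of the recurrence.\<close>

lemma quads_straight_not_iso:
  assumes L: "const_px n p V E L" and L1: "const_px n p V E L1" and d: "3 dvd n" "4 dvd n"
  shows "\<not> map_iso V E (quads_straight \<alpha> L) (quads_straight (\<not> \<alpha>) L1)"
proof
  assume "map_iso V E (quads_straight \<alpha> L) (quads_straight (\<not> \<alpha>) L1)"
  then obtain \<sigma> where g: "graph_automorphism V E \<sigma>"
    and im: "face_image \<sigma> ` quads_straight \<alpha> L = quads_straight (\<not> \<alpha>) L1" by (auto simp: map_iso_def)
  interpret L: const_px n p V E L by fact
  interpret L1: const_px n p V E L1 by fact
  define M where "M = (\<lambda>i a b. \<sigma> (L i a b))"
  have M: "const_px n p V E M" unfolding M_def const_px_def by (rule L.image_labelled[OF g])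
  interpret M: const_px n p V E M by (rule M)
  have n4: "n \<noteq> 4" using d(1) by auto
  have per: "period \<beta> dvd n" for \<beta> using d by (simp add: period_def)
  have sub: "straight_faces \<alpha> False M \<subseteq> straight_faces (\<not> \<alpha>) False L1"
  proof
    fix f assume f: "f \<in> straight_faces \<alpha> False M"
    have "face_image \<sigma> ` quads_straight \<alpha> L = quads_straight \<alpha> M"
      using face_image_families[of \<sigma> L M] unfolding quads_straight_def M_def image_Un by simp
    then have "f \<in> quads_straight (\<not> \<alpha>) L1" using f im unfolding quads_straight_def by blast
    moreover have "f \<notin> quads L1"
    proof
      assume "f \<in> quads L1"
      then have "card f = 4" using L1.quad_cycle(2) unfolding quads_def by auto
      moreover have "card f = n \<or> card f = 2 * n" using M.straight_face_cycle(2)[OF f per] by auto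
      ultimately show False using n4 d by auto
    qed
    ultimately show "f \<in> straight_faces (\<not> \<alpha>) False L1" unfolding quads_straight_def by blast
  qed
  \<comment> \<open>Composing with \<psi> turns the labelling \<open>M\<close> into an automorphism
    applied to \<open>L1\<close>, so that preservation of fibres compares \<open>M\<close> with
    \<open>L1\<close>.\<close>
  obtain \<psi> where p: "graph_automorphism V E \<psi>" "\<And>i a b. \<psi> (L1 i a b) = L i a b"
    using relabel[OF L1[unfolded const_px_def] L[unfolded const_px_def]] by blast
  have "L1.fibre_preserving (\<sigma> \<circ> \<psi>)" by (rule L1.automorphism_preserves_fibres[OF n4 graph_automorphism_comp[OF g p(1)]])
  then have fib: "\<exists>c' d'. M i a' b' = L1 j c' d'" if "M i a b = L1 j c d" for i j a b c d a' b'
    using that unfolding L1.fibre_preserving_def o_apply p(2) M_def by blast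
  obtain j c d where j: "M 0 False False = L1 j c d" using M.L_in_V[of 0 False False] unfolding L1.V_eq by blast
  have "{L1 j c d, M 1 False False} \<in> E" using M.ed_in_E[of 0 False False False] by (simp add: ed_def j)
  then obtain x where x: "M 1 False False = L1 (j + 1) d x \<or> M 1 False False = L1 (j - 1) x c" using L1.nbr by blast
  \<comment> \<open>Taking \<open>N\<close> as \<open>L1\<close> or its reversal reduces both
    directions to a translation going upwards.\<close>
  have "\<exists>N k t. const_px n p V E N \<and> straight_faces (\<not> \<alpha>) False N = straight_faces (\<not> \<alpha>) False L1 \<and>
     M = (\<lambda>i a b. N (i + k) (a \<noteq> t i) (b \<noteq> t (i + 1)))"
    using x
  proof
    assume "M 1 False False = L1 (j + 1) d x"
    then have "M 0 False False = L1 (0 + j) c d" "M (0 + 1) False False = L1 (0 + j + 1) d x" using j by simp_all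
    note m = this
    have "\<exists>t. \<forall>i a b. M i a b = L1 (i + j) (a \<noteq> t i) (b \<noteq> t (i + 1))"
    proof (rule gauge_forward[OF L1.labelled_px_axioms M.labelled_px_axioms])
      show "\<exists>c' d'. M i a' b' = L1 j c' d'" if "M i a b = L1 j c d" for i j a b c d a' b' using fib[OF that] .
    qed (fact m)+
    then obtain t where "\<forall>i a b. M i a b = L1 (i + j) (a \<noteq> t i) (b \<noteq> t (i + 1))" by blast
    then have "M = (\<lambda>i a b. L1 (i + j) (a \<noteq> t i) (b \<noteq> t (i + 1)))" by blast
    then show ?thesis using L1 by blast
  next
    assume "M 1 False False = L1 (j - 1) x c"
    then have "M 0 False False = L1 (j - 0) c d" "M (0 + 1) False False = L1 (j - 0 - 1) x c" using j by simp_all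
    note m = this
    have "\<exists>t. \<forall>i a b. M i a b = L1 (j - i) (b \<noteq> t (i + 1)) (a \<noteq> t i)"
    proof (rule gauge_backward[OF L1.labelled_px_axioms M.labelled_px_axioms])
      show "\<exists>c' d'. M i a' b' = L1 j c' d'" if "M i a b = L1 j c d" for i j a b c d a' b' using fib[OF that] .
    qed (fact m)+
    then obtain t where t: "\<forall>i a b. M i a b = L1 (j - i) (b \<noteq> t (i + 1)) (a \<noteq> t i)" by blast
    have "M = (\<lambda>i a b. (\<lambda>i a b. L1 (- i) b a) (i + (- j)) (a \<noteq> t i) (b \<noteq> t (i + 1)))"
      using t by (intro ext) simp
    then show ?thesis using const_px_rev[OF L1] straight_faces_rev[of "\<not> \<alpha>" False L1] by blast
  qed
  then obtain N k t where N: "const_px n p V E N" "straight_faces (\<not> \<alpha>) False N = straight_faces (\<not> \<alpha>) False L1"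
    and MN: "M = (\<lambda>i a b. N (i + k) (a \<noteq> t i) (b \<noteq> t (i + 1)))" by blast
  interpret N: const_px n p V E N by (rule N(1))
  have ed: "ed M i a b c = ed N (i + k) (a \<noteq> t i) (b \<noteq> t (i + 1)) (c \<noteq> t (i + 2))" for i a b c
    unfolding MN by (rule ed_gauge)
  \<comment> \<open>One step along a straight face is read once in \<open>M\<close> and once in
    \<open>N\<close>; both readings give the mate of the same edge at the same vertex.\<close>
  have eq: "((a \<noteq> t 0) \<noteq> (\<not> \<alpha> \<and> (b \<noteq> t 1) \<noteq> (d \<noteq> t 2))) = ((a \<noteq> (\<alpha> \<and> b \<noteq> d)) \<noteq> t 3)" for a b d
  proof -
    obtain f where f: "f \<in> straight_faces \<alpha> False M" "ed M 0 a b d \<in> f" using M.straight_face_exists by blast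
    have f': "f \<in> straight_faces (\<not> \<alpha>) False N" using f(1) sub N(2) by blast
    have e0: "ed N k (a \<noteq> t 0) (b \<noteq> t 1) (d \<noteq> t 2) \<in> f" using f(2) unfolding ed by simp
    have e1: "ed N (k + 1) (b \<noteq> t 1) (d \<noteq> t 2) ((a \<noteq> (\<alpha> \<and> b \<noteq> d)) \<noteq> t 3) \<in> f"
      using M.straight_face_next(1)[OF f] unfolding ed by (simp add: add.commute)
    have e2: "ed N (k + 1) (b \<noteq> t 1) (d \<noteq> t 2) ((a \<noteq> t 0) \<noteq> (\<not> \<alpha> \<and> (b \<noteq> t 1) \<noteq> (d \<noteq> t 2))) \<in> f"
      using N.straight_face_next(1)[OF f' e0] by simp
    have ne: "ed N (k + 1) p q r \<noteq> ed N k p' q' r'" for p q r p' q' r' using N.ed_neq(1)[of "k + 1"] by simp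
    have "ed N (k + 1) (b \<noteq> t 1) (d \<noteq> t 2) ((a \<noteq> (\<alpha> \<and> b \<noteq> d)) \<noteq> t 3) = ed N (k + 1) (b \<noteq> t 1) (d \<noteq> t 2) ((a \<noteq> t 0) \<noteq> (\<not> \<alpha> \<and> (b \<noteq> t 1) \<noteq> (d \<noteq> t 2)))"
      by (rule is_cycle_unique_mate[OF M.straight_face_cycle(1)[OF f(1) per] e0 e1 e2, of "N (k + 1) (b \<noteq> t 1) (d \<noteq> t 2)"])
        (simp_all only: ne N.ed_mem simp_thms not_False_eq_True)
    then show ?thesis unfolding N.ed_eq_iff by blast
  qed
  \<comment> \<open>Changing \<open>b\<close> changes the left-hand side exactly if \<alpha> = 0 and
    the right-hand side exactly if \<alpha> = 1.\<close>
  show False using eq[of False False False] eq[of False True False] by argo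
qed

text \<open>Two straight families with \<alpha> = 1 or even \<open>n\<close> drop out because
  \<open>straight_swap\<close> would be a map automorphism exchanging them. The case
  \<open>n = 4\<close> goes through the cube, after the twist has been removed from the
  labelling.\<close>

lemma class_map_classification:
  assumes L: "const_px n p V E L" and F: "F \<in> class201_maps V E"
  shows "\<exists>p \<alpha> L'. const_px n p V E L' \<and> period \<alpha> dvd n \<and>
    (F = quads_straight \<alpha> L' \<and> (n = 4 \<longrightarrow> p) \<or> \<not> \<alpha> \<and> odd n \<and> F = straight_straight L')"
proof (cases "n = 4")
  case True
  obtain M where "const_px 4 False V E M" using const_px_retwist[OF L] True by blast
  then have "q4 V E M" by (simp add: q4_def)
  from q4.class_map_standard[OF this F] obtain L' where "const_px 4 True V E L'" "F = quads_straight True L'"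
    unfolding quads_straight_def by blast
  moreover have "period True dvd 4" by (simp add: period_def)
  ultimately show ?thesis using True by blast
next
  case False
  interpret const_px n p V E L by fact
  obtain FA FB where c: "class_map n (\<lambda>_. p) V E L F FA FB" using class_map_exists[OF F] by blast
  have fib: "\<forall>\<sigma>. map_aut V E F \<sigma> \<longrightarrow> fibre_preserving \<sigma>"
    using automorphism_preserves_fibres[OF False] by (simp add: map_aut_def)
  obtain q \<alpha> L' where h: "const_px n q V E L'" "period \<alpha> dvd n" and cs: "F = quads L' \<union> straight_faces \<alpha> False L' \<and>
        (\<forall>\<sigma> f. map_aut V E F \<sigma> \<longrightarrow> f \<in> quads L' \<longrightarrow> face_image \<sigma> f \<notin> straight_faces \<alpha> False L') \<or>
      F = straight_faces \<alpha> False L' \<union> straight_faces \<alpha> True L' \<and>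
        (\<forall>\<sigma> f. map_aut V E F \<sigma> \<longrightarrow> f \<in> straight_faces \<alpha> False L' \<longrightarrow> face_image \<sigma> f \<notin> straight_faces \<alpha> True L')"
    using class_map.classification[OF c fib] by (elim exE conjE)
  from cs show ?thesis
  proof (elim disjE conjE)
    assume "F = quads L' \<union> straight_faces \<alpha> False L'"
    then show ?thesis using h False unfolding quads_straight_def by blast
  next
    assume F': "F = straight_faces \<alpha> False L' \<union> straight_faces \<alpha> True L'"
      and n: "\<forall>\<sigma> f. map_aut V E F \<sigma> \<longrightarrow> f \<in> straight_faces \<alpha> False L' \<longrightarrow> face_image \<sigma> f \<notin> straight_faces \<alpha> True L'"
    have "\<not> (\<alpha> \<or> even n)"
    proof
      assume "\<alpha> \<or> even n"
      from straight_swap[OF h this] obtain \<sigma> where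
        s: "graph_automorphism V E \<sigma>" "\<forall>\<beta>. face_image \<sigma> ` straight_faces \<alpha> \<beta> L' = straight_faces \<alpha> (\<not> \<beta>) L'" by blast
      then have "map_aut V E F \<sigma>" unfolding map_aut_def F' by (simp add: image_Un Un_commute)
      moreover obtain f where f: "f \<in> straight_faces \<alpha> False L'" using const_px.straight_nonempty[OF h(1)] by blast
      moreover have "face_image \<sigma> f \<in> straight_faces \<alpha> True L'" using imageI[OF f, of "face_image \<sigma>"] s(2)[rule_format, of False] by simp
      ultimately show False using n by blast
    qed
    then have \<alpha>: "\<alpha> = False" and "odd n" by simp_all
    then show ?thesis using h F' unfolding straight_straight_def \<alpha> by blast
  qed
qed

section \<open>The Rose Window graph as a Praeger-Xu graph with twist\<close>

definition rw_vertex :: "nat \<Rightarrow> bool \<Rightarrow> int \<Rightarrow> bool \<times> nat" where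
  "rw_vertex n s k = (s, nat (k mod (2 * int n)))"

text \<open>The \<open>x\<close> vertices have \<open>a = b\<close>, the \<open>y\<close> vertices
  \<open>a \<noteq> b\<close>; an index modulo \<open>2 n\<close> combines a level modulo
  \<open>n\<close> with the bit \<open>a\<close>. The index of a \<open>y\<close> vertex is lowered
  by one so that the edge from \<open>x_k\<close> to \<open>y_k\<close> climbs one level. Adding
  \<open>n\<close> to the index flips \<open>a\<close>, so the twist is \<open>True\<close>.\<close>

definition rw_label :: "nat \<Rightarrow> int \<Rightarrow> bool \<Rightarrow> bool \<Rightarrow> bool \<times> nat" where
  "rw_label n i a b = rw_vertex n (a \<noteq> b) (i - of_bool (a \<noteq> b) + int n * of_bool a)"

lemma rw_vertex_eq_iff:
  assumes "n > 0"
  shows "rw_vertex n s k = rw_vertex n s' k' \<longleftrightarrow> s = s' \<and> 2 * int n dvd k - k'"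
proof -
  have "0 \<le> k mod (2 * int n)" "0 \<le> k' mod (2 * int n)" using assms by simp_all
  then have "nat (k mod (2 * int n)) = nat (k' mod (2 * int n)) \<longleftrightarrow> k mod (2 * int n) = k' mod (2 * int n)"
    by (simp add: eq_nat_nat_iff)
  then show ?thesis unfolding rw_vertex_def by (simp add: mod_eq_dvd_iff)
qed

lemma rw_vertex_nat: "rw_vertex n s (int k) = (s, k mod (2 * n))"
  unfolding rw_vertex_def by (metis nat_int of_nat_mult of_nat_numeral zmod_int)

lemma rw_edges_eq:
  assumes n: "n \<ge> 3"
  shows "rw_edges (2 * n) (n + 2) (n + 1) = {e. \<exists>k. e = {rw_vertex n False k, rw_vertex n False (k + 1)} \<or>
     e = {rw_vertex n True k, rw_vertex n True (k + int n + 1)} \<or> e = {rw_vertex n False k, rw_vertex n True k} \<or>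
     e = {rw_vertex n False k, rw_vertex n True (k + int n - 2)}}" (is "_ = ?R")
proof -
  let ?P = "\<lambda>k. {{rw_vertex n False k, rw_vertex n False (k + 1)}, {rw_vertex n True k, rw_vertex n True (k + int n + 1)},
     {rw_vertex n False k, rw_vertex n True k}, {rw_vertex n False k, rw_vertex n True (k + int n - 2)}}"
  have P: "?P (int i) = {{(False, i), (False, (i + 1) mod (2 * n))}, {(True, i), (True, (i + (n + 1)) mod (2 * n))},
       {(False, i), (True, i)}, {(False, i), (True, (i + 2 * n - (n + 2)) mod (2 * n))}}" if "i < 2 * n" for i
  proof -
    have e: "int i + 1 = int (i + 1)" "int i + int n + 1 = int (i + (n + 1))" "int i + int n - 2 = int (i + 2 * n - (n + 2))"
      using n by (simp_all add: of_nat_diff)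
    show ?thesis unfolding e rw_vertex_nat using that by simp
  qed
  have per: "?P k = ?P (k mod (2 * int n))" for k
  proof -
    have "rw_vertex n s (k mod (2 * int n) + c) = rw_vertex n s (k + c)" for s c
      unfolding rw_vertex_def by (simp add: mod_add_left_eq)
    from this[of _ 0] this[of _ 1] this[of _ "int n + 1"] this[of _ "int n - 2"] show ?thesis by (simp add: algebra_simps)
  qed
  have "rw_edges (2 * n) (n + 2) (n + 1) = (\<Union>i\<in>{..<2 * n}. ?P (int i))"
    unfolding rw_edges_def using P by (intro SUP_cong) auto
  also have "\<dots> = (\<Union>k. ?P k)"
  proof
    show "(\<Union>k. ?P k) \<subseteq> (\<Union>i\<in>{..<2 * n}. ?P (int i))"
    proof
      fix e assume "e \<in> (\<Union>k. ?P k)"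
      then obtain k where "e \<in> ?P k" by blast
      then have "e \<in> ?P (k mod (2 * int n))" using per[of k] by simp
      moreover have "0 \<le> k mod (2 * int n)" "k mod (2 * int n) < 2 * int n" using n by simp_all
      then have "nat (k mod (2 * int n)) < 2 * n" "int (nat (k mod (2 * int n))) = k mod (2 * int n)" by linarith+
      ultimately show "e \<in> (\<Union>i\<in>{..<2 * n}. ?P (int i))" by (intro UN_I[of "nat (k mod (2 * int n))"]) simp_all
    qed
  qed blast
  also have "\<dots> = ?R" by auto
  finally show ?thesis .
qed

lemma rose_window_const_px:
  assumes n: "n \<ge> 3"
  shows "const_px n True (rw_verts (2 * n)) (rw_edges (2 * n) (n + 2) (n + 1)) (rw_label n)"
  unfolding const_px_def
proof
  show "n \<ge> 3" by fact
  have n0: "n > 0" using n by simp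
  note v = rw_vertex_eq_iff[OF n0]
  fix i j :: int and a b c d :: bool
  show "rw_label n (i + int n) a b = rw_label n i (a \<noteq> True) (b \<noteq> True)"
    unfolding rw_label_def v by (cases a; cases b) simp_all
  show "int n dvd i - j" if e: "rw_label n i a b = rw_label n j c d"
  proof -
    have ab: "(a \<noteq> b) = (c \<noteq> d)" and "2 * int n dvd (i - of_bool (a \<noteq> b) + int n * of_bool a) - (j - of_bool (c \<noteq> d) + int n * of_bool c)"
      using e unfolding rw_label_def v by (rule conjunct1, rule conjunct2)
    then have "int n dvd (i - of_bool (a \<noteq> b) + int n * of_bool a) - (j - of_bool (c \<noteq> d) + int n * of_bool c)"
      by (metis dvd_mult_right)
    also have "\<dots> = (i - j) + int n * (of_bool a - of_bool c)" using ab by (simp add: algebra_simps)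
    finally show ?thesis by (simp add: dvd_add_left_iff)
  qed
  show "a = c \<and> b = d" if e: "rw_label n i a b = rw_label n i c d"
  proof -
    have ab: "(a \<noteq> b) = (c \<noteq> d)" and "2 * int n dvd (i - of_bool (a \<noteq> b) + int n * of_bool a) - (i - of_bool (c \<noteq> d) + int n * of_bool c)"
      using e unfolding rw_label_def v by (rule conjunct1, rule conjunct2)
    then have "2 * int n dvd int n * (of_bool a - of_bool c)" by (simp add: algebra_simps)
    then have "a = c" using n0 by (cases a; cases c) (auto dest: zdvd_imp_le)
    then show ?thesis using ab by blast
  qed
next
  have n0: "n > 0" using n by simp
  note v = rw_vertex_eq_iff[OF n0]
  show "rw_verts (2 * n) = {v. \<exists>i a b. v = rw_label n i a b}"
  proof (intro set_eqI iffI)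
    fix w assume "w \<in> rw_verts (2 * n)"
    then obtain s k where w: "w = (s, k)" "k < 2 * n" by (auto simp: rw_verts_def)
    then have "w = rw_label n (int k + of_bool s) False s"
      unfolding rw_label_def by (simp add: rw_vertex_nat)
    then show "w \<in> {v. \<exists>i a b. v = rw_label n i a b}" by blast
  next
    fix w assume "w \<in> {v. \<exists>i a b. v = rw_label n i a b}"
    then obtain i a b where "w = rw_label n i a b" by blast
    moreover have "nat (k mod (2 * int n)) < 2 * n" for k
      using n0 pos_mod_bound[of "2 * int n" k] by linarith
    ultimately show "w \<in> rw_verts (2 * n)" unfolding rw_label_def rw_vertex_def rw_verts_def by simp
  qed
  let ?x = "rw_vertex n False" and ?y = "rw_vertex n True"
  show "rw_edges (2 * n) (n + 2) (n + 1) = {e. \<exists>i a b c. e = ed (rw_label n) i a b c}" (is "_ = ?R")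
    unfolding rw_edges_eq[OF n]
  proof (intro set_eqI iffI)
    fix e assume "e \<in> {e. \<exists>k. e = {?x k, ?x (k + 1)} \<or> e = {?y k, ?y (k + int n + 1)} \<or> e = {?x k, ?y k} \<or> e = {?x k, ?y (k + int n - 2)}}"
    then obtain k where "e = {?x k, ?x (k + 1)} \<or> e = {?y k, ?y (k + int n + 1)} \<or> e = {?x k, ?y k} \<or> e = {?x k, ?y (k + int n - 2)}" by blast
    \<comment> \<open>One window of three bits for each of the four kinds of edges; in the last kind
      the \<open>y\<close> vertex is the lower end.\<close>
    moreover have "{?x k, ?x (k + 1)} = ed (rw_label n) k False False False" "{?y k, ?y (k + int n + 1)} = ed (rw_label n) (k + 1) False True False"
      "{?x k, ?y k} = ed (rw_label n) k False False True" "{?x k, ?y (k + int n - 2)} = ed (rw_label n) (k - 1) True False False"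
      by (simp_all add: ed_def rw_label_def insert_commute algebra_simps)
    ultimately show "e \<in> ?R" by blast
  next
    fix e assume "e \<in> ?R"
    then obtain i a b c where e: "e = ed (rw_label n) i a b c" by blast
    have "(\<exists>k. e = {?x k, ?x (k + 1)}) \<or> (\<exists>k. e = {?y k, ?y (k + int n + 1)}) \<or> (\<exists>k. e = {?x k, ?y k}) \<or> (\<exists>k. e = {?x k, ?y (k + int n - 2)})"
    proof (cases "a = b")
      case ab: True
      show ?thesis
      proof (cases "b = c")
        case True
        then have "e = {?x (i + int n * of_bool a), ?x (i + int n * of_bool a + 1)}"
          unfolding e ed_def rw_label_def using ab by (simp add: add_ac)
        then show ?thesis by blast
      next
        case False
        then have "e = {?x (i + int n * of_bool a), ?y (i + int n * of_bool a)}"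
          unfolding e ed_def rw_label_def using ab by simp
        then show ?thesis by blast
      qed
    next
      case ab: False
      show ?thesis
      proof (cases "b = c")
        case True
        let ?k = "i + 1 + int n * of_bool b"
        have "?y (i - 1 + int n * of_bool a) = ?y (?k + int n - 2)" unfolding v using ab by (cases a; cases b) simp_all
        then have "e = {?x ?k, ?y (?k + int n - 2)}"
          unfolding e ed_def rw_label_def using ab True by (simp add: insert_commute)
        then show ?thesis by blast
      next
        case False
        let ?k = "i - 1 + int n * of_bool a"
        have "?y (i + int n * of_bool b) = ?y (?k + int n + 1)" unfolding v using ab by (cases a; cases b) simp_all
        then have "e = {?y ?k, ?y (?k + int n + 1)}"
          unfolding e ed_def rw_label_def using ab False by simp
        then show ?thesis by blast
      qed
    qed
    then show "e \<in> {e. \<exists>k. e = {?x k, ?x (k + 1)} \<or> e = {?y k, ?y (k + int n + 1)} \<or> e = {?x k, ?y k} \<or> e = {?x k, ?y (k + int n - 2)}}"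
      by blast
  qed
qed

section \<open>Counting the isomorphism classes\<close>

lemma gcd_12_gt_2_iff: "gcd n 12 > 2 \<longleftrightarrow> 3 dvd n \<or> 4 dvd (n :: nat)"
proof
  define g where "g = gcd n 12"
  have g: "g dvd n" "g dvd 12" by (simp_all add: g_def)
  assume "gcd n 12 > 2"
  then have "g > 2" "g \<le> 12" using dvd_imp_le[OF g(2)] by (simp_all add: g_def)
  then have "g = 3 \<or> g = 4 \<or> g = 5 \<or> g = 6 \<or> g = 7 \<or> g = 8 \<or> g = 9 \<or> g = 10 \<or> g = 11 \<or> g = 12" by presburger
  then have "3 dvd g \<or> 4 dvd g" using g(2) by (elim disjE) simp_all
  then show "3 dvd n \<or> 4 dvd n" using g(1) dvd_trans by blast
next
  assume "3 dvd n \<or> 4 dvd n"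
  then have "3 dvd gcd n 12 \<or> 4 dvd gcd n 12" by auto
  then have "3 \<le> gcd n 12 \<or> 4 \<le> gcd n 12"
    using dvd_imp_le[of 3 "gcd n 12"] dvd_imp_le[of 4 "gcd n 12"] by (simp del: gcd_greatest_iff) blast
  then show "gcd n 12 > 2" by linarith
qed

theorem theorem3p6:
  fixes n :: nat
  assumes "n \<ge> 3"
  shows
   "(class201_maps (rw_verts (2*n)) (rw_edges (2*n) (n+2) (n+1)) \<noteq> {} \<longleftrightarrow> gcd n 12 > 2) \<and>
    (n = 4 \<longrightarrow> (\<exists>F. iso_classes_are (rw_verts (2*n)) (rw_edges (2*n) (n+2) (n+1)) [F] \<and>
                     face_lengths F = {4, 8})) \<and>
    (n mod 12 \<in> {3, 9} \<longrightarrow> (\<exists>F1 F2 F3.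
        iso_classes_are (rw_verts (2*n)) (rw_edges (2*n) (n+2) (n+1)) [F1, F2, F3] \<and>
        face_lengths F1 = {4, n} \<and> face_lengths F2 = {4, 2*n} \<and> face_lengths F3 = {n, 2*n})) \<and>
    (n mod 12 \<in> {4, 6, 8} \<and> n \<noteq> 4 \<longrightarrow> (\<exists>F1 F2.
        iso_classes_are (rw_verts (2*n)) (rw_edges (2*n) (n+2) (n+1)) [F1, F2] \<and>
        face_lengths F1 = {4, n} \<and> face_lengths F2 = {4, 2*n})) \<and>
    (n mod 12 = 0 \<longrightarrow> (\<exists>F1 F2 F3 F4.
        iso_classes_are (rw_verts (2*n)) (rw_edges (2*n) (n+2) (n+1)) [F1, F2, F3, F4] \<and>
        face_lengths F1 = {4, n} \<and> face_lengths F2 = {4, n} \<and>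
        face_lengths F3 = {4, 2*n} \<and> face_lengths F4 = {4, 2*n}))"
proof -
  define V where "V = rw_verts (2*n)"
  define E where "E = rw_edges (2*n) (n+2) (n+1)"
  have "const_px n True V E (rw_label n)" unfolding V_def E_def by (rule rose_window_const_px[OF assms])
  then have "\<forall>p. \<exists>L. const_px n p V E L" using const_px_retwist by blast
  then obtain L where L: "\<And>p. const_px n p V E (L p)" by metis
  \<comment> \<open>Labellings with equal twist give isomorphic maps, so one labelling per twist
    suffices. \<open>B\<close> is the only candidate with two straight families.\<close>
  define Q where "Q \<alpha> p = quads_straight \<alpha> (L p)" for \<alpha> p
  define B where "B = straight_straight (L False)"
  have Q: "Q \<alpha> p \<in> class201_maps V E" "face_lengths (Q \<alpha> p) = {4, if p then 2 * n else n}"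
    if "period \<alpha> dvd n" "n \<noteq> 4 \<or> p" for \<alpha> p
  proof -
    have l: "(if p then 2 * n else n) \<noteq> 4" using that(2) assms by auto
    show "Q \<alpha> p \<in> class201_maps V E" "face_lengths (Q \<alpha> p) = {4, if p then 2 * n else n}"
      unfolding Q_def quads_straight_def using const_px.quads_straight_map[OF L that(1) l] by simp_all
  qed
  have B: "B \<in> class201_maps V E" "face_lengths B = {n, 2 * n}" if "3 dvd n" "odd n"
    unfolding B_def straight_straight_def using const_px.straight_straight_map[OF L[of False] that] by simp_all
  \<comment> \<open>Every map is carried to the fixed labellings: next to quads both \<alpha> and
    \<open>p\<close> are kept, with two straight families the twist is first removed.\<close>
  have C: "(\<exists>p \<alpha>. period \<alpha> dvd n \<and> (n = 4 \<longrightarrow> p) \<and> map_iso V E F (Q \<alpha> p)) \<or> 3 dvd n \<and> odd n \<and> map_iso V E F B"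
    if F: "F \<in> class201_maps V E" for F
  proof -
    obtain p \<alpha> L' where h: "const_px n p V E L'" "period \<alpha> dvd n"
      "F = quads_straight \<alpha> L' \<and> (n = 4 \<longrightarrow> p) \<or> \<not> \<alpha> \<and> odd n \<and> F = straight_straight L'"
      using class_map_classification[OF L F] by blast
    from h(3) show ?thesis
    proof
      assume f: "F = quads_straight \<alpha> L' \<and> (n = 4 \<longrightarrow> p)"
      then have "map_iso V E F (Q \<alpha> p)" unfolding Q_def using standard_maps_iso(1)[OF h(1) L] by blast
      then show ?thesis using h(2) f by blast
    next
      assume f: "\<not> \<alpha> \<and> odd n \<and> F = straight_straight L'"
      then have d: "3 dvd n" "odd n" using h(2) by (simp_all add: period_def)
      obtain M where "const_px n False V E M" "straight_straight M = F" using straight_straight_untwist[OF h(1) d] f by blast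
      then have "map_iso V E F B" unfolding B_def using standard_maps_iso(2)[OF _ L] by blast
      then show ?thesis using d by blast
    qed
  qed
  have simple: "simple_graph V E" using labelled_px.simple[OF L[of True, unfolded const_px_def]] .
  have len: "\<not> map_iso V E F F'" if "F \<in> class201_maps V E" "face_lengths F \<noteq> face_lengths F'" for F F'
  proof
    assume i: "map_iso V E F F'"
    have "f \<subseteq> E" if "f \<in> F" for f
      using \<open>F \<in> class201_maps V E\<close> that by (auto simp: class201_maps_def is_polytopal_map_def is_cycle_def)
    from map_iso_face_lengths[OF simple this i] show False using that(2) by simp
  qed
  have per: "period \<alpha> dvd n \<longleftrightarrow> (if \<alpha> then 4 dvd n else 3 dvd n)" for \<alpha> by (simp add: period_def)
  have iff: "class201_maps V E \<noteq> {} \<longleftrightarrow> gcd n 12 > 2"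
    unfolding gcd_12_gt_2_iff
  proof
    assume "class201_maps V E \<noteq> {}"
    then show "3 dvd n \<or> 4 dvd n" using C per by (metis all_not_in_conv)
  next
    assume "3 dvd n \<or> 4 dvd n"
    \<comment> \<open>The twist \<open>True\<close> is taken because it gives a map of the class
      also for \<open>n = 4\<close>.\<close>
    then have "Q False True \<in> class201_maps V E \<or> Q True True \<in> class201_maps V E" using Q(1) per by auto
    then show "class201_maps V E \<noteq> {}" by blast
  qed
  have I: "\<exists>F. iso_classes_are V E [F] \<and> face_lengths F = {4, 8}" if n: "n = 4"
  proof (intro exI conjI)
    have p: "period True dvd n" using n per by simp
    show "face_lengths (Q True True) = {4, 8}" using Q(2)[OF p, of True] n by simp
    show "iso_classes_are V E [Q True True]"
      unfolding iso_classes_are_def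
    proof (intro conjI ballI)
      show "set [Q True True] \<subseteq> class201_maps V E" using Q(1)[OF p, of True] by simp
      fix F assume "F \<in> class201_maps V E"
      from C[OF this] obtain p \<alpha> where "period \<alpha> dvd n" "p" "map_iso V E F (Q \<alpha> p)" using n by auto
      then show "\<exists>G\<in>set [Q True True]. map_iso V E F G" using n per[of \<alpha>] by (cases \<alpha>) auto
    qed simp
  qed
  have II: "\<exists>F1 F2 F3. iso_classes_are V E [F1, F2, F3] \<and>
        face_lengths F1 = {4, n} \<and> face_lengths F2 = {4, 2*n} \<and> face_lengths F3 = {n, 2*n}" if n: "n mod 12 \<in> {3, 9}"
  proof (intro exI conjI)
    have "n mod 12 = 3 \<or> n mod 12 = 9" using n by simp
    then have d: "3 dvd n" "odd n" "\<not> 4 dvd n" "n \<noteq> 4" by presburger+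
    have p: "period False dvd n" using d per by simp
    note len3 = Q(2)[OF p, of False] Q(2)[OF p, of True] B(2)[OF d(1,2)]
    note mem3 = Q(1)[OF p, of False] Q(1)[OF p, of True] B(1)[OF d(1,2)]
    show "face_lengths (Q False False) = {4, n}" "face_lengths (Q False True) = {4, 2 * n}" "face_lengths B = {n, 2 * n}"
      using len3 d(4) by simp_all
    have ne: "{4, n} \<noteq> {4, 2 * n}" "{4, n} \<noteq> {n, 2 * n}" "{4, 2 * n} \<noteq> {n, 2 * n}" "n \<noteq> 4" "2 * n \<noteq> 4"
      using d assms by (auto simp: doubleton_eq_iff)
    show "iso_classes_are V E [Q False False, Q False True, B]"
      unfolding iso_classes_are_def
    proof (intro conjI ballI)
      show "set [Q False False, Q False True, B] \<subseteq> class201_maps V E" using mem3 d(4) by simp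
      show "\<forall>i<length [Q False False, Q False True, B]. \<forall>j<length [Q False False, Q False True, B]. i \<noteq> j \<longrightarrow>
        \<not> map_iso V E ([Q False False, Q False True, B] ! i) ([Q False False, Q False True, B] ! j)"
        using len mem3 len3 ne ne(1-3)[symmetric] by (auto simp: less_Suc_eq)
      fix F assume "F \<in> class201_maps V E"
      from C[OF this] show "\<exists>G\<in>set [Q False False, Q False True, B]. map_iso V E F G"
      proof
        assume "\<exists>p \<alpha>. period \<alpha> dvd n \<and> (n = 4 \<longrightarrow> p) \<and> map_iso V E F (Q \<alpha> p)"
        then obtain p \<alpha> where "period \<alpha> dvd n" "map_iso V E F (Q \<alpha> p)" by blast
        then show ?thesis using per[of \<alpha>] d(3) by (cases \<alpha>; cases p) auto
      qed simp
    qed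
  qed
  have III: "\<exists>F1 F2. iso_classes_are V E [F1, F2] \<and> face_lengths F1 = {4, n} \<and> face_lengths F2 = {4, 2*n}"
    if n: "n mod 12 \<in> {4, 6, 8} \<and> n \<noteq> 4"
  proof (intro exI conjI)
    \<comment> \<open>For these residues exactly one of 3 and 4 divides \<open>n\<close>, so one
      recurrence is available and the two twists give the two maps.\<close>
    define \<alpha> where "\<alpha> = (4 dvd n)"
    have d: "\<not> (3 dvd n \<and> odd n)" "3 dvd n \<longleftrightarrow> \<not> 4 dvd n" "n \<noteq> 4"
    proof -
      have m: "n mod 12 = 4 \<or> n mod 12 = 6 \<or> n mod 12 = 8" using n by simp
      then show "\<not> (3 dvd n \<and> odd n)" "3 dvd n \<longleftrightarrow> \<not> 4 dvd n" by presburger+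
    qed (use n in simp)
    have p: "period \<beta> dvd n \<longleftrightarrow> \<beta> = \<alpha>" for \<beta> using d per[of \<beta>] \<alpha>_def by auto
    have pa: "period \<alpha> dvd n" using p by simp
    note len2 = Q(2)[OF pa, of False] Q(2)[OF pa, of True]
    note mem2 = Q(1)[OF pa, of False] Q(1)[OF pa, of True]
    show "face_lengths (Q \<alpha> False) = {4, n}" "face_lengths (Q \<alpha> True) = {4, 2 * n}" using len2 d(3) by simp_all
    have ne: "{4, n} \<noteq> {4, 2 * n}" using d(3) assms by (auto simp: doubleton_eq_iff)
    show "iso_classes_are V E [Q \<alpha> False, Q \<alpha> True]"
      unfolding iso_classes_are_def
    proof (intro conjI ballI)
      show "set [Q \<alpha> False, Q \<alpha> True] \<subseteq> class201_maps V E" using mem2 d(3) by simp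
      show "\<forall>i<length [Q \<alpha> False, Q \<alpha> True]. \<forall>j<length [Q \<alpha> False, Q \<alpha> True]. i \<noteq> j \<longrightarrow>
        \<not> map_iso V E ([Q \<alpha> False, Q \<alpha> True] ! i) ([Q \<alpha> False, Q \<alpha> True] ! j)"
        using len mem2 len2 ne ne[symmetric] d(3) by (auto simp: less_Suc_eq)
      fix F assume "F \<in> class201_maps V E"
      from C[OF this] obtain q \<beta> where "period \<beta> dvd n" "map_iso V E F (Q \<beta> q)" using d(1) by blast
      then show "\<exists>G\<in>set [Q \<alpha> False, Q \<alpha> True]. map_iso V E F G" using p by (cases q) auto
    qed
  qed
  have IV: "\<exists>F1 F2 F3 F4. iso_classes_are V E [F1, F2, F3, F4] \<and> face_lengths F1 = {4, n} \<and> face_lengths F2 = {4, n} \<and>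
        face_lengths F3 = {4, 2*n} \<and> face_lengths F4 = {4, 2*n}" if n: "n mod 12 = 0"
  proof (intro exI conjI)
    have d: "3 dvd n" "4 dvd n" "even n" "n \<noteq> 4" using n by presburger+
    have p: "period \<alpha> dvd n" for \<alpha> using d per by simp
    have lenQ: "face_lengths (Q \<alpha> False) = {4, n}" "face_lengths (Q \<alpha> True) = {4, 2 * n}" for \<alpha>
      using Q(2)[OF p] d(4) by simp_all
    have mem: "Q \<alpha> q \<in> class201_maps V E" for \<alpha> q using Q(1)[OF p] d(4) by simp
    show "face_lengths (Q False False) = {4, n}" "face_lengths (Q True False) = {4, n}"
      "face_lengths (Q False True) = {4, 2 * n}" "face_lengths (Q True True) = {4, 2 * n}" by (rule lenQ)+
    have ne: "{4, n} \<noteq> {4, 2 * n}" using d(4) assms by (auto simp: doubleton_eq_iff)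
    \<comment> \<open>Equal twists give equal face lengths, so here the recurrences must be told
      apart; different twists are separated by the lengths in \<open>b\<close>.\<close>
    have a: "\<not> map_iso V E (Q False q) (Q True q)" "\<not> map_iso V E (Q True q) (Q False q)" for q
      unfolding Q_def using quads_straight_not_iso[OF L L d(1,2), of False q] quads_straight_not_iso[OF L L d(1,2), of True q]
      by simp_all
    have b: "\<not> map_iso V E (Q \<alpha> False) (Q \<beta> True)" "\<not> map_iso V E (Q \<alpha> True) (Q \<beta> False)" for \<alpha> \<beta>
      using len[OF mem] lenQ ne by metis+
    show "iso_classes_are V E [Q False False, Q True False, Q False True, Q True True]"
      unfolding iso_classes_are_def
    proof (intro conjI ballI)
      show "set [Q False False, Q True False, Q False True, Q True True] \<subseteq> class201_maps V E" using mem by simp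
      show "\<forall>i<length [Q False False, Q True False, Q False True, Q True True]. \<forall>j<length [Q False False, Q True False, Q False True, Q True True]. i \<noteq> j \<longrightarrow>
        \<not> map_iso V E ([Q False False, Q True False, Q False True, Q True True] ! i) ([Q False False, Q True False, Q False True, Q True True] ! j)"
        using a b by (auto simp: less_Suc_eq)
      fix F assume "F \<in> class201_maps V E"
      from C[OF this] obtain q \<beta> where "map_iso V E F (Q \<beta> q)" using d(3) by blast
      then show "\<exists>G\<in>set [Q False False, Q True False, Q False True, Q True True]. map_iso V E F G" by (cases q; cases \<beta>) auto
    qed
  qed
  show ?thesis using iff I II III IV unfolding V_def E_def by blast
qed

end
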